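(* Let $\eta,\xi>0$ and $0\le\tau<1$, and let $\nu$ be the RapidBeta rate measure on $[0,1]$ with $\alpha=1$, i.e. the measure with density $$\nu(w)=\frac{\eta}{1-\tau}\int_\tau^1\frac{s}{\Gamma(1-s)}\,w^{-1-s}(1-w)^{\xi-1}\,\mathrm{d}s .$$ Then the edge-exchangeable multigraph sequence constructed from a Poisson process of weights with rate measure $\nu$ is extremely sparse: there exists a slowly varying function $\ell$ such that, almost surely, as $t\to\infty$, $$N_t^{(e)}=\Theta\big(N_t\,\ell(N_t)\big),$$ where $N_t$ and $N_t^{(e)}$ are the numbers of vertices and of edges (counted with multiplicity) at step $t$.
   Context: Graph model. Let $\mathcal W=\{w_i\}_{i\ge 1}$ be an enumeration of the points of a Poisson point process on $[0,1]$ with rate (intensity) measure $\nu$. Vertices are indexed by $i\in\mathbb N$. Conditionally on $\mathcal W$, for every step $p=1,2,\dots$ and every unordered pair $\{i,j\}$ with $i\ne j$, let $m^p_{\{i,j\}}\sim\mathrm{Bernoulli}(w_iw_j)$, independently over all $p$ and all pairs (there are no self-loops). At step $p$, $m^p_{\{i,j\}}$ copies of the edge $\{i,j\}$ are added to the multigraph. Put $M^t_{\{i,j\}}=\sum_{p=1}^t m^p_{\{i,j\}}$. The number of vertices (only vertices with at least one incident edge are counted) and the number of edges at step $t$ are $$N_t=\sum_i \mathbf 1\Big\{\sum_{j\ne i}M^t_{\{i,j\}}>0\Big\},\qquad N_t^{(e)}=\frac12\sum_{i\ne j}M^t_{\{i,j\}}.$$ Notation. $\Gamma$ is the gamma function and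 $1/\Gamma(0)=0$. $f=\Theta(g)$ means that there are constants $0<C_1\le C_2$ with $C_1|g|\le|f|\le C_2|g|$ in a neighbourhood of the limit point; for random quantities this is required to hold almost surely (constants and neighbourhood may depend on the realization). A function $\ell:(0,\infty)\to(0,\infty)$ is slowly varying (at infinity) if $\ell(cx)/\ell(x)\to1$ as $x\to\infty$ for all $c>0$; only its values at large arguments matter here. The function $\ell$ in the claim is deterministic. *)

theory Defs
  imports "HOL-Probability.Probability" "HOL-Library.Landau_Symbols"
begin

section \<open>Poisson point processes\<close>

text \<open>Points are counted with multiplicity.\<close>

definition point_count :: "(nat \<Rightarrow> 'a \<Rightarrow> 'b) \<Rightarrow> 'b set \<Rightarrow> 'a \<Rightarrow> ennreal" where
  "point_count w B \<omega> = (\<Sum>i. indicator B (w i \<omega>))"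

text \<open>The random sequence \<open>w\<close> on the probability space \<open>M\<close> enumerates a Poisson point process
  with rate measure \<open>\<nu>\<close>. As the index type is \<^typ>\<open>nat\<close>, this is meant for rate measures of
  infinite total mass. The Poisson probabilities are written out because \<^const>\<open>poisson_pmf\<close>
  excludes rate 0.\<close>

definition poisson_point_process :: "'a measure \<Rightarrow> 'b measure \<Rightarrow> (nat \<Rightarrow> 'a \<Rightarrow> 'b) \<Rightarrow> bool" where
  "poisson_point_process M \<nu> w \<longleftrightarrow>
     prob_space M \<and>
     (\<forall>i. w i \<in> M \<rightarrow>\<^sub>M \<nu>) \<and>
     (\<forall>B\<in>sets \<nu>. emeasure \<nu> B < \<infinity> \<longrightarrow>
        (\<forall>k::nat. measure M {\<omega> \<in> space M. point_count w B \<omega> = of_nat k} =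
                    measure \<nu> B ^ k / fact k * exp (- measure \<nu> B))) \<and>
     (\<forall>B\<in>sets \<nu>. emeasure \<nu> B = \<infinity> \<longrightarrow> (AE \<omega> in M. point_count w B \<omega> = \<infinity>)) \<and>
     (\<forall>\<B>. finite \<B> \<and> \<B> \<subseteq> sets \<nu> \<and> disjoint \<B> \<longrightarrow>
        prob_space.indep_vars M (\<lambda>_. borel) (point_count w) \<B>)"

section \<open>The RapidBeta rate measure with \<open>\<alpha> = 1\<close>\<close>

text \<open>At \<open>s = 1\<close> the integrand is 0, since \<open>Gamma 0 = 0\<close> and \<open>1 / 0 = 0\<close>; this agrees with the
  convention \<open>1 / \<Gamma>(0) = 0\<close>.\<close>

definition rapid_beta_density :: "real \<Rightarrow> real \<Rightarrow> real \<Rightarrow> real \<Rightarrow> real" where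
  "rapid_beta_density \<eta> \<tau> \<xi> w =
     \<eta> / (1 - \<tau>) *
       (LINT s:{\<tau>..1}|lborel. s / Gamma (1 - s) * w powr (-1 - s) * (1 - w) powr (\<xi> - 1))"

definition rapid_beta :: "real \<Rightarrow> real \<Rightarrow> real \<Rightarrow> real measure" where
  "rapid_beta \<eta> \<tau> \<xi> =
     density (restrict_space lborel {0..1}) (\<lambda>w. ennreal (rapid_beta_density \<eta> \<tau> \<xi> w))"

section \<open>The edge-exchangeable multigraph sequence\<close>

text \<open>Unordered pairs \<open>{i, j}\<close> with \<open>i \<noteq> j\<close>.\<close>

definition vertex_pairs :: "nat set set" where
  "vertex_pairs = {{i, j} | i j. i \<noteq> j}"

definition weight_algebra :: "'a measure \<Rightarrow> (nat \<Rightarrow> 'a \<Rightarrow> real) \<Rightarrow> 'a measure" where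
  "weight_algebra M w = vimage_algebra (space M) (\<lambda>\<omega> i. w i \<omega>) (Pi\<^sub>M UNIV (\<lambda>_. borel))"

text \<open>\<open>m p {i, j}\<close> is the number of copies of the edge \<open>{i, j}\<close> added at step \<open>p\<close>; values of \<open>m\<close> at
  \<open>p = 0\<close> or outside \<^const>\<open>vertex_pairs\<close> are irrelevant. The last clause says that, conditionally
  on the sequence of weights, the variables \<open>m p {i, j}\<close> are independent with law
  Bernoulli(\<open>w\<^sub>i w\<^sub>j\<close>): it gives the conditional joint probability mass function of every finite
  subfamily.\<close>

definition edge_exchangeable_sequence ::
    "'a measure \<Rightarrow> real measure \<Rightarrow> (nat \<Rightarrow> 'a \<Rightarrow> real) \<Rightarrow> (nat \<Rightarrow> nat set \<Rightarrow> 'a \<Rightarrow> nat) \<Rightarrow> bool" where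
  "edge_exchangeable_sequence M \<nu> w m \<longleftrightarrow>
     poisson_point_process M \<nu> w \<and>
     (\<forall>p\<ge>1. \<forall>e\<in>vertex_pairs. m p e \<in> M \<rightarrow>\<^sub>M count_space UNIV) \<and>
     (\<forall>J v. finite J \<and> J \<subseteq> {1..} \<times> vertex_pairs \<longrightarrow>
        (AE \<omega> in M.
           real_cond_exp M (weight_algebra M w)
             (indicator {\<omega> \<in> space M. \<forall>(p, e)\<in>J. m p e \<omega> = v (p, e)}) \<omega> =
           (\<Prod>(p, e)\<in>J. pmf (map_pmf of_bool (bernoulli_pmf (\<Prod>i\<in>e. w i \<omega>))) (v (p, e)))))"

definition multiplicity_upto ::
    "(nat \<Rightarrow> nat set \<Rightarrow> 'a \<Rightarrow> nat) \<Rightarrow> nat \<Rightarrow> nat set \<Rightarrow> 'a \<Rightarrow> nat" where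
  "multiplicity_upto m t e \<omega> = (\<Sum>p=1..t. m p e \<omega>)"

definition num_vertices :: "(nat \<Rightarrow> nat set \<Rightarrow> 'a \<Rightarrow> nat) \<Rightarrow> nat \<Rightarrow> 'a \<Rightarrow> ennreal" where
  "num_vertices m t \<omega> =
     (\<Sum>i. of_bool ((\<Sum>j. if j \<noteq> i then of_nat (multiplicity_upto m t {i, j} \<omega>) else 0)
                     > (0 :: ennreal)))"

definition num_edges :: "(nat \<Rightarrow> nat set \<Rightarrow> 'a \<Rightarrow> nat) \<Rightarrow> nat \<Rightarrow> 'a \<Rightarrow> ennreal" where
  "num_edges m t \<omega> =
     (\<Sum>i. \<Sum>j. if j \<noteq> i then of_nat (multiplicity_upto m t {i, j} \<omega>) else 0) / 2"

section \<open>Slow variation at infinity\<close>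

text \<open>Only the values of \<open>l\<close> on the positive half-line matter.\<close>

definition slowly_varying :: "(real \<Rightarrow> real) \<Rightarrow> bool" where
  "slowly_varying l \<longleftrightarrow>
     (\<forall>x>0. l x > 0) \<and> (\<forall>c>0. ((\<lambda>x. l (c * x) / l x) \<longlongrightarrow> 1) at_top)"

end

theory Submission
  imports Defs "HOL-Real_Asymp.Real_Asymp"
begin

text \<open>
  The reason for the theorem is that almost surely the number of edges has order \<open>t\<close> and the number of vertices has
  order \<open>t / log t\<close>; then \<open>ln (1 + x)\<close> serves as the slowly varying function.

  The weights are summable, so given the weights a step adds edges with the finite positive mean
  \<open>\<Sum>i<j. w\<^sub>i w\<^sub>j\<close>, independently of the other steps. For the vertices the behaviour of the density at 0
  matters. As \<open>s / \<Gamma>(1 - s)\<close> has a simple zero at \<open>s = 1\<close>, the density is of order \<open>1 / (w log w)\<^sup>2\<close>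
  (\<open>rapid_beta_density_bounds\<close>). Hence \<open>O(t / log t)\<close> weights exceed \<open>1 / t\<close>, whereas the weights below \<open>1 / t\<close>,
  which belong to the light vertices, have a sum of order \<open>1 / log t\<close>. The edges at light vertices therefore
  number \<open>O(t / log t)\<close>, which bounds the number of vertices from above (\<open>num_vertices_le\<close>). From below it
  is bounded by the number of light vertices joined to a single vertex of positive weight, the hub: a light vertex
  is joined to it with conditional probability of order \<open>t\<close> times its weight.

  Both counts increase with \<open>t\<close>, so it suffices to bound them along \<open>t = 2 ^ k\<close>
  (\<open>bigtheta_of_dyadic_bounds\<close>). The randomness of the weights is removed first: the number of weights in each
  interval between consecutive powers of \<open>1 / 2\<close> is Poisson, and a tail bound with the Borel-Cantelli lemma
  controls all these numbers at once up to a random constant (\<open>AE_point_count_bounds\<close>). From then on the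
  weights enter only through these counts (\<open>level_bounded_weights\<close>). The randomness of the edges is handled by
  a conditional form of Chebyshev's inequality (\<open>cond_pairwise_concentration\<close>): the number of occurring events
  among conditionally pairwise independent ones has conditional variance at most its conditional mean. It is
  applied to all edges, to the edges at light vertices and to the neighbours of a hub.
\<close>

section \<open>Conditional probabilities and concentration\<close>

text \<open>\<open>p\<close> is a version, with values in the unit interval, of the conditional probability of \<open>E\<close> given \<open>F\<close>.
  Working with such versions on plain events, rather than with \<^const>\<open>real_cond_exp\<close>, makes the
  product formulas below pointwise identities between functions of the weights.\<close>

definition has_cond_prob :: "'a measure \<Rightarrow> 'a measure \<Rightarrow> 'a set \<Rightarrow> ('a \<Rightarrow> real) \<Rightarrow> bool" where
  "has_cond_prob M F E p \<longleftrightarrow>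
     E \<in> sets M \<and> p \<in> borel_measurable F \<and> (\<forall>\<omega>\<in>space M. 0 \<le> p \<omega> \<and> p \<omega> \<le> 1) \<and>
     (\<forall>A\<in>sets F. measure M (A \<inter> E) = (\<integral>\<omega>. indicator A \<omega> * p \<omega> \<partial>M))"

lemma has_cond_probD:
  assumes "has_cond_prob M F E p"
  shows "E \<in> sets M" "p \<in> borel_measurable F" "\<And>\<omega>. \<omega> \<in> space M \<Longrightarrow> 0 \<le> p \<omega>" "\<And>\<omega>. \<omega> \<in> space M \<Longrightarrow> p \<omega> \<le> 1"
    "\<And>A. A \<in> sets F \<Longrightarrow> measure M (A \<inter> E) = (\<integral>\<omega>. indicator A \<omega> * p \<omega> \<partial>M)"
  using assms by (auto simp: has_cond_prob_def)

context prob_space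
begin

lemma integrable_cond_prob:
  assumes "subalgebra M F" "has_cond_prob M F E p" "A \<in> sets F"
  shows "integrable M (\<lambda>\<omega>. indicator A \<omega> * p \<omega>)"
proof -
  note D = has_cond_probD[OF assms(2)]
  have [measurable]: "p \<in> borel_measurable M" "A \<in> sets M"
    using measurable_from_subalg[OF assms(1) D(2)] assms(1,3) by (auto simp: subalgebra_def)
  show ?thesis
    by (rule integrable_const_bound[where B = 1])
       (use D in \<open>auto intro!: AE_I2 split: split_indicator\<close>)
qed

text \<open>Both sides integrate \<open>f\<close> against measures on \<open>F\<close> that agree on every set of \<open>F\<close>; this carries the
  defining identity from indicators to unbounded test functions such as conditional means.\<close>

lemma has_cond_prob_nn_integral:
  assumes F: "subalgebra M F" and E: "has_cond_prob M F E p" and f: "f \<in> borel_measurable F"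
  shows "(\<integral>\<^sup>+\<omega>. f \<omega> * indicator E \<omega> \<partial>M) = (\<integral>\<^sup>+\<omega>. f \<omega> * ennreal (p \<omega>) \<partial>M)"
proof -
  note D = has_cond_probD[OF E]
  have sF: "space F = space M" and sub: "sets F \<subseteq> sets M" using F by (auto simp: subalgebra_def)
  have [measurable]: "p \<in> borel_measurable M" "E \<in> sets M" "f \<in> borel_measurable M"
    using measurable_from_subalg[OF F D(2)] measurable_from_subalg[OF F f] D(1) by auto
  let ?M1 = "density M (indicator E)" and ?M2 = "density M (\<lambda>\<omega>. ennreal (p \<omega>))"
  have sub1: "subalgebra ?M1 F" and sub2: "subalgebra ?M2 F"
    using F by (auto simp: subalgebra_def)
  have eq: "restr_to_subalg ?M1 F = restr_to_subalg ?M2 F"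
  proof (rule measure_eqI)
    show "sets (restr_to_subalg ?M1 F) = sets (restr_to_subalg ?M2 F)"
      using sets_restr_to_subalg[OF sub1] sets_restr_to_subalg[OF sub2] by simp
  next
    fix A assume "A \<in> sets (restr_to_subalg ?M1 F)"
    then have A: "A \<in> sets F" using sets_restr_to_subalg[OF sub1] by simp
    then have [measurable]: "A \<in> sets M" using sub by auto
    have "emeasure ?M1 A = (\<integral>\<^sup>+\<omega>. indicator E \<omega> * indicator A \<omega> \<partial>M)"
      by (rule emeasure_density) measurable
    also have "\<dots> = (\<integral>\<^sup>+\<omega>. indicator (A \<inter> E) \<omega> \<partial>M)"
      by (rule nn_integral_cong) (simp add: indicator_inter_arith mult.commute)
    also have "\<dots> = emeasure M (A \<inter> E)"
      by (rule nn_integral_indicator) measurable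
    also have "\<dots> = ennreal (measure M (A \<inter> E))"
      by (rule emeasure_eq_measure)
    also have "\<dots> = ennreal (\<integral>\<omega>. indicator A \<omega> * p \<omega> \<partial>M)"
      using D(5)[OF A] by simp
    also have "\<dots> = (\<integral>\<^sup>+\<omega>. ennreal (indicator A \<omega> * p \<omega>) \<partial>M)"
      by (rule nn_integral_eq_integral[symmetric, OF integrable_cond_prob[OF F E A]])
         (use D(3) in \<open>auto intro!: AE_I2\<close>)
    also have "\<dots> = emeasure ?M2 A"
      by (subst emeasure_density) (auto intro!: nn_integral_cong split: split_indicator)
    finally show "emeasure (restr_to_subalg ?M1 F) A = emeasure (restr_to_subalg ?M2 F) A"
      using emeasure_restr_to_subalg[OF sub1 A] emeasure_restr_to_subalg[OF sub2 A] by simp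
  qed
  have "(\<integral>\<^sup>+\<omega>. f \<omega> * indicator E \<omega> \<partial>M) = (\<integral>\<^sup>+\<omega>. f \<omega> \<partial>?M1)"
    by (subst nn_integral_density) (auto simp: mult.commute)
  also have "\<dots> = (\<integral>\<^sup>+\<omega>. f \<omega> \<partial>?M2)"
    using nn_integral_subalgebra2[OF sub1 f] nn_integral_subalgebra2[OF sub2 f] eq by simp
  also have "\<dots> = (\<integral>\<^sup>+\<omega>. f \<omega> * ennreal (p \<omega>) \<partial>M)"
    by (subst nn_integral_density) (auto simp: mult.commute)
  finally show ?thesis .
qed

lemma has_cond_prob_Int_subalgebra:
  assumes "subalgebra M F" "has_cond_prob M F E p" "C \<in> sets F"
  shows "has_cond_prob M F (E \<inter> C) (\<lambda>\<omega>. indicator C \<omega> * p \<omega>)"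
  unfolding has_cond_prob_def
proof (intro conjI ballI)
  note D = has_cond_probD[OF assms(2)]
  note [measurable] = D(2) assms(3)
  have "C \<in> sets M" using assms(1,3) by (auto simp: subalgebra_def)
  then show "E \<inter> C \<in> sets M" using D(1) by blast
  show "(\<lambda>\<omega>. indicator C \<omega> * p \<omega>) \<in> borel_measurable F" by measurable
  fix A assume "A \<in> sets F"
  then show "measure M (A \<inter> (E \<inter> C)) = (\<integral>\<omega>. indicator A \<omega> * (indicator C \<omega> * p \<omega>) \<partial>M)"
    using D(5)[of "A \<inter> C"] assms(3) by (simp add: indicator_inter_arith ac_simps)
qed (use has_cond_probD[OF assms(2)] in \<open>auto split: split_indicator\<close>)

lemma has_cond_prob_Diff:
  assumes F: "subalgebra M F" and E: "has_cond_prob M F E p" and E': "has_cond_prob M F E' p'"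
    and le: "\<And>\<omega>. \<omega> \<in> space M \<Longrightarrow> p' \<omega> \<le> p \<omega>" and "E' \<subseteq> E"
  shows "has_cond_prob M F (E - E') (\<lambda>\<omega>. p \<omega> - p' \<omega>)"
  unfolding has_cond_prob_def
proof (intro conjI ballI)
  note D = has_cond_probD[OF E] and D' = has_cond_probD[OF E']
  show "E - E' \<in> sets M" "(\<lambda>\<omega>. p \<omega> - p' \<omega>) \<in> borel_measurable F" using D(1,2) D'(1,2) by auto
  fix A assume A: "A \<in> sets F"
  then have "A \<in> sets M" using F by (auto simp: subalgebra_def)
  then have "measure M ((A \<inter> E) - (A \<inter> E')) = measure M (A \<inter> E) - measure M (A \<inter> E')"
    using D(1) D'(1) \<open>E' \<subseteq> E\<close> by (intro finite_measure_Diff) auto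
  moreover have "A \<inter> (E - E') = (A \<inter> E) - (A \<inter> E')" by auto
  ultimately show "measure M (A \<inter> (E - E')) = (\<integral>\<omega>. indicator A \<omega> * (p \<omega> - p' \<omega>) \<partial>M)"
    using integrable_cond_prob[OF F E A] integrable_cond_prob[OF F E' A] D(5)[OF A] D'(5)[OF A]
    by (simp add: algebra_simps)
next
  fix \<omega> assume \<omega>: "\<omega> \<in> space M"
  show "0 \<le> p \<omega> - p' \<omega>" using le[OF \<omega>] by simp
  show "p \<omega> - p' \<omega> \<le> 1"
    using has_cond_probD(4)[OF E \<omega>] has_cond_probD(3)[OF E' \<omega>] by simp
qed

lemma has_cond_prob_space:
  assumes "subalgebra M F"
  shows "has_cond_prob M F (space M) (\<lambda>_. 1)"
  unfolding has_cond_prob_def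
proof (intro conjI ballI)
  fix A assume "A \<in> sets F"
  then have "A \<in> sets M" using assms by (auto simp: subalgebra_def)
  then show "measure M (A \<inter> space M) = (\<integral>\<omega>. indicator A \<omega> * 1 \<partial>M)"
    by simp
qed auto

lemma has_cond_prob_cong:
  assumes "has_cond_prob M F E p" "subalgebra M F" "\<And>\<omega>. \<omega> \<in> space M \<Longrightarrow> p \<omega> = p' \<omega>" "E = E'"
  shows "has_cond_prob M F E' p'"
proof -
  have "p' \<in> borel_measurable F"
    using has_cond_probD(2)[OF assms(1)] assms(2,3)
    by (subst measurable_cong[where g = p]) (auto simp: subalgebra_def)
  moreover have "(\<integral>\<omega>. indicator A \<omega> * p \<omega> \<partial>M) = (\<integral>\<omega>. indicator A \<omega> * p' \<omega> \<partial>M)" for A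
    using assms(3) by (intro Bochner_Integration.integral_cong) auto
  ultimately show ?thesis using assms by (auto simp: has_cond_prob_def)
qed

lemma has_cond_prob_empty: "has_cond_prob M F {} (\<lambda>_. 0)"
  by (auto simp: has_cond_prob_def)

end

lemma borel_measurable_nn_integral_countable:
  fixes f :: "'i::countable \<Rightarrow> 'a \<Rightarrow> ennreal"
  assumes "\<And>i. f i \<in> borel_measurable M"
  shows "(\<lambda>x. \<integral>\<^sup>+i. f i x \<partial>count_space UNIV) \<in> borel_measurable M"
proof -
  interpret sigma_finite_measure "count_space (UNIV::'i set)"
    by (rule sigma_finite_measure_count_space_countable) simp
  have "(\<lambda>(x,i). f i x) \<in> borel_measurable (M \<Otimes>\<^sub>M count_space UNIV)"
    unfolding split_beta'
    by (rule measurable_compose_countable[where f = "\<lambda>i x. f i (fst x)" and g = snd])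
       (use assms in measurable)
  then show ?thesis by (rule borel_measurable_nn_integral)
qed

text \<open>Write \<open>X\<close> for the number of events that occur and \<open>\<mu>\<close> for its conditional mean. Expanding \<open>X\<^sup>2\<close> over pairs
  of events, the off-diagonal terms give at most \<open>\<mu>\<^sup>2\<close> and the diagonal gives \<open>\<mu>\<close>, while the cross term
  \<open>X \<mu>\<close> has the same integral as \<open>\<mu>\<^sup>2\<close>. So the conditional variance is at most \<open>\<mu>\<close>. Infinitely many events
  are allowed; the bound on \<open>\<mu>\<close> over \<open>A\<close> keeps the subtracted quantities finite.\<close>

lemma (in prob_space) cond_pairwise_second_moment:
  fixes B :: "'i::countable \<Rightarrow> 'a set" and p :: "'i \<Rightarrow> 'a \<Rightarrow> real"
  assumes F: "subalgebra M F"
    and one: "\<And>a. has_cond_prob M F (B a) (p a)"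
    and two: "\<And>a b. a \<noteq> b \<Longrightarrow> has_cond_prob M F (B a \<inter> B b) (\<lambda>\<omega>. p a \<omega> * p b \<omega>)"
    and A: "A \<in> sets F"
    and bound: "\<And>\<omega>. \<omega> \<in> A \<Longrightarrow> (\<integral>\<^sup>+a. ennreal (p a \<omega>) \<partial>count_space UNIV) \<le> ennreal K" and K: "0 \<le> K"
  defines "X \<equiv> \<lambda>\<omega>. \<integral>\<^sup>+a. indicator (B a) \<omega> \<partial>count_space UNIV"
    and "\<mu> \<equiv> \<lambda>\<omega>. \<integral>\<^sup>+a. ennreal (p a \<omega>) \<partial>count_space UNIV"
  shows "(\<integral>\<^sup>+\<omega>. indicator A \<omega> * ennreal ((enn2real (X \<omega>) - enn2real (\<mu> \<omega>))\<^sup>2) \<partial>M) \<le> ennreal K"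
    and "AE \<omega> in M. \<omega> \<in> A \<longrightarrow> X \<omega> < \<infinity>"
proof -
  have sub: "sets F \<subseteq> sets M" using F by (auto simp: subalgebra_def)
  note D = has_cond_probD[OF one]
  have [measurable]: "p a \<in> borel_measurable F" "B a \<in> sets M" for a using D by auto
  have p_M[measurable]: "p a \<in> borel_measurable M" for a
    using measurable_from_subalg[OF F D(2)] .
  have [measurable]: "A \<in> sets F" "A \<in> sets M" using A sub by auto
  have X[measurable]: "X \<in> borel_measurable M"
    unfolding X_def by (rule borel_measurable_nn_integral_countable) measurable
  have \<mu>F[measurable]: "\<mu> \<in> borel_measurable F" 
    unfolding \<mu>_def by (rule borel_measurable_nn_integral_countable) measurable
  have \<mu>M[measurable]: "\<mu> \<in> borel_measurable M" 
    using measurable_from_subalg[OF F \<mu>F] .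
  let ?I = "\<lambda>\<omega>. indicator A \<omega> :: ennreal"
  have lin: "(\<integral>\<^sup>+\<omega>. f \<omega> * X \<omega> \<partial>M) = (\<integral>\<^sup>+\<omega>. f \<omega> * \<mu> \<omega> \<partial>M)"
    if [measurable]: "f \<in> borel_measurable F" for f
  proof -
    have [measurable]: "f \<in> borel_measurable M" using measurable_from_subalg[OF F that] .
    have "(\<integral>\<^sup>+\<omega>. f \<omega> * X \<omega> \<partial>M) = (\<integral>\<^sup>+\<omega>. \<integral>\<^sup>+a. f \<omega> * indicator (B a) \<omega> \<partial>count_space UNIV \<partial>M)"
      unfolding X_def by (subst nn_integral_cmult) auto
    also have "\<dots> = (\<integral>\<^sup>+a. \<integral>\<^sup>+\<omega>. f \<omega> * indicator (B a) \<omega> \<partial>M \<partial>count_space UNIV)"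
      by (rule nn_integral_count_space_nn_integral) auto
    also have "\<dots> = (\<integral>\<^sup>+a. \<integral>\<^sup>+\<omega>. f \<omega> * ennreal (p a \<omega>) \<partial>M \<partial>count_space UNIV)"
      using has_cond_prob_nn_integral[OF F one that] by simp
    also have "\<dots> = (\<integral>\<^sup>+\<omega>. \<integral>\<^sup>+a. f \<omega> * ennreal (p a \<omega>) \<partial>count_space UNIV \<partial>M)"
      by (rule nn_integral_count_space_nn_integral[symmetric]) auto
    also have "\<dots> = (\<integral>\<^sup>+\<omega>. f \<omega> * \<mu> \<omega> \<partial>M)"
      unfolding \<mu>_def by (subst nn_integral_cmult) auto
    finally show ?thesis .
  qed
  have IX: "(\<integral>\<^sup>+\<omega>. ?I \<omega> * X \<omega> \<partial>M) = (\<integral>\<^sup>+\<omega>. ?I \<omega> * \<mu> \<omega> \<partial>M)"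
    by (rule lin) measurable
  have I\<mu>: "(\<integral>\<^sup>+\<omega>. ?I \<omega> * \<mu> \<omega> \<partial>M) \<le> ennreal K"
  proof -
    have "(\<integral>\<^sup>+\<omega>. ?I \<omega> * \<mu> \<omega> \<partial>M) \<le> (\<integral>\<^sup>+\<omega>. ennreal K \<partial>M)"
      by (intro nn_integral_mono) (use bound in \<open>auto simp: \<mu>_def split: split_indicator\<close>)
    then show ?thesis by (simp add: emeasure_space_1)
  qed
  have "AE \<omega> in M. ?I \<omega> * X \<omega> \<noteq> \<infinity>"
    using IX I\<mu> by (intro nn_integral_PInf_AE) (auto simp: top_unique)
  then show fin: "AE \<omega> in M. \<omega> \<in> A \<longrightarrow> X \<omega> < \<infinity>"
    by eventually_elim (auto simp: less_top)
  have sq: "(\<integral>\<^sup>+\<omega>. ?I \<omega> * (X \<omega> * X \<omega>) \<partial>M) \<le> (\<integral>\<^sup>+\<omega>. ?I \<omega> * (\<mu> \<omega> * \<mu> \<omega>) \<partial>M) + (\<integral>\<^sup>+\<omega>. ?I \<omega> * \<mu> \<omega> \<partial>M)"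
  proof -
    have "(\<integral>\<^sup>+\<omega>. ?I \<omega> * (X \<omega> * X \<omega>) \<partial>M) =
        (\<integral>\<^sup>+\<omega>. \<integral>\<^sup>+a. ?I \<omega> * (indicator (B a) \<omega> * X \<omega>) \<partial>count_space UNIV \<partial>M)"
      by (subst nn_integral_cmult, simp, subst nn_integral_multc, simp) (simp add: X_def)
    also have "\<dots> = (\<integral>\<^sup>+a. \<integral>\<^sup>+\<omega>. ?I \<omega> * (indicator (B a) \<omega> * X \<omega>) \<partial>M \<partial>count_space UNIV)"
      by (rule nn_integral_count_space_nn_integral) auto
    also have "\<dots> = (\<integral>\<^sup>+a. \<integral>\<^sup>+b. \<integral>\<^sup>+\<omega>. ?I \<omega> * (indicator (B a) \<omega> * indicator (B b) \<omega>) \<partial>M \<partial>count_space UNIV \<partial>count_space UNIV)"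
    proof (rule nn_integral_cong)
      fix a
      have "(\<integral>\<^sup>+\<omega>. ?I \<omega> * (indicator (B a) \<omega> * X \<omega>) \<partial>M) =
        (\<integral>\<^sup>+\<omega>. \<integral>\<^sup>+b. ?I \<omega> * (indicator (B a) \<omega> * indicator (B b) \<omega>) \<partial>count_space UNIV \<partial>M)"
        by (subst nn_integral_cmult, simp, subst nn_integral_cmult, simp) (simp add: X_def)
      also have "\<dots> = (\<integral>\<^sup>+b. \<integral>\<^sup>+\<omega>. ?I \<omega> * (indicator (B a) \<omega> * indicator (B b) \<omega>) \<partial>M \<partial>count_space UNIV)"
        by (rule nn_integral_count_space_nn_integral) auto
      finally show "(\<integral>\<^sup>+\<omega>. ?I \<omega> * (indicator (B a) \<omega> * X \<omega>) \<partial>M) = \<dots>" .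
    qed
    also have "\<dots> \<le> (\<integral>\<^sup>+a. \<integral>\<^sup>+b. ((\<integral>\<^sup>+\<omega>. ?I \<omega> * (ennreal (p a \<omega>) * ennreal (p b \<omega>)) \<partial>M)
          + (\<integral>\<^sup>+\<omega>. ?I \<omega> * ennreal (p a \<omega>) \<partial>M) * indicator {a} b) \<partial>count_space UNIV \<partial>count_space UNIV)"
    proof (intro nn_integral_mono)
      fix a b
      show "(\<integral>\<^sup>+\<omega>. ?I \<omega> * (indicator (B a) \<omega> * indicator (B b) \<omega>) \<partial>M) \<le>
         (\<integral>\<^sup>+\<omega>. ?I \<omega> * (ennreal (p a \<omega>) * ennreal (p b \<omega>)) \<partial>M)
          + (\<integral>\<^sup>+\<omega>. ?I \<omega> * ennreal (p a \<omega>) \<partial>M) * indicator {a} b"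
      proof (cases "a = b")
        case True
        have "(\<integral>\<^sup>+\<omega>. ?I \<omega> * (indicator (B a) \<omega> * indicator (B b) \<omega>) \<partial>M) = (\<integral>\<^sup>+\<omega>. ?I \<omega> * indicator (B a) \<omega> \<partial>M)"
          using True by (intro nn_integral_cong) (auto split: split_indicator)
        also have "\<dots> = (\<integral>\<^sup>+\<omega>. ?I \<omega> * ennreal (p a \<omega>) \<partial>M)"
          by (rule has_cond_prob_nn_integral[OF F one]) measurable
        finally show ?thesis using True by simp
      next
        case False
        have "(\<integral>\<^sup>+\<omega>. ?I \<omega> * (indicator (B a) \<omega> * indicator (B b) \<omega>) \<partial>M) = (\<integral>\<^sup>+\<omega>. ?I \<omega> * indicator (B a \<inter> B b) \<omega> \<partial>M)"
          by (intro nn_integral_cong) (auto split: split_indicator)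
        also have "\<dots> = (\<integral>\<^sup>+\<omega>. ?I \<omega> * ennreal (p a \<omega> * p b \<omega>) \<partial>M)"
          by (rule has_cond_prob_nn_integral[OF F two[OF False]]) measurable
        also have "\<dots> = (\<integral>\<^sup>+\<omega>. ?I \<omega> * (ennreal (p a \<omega>) * ennreal (p b \<omega>)) \<partial>M)"
          using D(3) by (intro nn_integral_cong) (auto simp: ennreal_mult)
        finally show ?thesis by simp
      qed
    qed
    also have "\<dots> = (\<integral>\<^sup>+a. (\<integral>\<^sup>+\<omega>. ?I \<omega> * (ennreal (p a \<omega>) * \<mu> \<omega>) \<partial>M)
          + (\<integral>\<^sup>+\<omega>. ?I \<omega> * ennreal (p a \<omega>) \<partial>M) \<partial>count_space UNIV)"
    proof (rule nn_integral_cong)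
      fix a
      have "(\<integral>\<^sup>+b. (\<integral>\<^sup>+\<omega>. ?I \<omega> * (ennreal (p a \<omega>) * ennreal (p b \<omega>)) \<partial>M) \<partial>count_space UNIV)
          = (\<integral>\<^sup>+\<omega>. \<integral>\<^sup>+b. ?I \<omega> * (ennreal (p a \<omega>) * ennreal (p b \<omega>)) \<partial>count_space UNIV \<partial>M)"
        by (rule nn_integral_count_space_nn_integral[symmetric]) auto
      also have "\<dots> = (\<integral>\<^sup>+\<omega>. ?I \<omega> * (ennreal (p a \<omega>) * \<mu> \<omega>) \<partial>M)"
        by (subst nn_integral_cmult, simp, subst nn_integral_cmult, simp) (simp add: \<mu>_def)
      finally show "(\<integral>\<^sup>+b. ((\<integral>\<^sup>+\<omega>. ?I \<omega> * (ennreal (p a \<omega>) * ennreal (p b \<omega>)) \<partial>M)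
          + (\<integral>\<^sup>+\<omega>. ?I \<omega> * ennreal (p a \<omega>) \<partial>M) * indicator {a} b) \<partial>count_space UNIV) = 
          (\<integral>\<^sup>+\<omega>. ?I \<omega> * (ennreal (p a \<omega>) * \<mu> \<omega>) \<partial>M) + (\<integral>\<^sup>+\<omega>. ?I \<omega> * ennreal (p a \<omega>) \<partial>M)"
        by (simp add: nn_integral_add nn_integral_cmult one_ennreal_def[symmetric])
    qed
    also have "\<dots> = (\<integral>\<^sup>+a. (\<integral>\<^sup>+\<omega>. ?I \<omega> * (ennreal (p a \<omega>) * \<mu> \<omega>) \<partial>M) \<partial>count_space UNIV)
          + (\<integral>\<^sup>+a. (\<integral>\<^sup>+\<omega>. ?I \<omega> * ennreal (p a \<omega>) \<partial>M) \<partial>count_space UNIV)"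
      by (rule nn_integral_add) auto
    also have "(\<integral>\<^sup>+a. (\<integral>\<^sup>+\<omega>. ?I \<omega> * (ennreal (p a \<omega>) * \<mu> \<omega>) \<partial>M) \<partial>count_space UNIV)
        = (\<integral>\<^sup>+\<omega>. \<integral>\<^sup>+a. ?I \<omega> * (ennreal (p a \<omega>) * \<mu> \<omega>) \<partial>count_space UNIV \<partial>M)"
      by (rule nn_integral_count_space_nn_integral[symmetric]) auto
    also have "\<dots> = (\<integral>\<^sup>+\<omega>. ?I \<omega> * (\<mu> \<omega> * \<mu> \<omega>) \<partial>M)"
      by (subst nn_integral_cmult, simp, subst nn_integral_multc, simp) (simp add: \<mu>_def)
    also have "(\<integral>\<^sup>+a. (\<integral>\<^sup>+\<omega>. ?I \<omega> * ennreal (p a \<omega>) \<partial>M) \<partial>count_space UNIV)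
        = (\<integral>\<^sup>+\<omega>. \<integral>\<^sup>+a. ?I \<omega> * ennreal (p a \<omega>) \<partial>count_space UNIV \<partial>M)"
      by (rule nn_integral_count_space_nn_integral[symmetric]) auto
    also have "\<dots> = (\<integral>\<^sup>+\<omega>. ?I \<omega> * \<mu> \<omega> \<partial>M)"
      by (subst nn_integral_cmult, simp) (simp add: \<mu>_def)
    finally show ?thesis .
  qed
  let ?V = "\<integral>\<^sup>+\<omega>. ?I \<omega> * ennreal ((enn2real (X \<omega>) - enn2real (\<mu> \<omega>))\<^sup>2) \<partial>M"
  let ?P = "\<integral>\<^sup>+\<omega>. ?I \<omega> * (\<mu> \<omega> * \<mu> \<omega>) \<partial>M"
  have cross: "(\<integral>\<^sup>+\<omega>. ?I \<omega> * \<mu> \<omega> * X \<omega> \<partial>M) = ?P"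
    using lin[of "\<lambda>\<omega>. ?I \<omega> * \<mu> \<omega>"] by (simp add: mult.assoc)
  \<comment> \<open>\<open>(X - \<mu>)\<^sup>2 + 2 X \<mu> = X\<^sup>2 + \<mu>\<^sup>2\<close> avoids subtraction of extended reals; \<open>2 P\<close> is cancelled at the end\<close>
  have "?V + (?P + ?P) = (\<integral>\<^sup>+\<omega>. ?I \<omega> * ennreal ((enn2real (X \<omega>) - enn2real (\<mu> \<omega>))\<^sup>2)
       + (?I \<omega> * \<mu> \<omega> * X \<omega> + ?I \<omega> * \<mu> \<omega> * X \<omega>) \<partial>M)"
    by (simp add: nn_integral_add cross)
  also have "\<dots> = (\<integral>\<^sup>+\<omega>. ?I \<omega> * (X \<omega> * X \<omega>) + ?I \<omega> * (\<mu> \<omega> * \<mu> \<omega>) \<partial>M)"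
  proof (rule nn_integral_cong_AE)
    show "AE \<omega> in M. ?I \<omega> * ennreal ((enn2real (X \<omega>) - enn2real (\<mu> \<omega>))\<^sup>2)
       + (?I \<omega> * \<mu> \<omega> * X \<omega> + ?I \<omega> * \<mu> \<omega> * X \<omega>) = ?I \<omega> * (X \<omega> * X \<omega>) + ?I \<omega> * (\<mu> \<omega> * \<mu> \<omega>)"
      using fin
    proof eventually_elim
      case (elim \<omega>)
      show ?case
      proof (cases "\<omega> \<in> A")
        case True
        have "\<mu> \<omega> < \<infinity>" using bound[OF True] by (auto simp: \<mu>_def intro: le_less_trans)
        then obtain u where u: "\<mu> \<omega> = ennreal u" "0 \<le> u" by (cases "\<mu> \<omega>") auto
        from True elim obtain x where x: "X \<omega> = ennreal x" "0 \<le> x" by (cases "X \<omega>") auto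
        have "(x - u)\<^sup>2 + (u * x + u * x) = x * x + u * u"
          by (simp add: power2_eq_square algebra_simps)
        then show ?thesis using True u x
          by (simp add: ennreal_mult[symmetric] ennreal_plus[symmetric] del: ennreal_plus)
      qed simp
    qed
  qed
  also have "\<dots> = (\<integral>\<^sup>+\<omega>. ?I \<omega> * (X \<omega> * X \<omega>) \<partial>M) + ?P"
    by (rule nn_integral_add) auto
  also have "\<dots> \<le> (?P + (\<integral>\<^sup>+\<omega>. ?I \<omega> * \<mu> \<omega> \<partial>M)) + ?P"
    using sq by (intro add_mono) auto
  also have "\<dots> \<le> ennreal K + (?P + ?P)"
    using I\<mu> by (simp add: ac_simps add_left_mono)
  finally have le: "?V + (?P + ?P) \<le> ennreal K + (?P + ?P)" .
  have "?P \<le> (\<integral>\<^sup>+\<omega>. ennreal (K * K) \<partial>M)"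
    by (intro nn_integral_mono) 
       (use bound K in \<open>auto simp: \<mu>_def ennreal_mult intro!: mult_mono split: split_indicator\<close>)
  then have "?P < \<infinity>" by (auto simp: emeasure_space_1 intro: le_less_trans)
  then have "?P + ?P \<noteq> \<infinity>" by auto
  with le show "?V \<le> ennreal K"
    by (simp add: add.commute[of _ "?P + ?P"] ennreal_add_left_cancel_le)
qed

text \<open>On the \<open>F\<close>-measurable set where all \<open>\<mu>\<^sub>k\<close> are at most \<open>n a\<^sub>k\<close>, the expected value of
  \<open>((X\<^sub>k - \<mu>\<^sub>k) / a\<^sub>k)\<^sup>2\<close> is at most \<open>n / a\<^sub>k\<close>, which is summable; hence these squares are almost surely
  summable there. Letting \<open>n\<close> run through the naturals turns the deterministic constant into a random one.\<close>

lemma (in prob_space) cond_pairwise_concentration: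
  fixes B :: "nat \<Rightarrow> 'i::countable \<Rightarrow> 'a set" and p :: "nat \<Rightarrow> 'i \<Rightarrow> 'a \<Rightarrow> real" and a :: "nat \<Rightarrow> real"
  assumes F: "subalgebra M F"
    and one: "\<And>k i. has_cond_prob M F (B k i) (p k i)"
    and two: "\<And>k i j. i \<noteq> j \<Longrightarrow> has_cond_prob M F (B k i \<inter> B k j) (\<lambda>\<omega>. p k i \<omega> * p k j \<omega>)"
    and a: "\<And>k. a k > 0" and a_sum: "summable (\<lambda>k. 1 / a k)"
  defines "X \<equiv> \<lambda>k \<omega>. \<integral>\<^sup>+i. indicator (B k i) \<omega> \<partial>count_space UNIV"
    and "\<mu> \<equiv> \<lambda>k \<omega>. \<integral>\<^sup>+i. ennreal (p k i \<omega>) \<partial>count_space UNIV"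
  shows "AE \<omega> in M. (\<exists>C. \<forall>k. \<mu> k \<omega> \<le> ennreal (C * a k)) \<longrightarrow>
     (\<forall>k. X k \<omega> < \<infinity>) \<and> (\<lambda>k. (enn2real (X k \<omega>) - enn2real (\<mu> k \<omega>)) / a k) \<longlonglongrightarrow> 0"
proof -
  have sub: "sets F \<subseteq> sets M" and sp: "space F = space M" using F by (auto simp: subalgebra_def)
  note D = has_cond_probD[OF one]
  have [measurable]: "p k i \<in> borel_measurable F" "B k i \<in> sets M" for k i using D by auto
  have X[measurable]: "X k \<in> borel_measurable M" for k
    unfolding X_def by (rule borel_measurable_nn_integral_countable) measurable
  have \<mu>F[measurable]: "\<mu> k \<in> borel_measurable F" for k
    unfolding \<mu>_def by (rule borel_measurable_nn_integral_countable) measurable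
  have \<mu>M[measurable]: "\<mu> k \<in> borel_measurable M" for k
    using measurable_from_subalg[OF F \<mu>F] .
  define A where "A n = {\<omega> \<in> space F. \<forall>k. \<mu> k \<omega> \<le> ennreal (real n * a k)}" for n :: nat
  have A[measurable]: "A n \<in> sets F" for n unfolding A_def by measurable
  have A_M[measurable]: "A n \<in> sets M" for n using A sub by blast
  let ?Z = "\<lambda>k \<omega>. ((enn2real (X k \<omega>) - enn2real (\<mu> k \<omega>)) / a k)\<^sup>2"
  have "AE \<omega> in M. \<omega> \<in> A n \<longrightarrow> (\<forall>k. X k \<omega> < \<infinity>) \<and> (\<lambda>k. (enn2real (X k \<omega>) - enn2real (\<mu> k \<omega>)) / a k) \<longlonglongrightarrow> 0" for n
  proof -
    have na: "0 \<le> real n * a k" for k using a[of k] by simp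
    have bd: "\<omega> \<in> A n \<Longrightarrow> \<mu> k \<omega> \<le> ennreal (real n * a k)" for k \<omega> by (auto simp: A_def)
    have fin: "AE \<omega> in M. \<forall>k. \<omega> \<in> A n \<longrightarrow> X k \<omega> < \<infinity>"
      unfolding AE_all_countable X_def
      by (intro allI cond_pairwise_second_moment(2)[OF F one two A _ na])
         (use bd in \<open>auto simp: \<mu>_def\<close>)
    have Vk: "(\<integral>\<^sup>+\<omega>. indicator (A n) \<omega> * ennreal (?Z k \<omega>) \<partial>M) \<le> ennreal (real n * (1 / a k))" for k
    proof -
      have "(\<integral>\<^sup>+\<omega>. indicator (A n) \<omega> * ennreal (?Z k \<omega>) \<partial>M) =
         (\<integral>\<^sup>+\<omega>. ennreal (1 / (a k)\<^sup>2) * (indicator (A n) \<omega> * ennreal ((enn2real (X k \<omega>) - enn2real (\<mu> k \<omega>))\<^sup>2)) \<partial>M)"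
        by (intro nn_integral_cong)
           (auto simp: power_divide ennreal_mult[symmetric] split: split_indicator)
      also have "\<dots> = ennreal (1 / (a k)\<^sup>2) * (\<integral>\<^sup>+\<omega>. indicator (A n) \<omega> * ennreal ((enn2real (X k \<omega>) - enn2real (\<mu> k \<omega>))\<^sup>2) \<partial>M)"
        by (rule nn_integral_cmult) measurable
      also have "\<dots> \<le> ennreal (1 / (a k)\<^sup>2) * ennreal (real n * a k)"
        unfolding X_def \<mu>_def
        by (intro mult_left_mono cond_pairwise_second_moment(1)[OF F one two A _ na])
           (use bd in \<open>auto simp: \<mu>_def\<close>)
      also have "\<dots> = ennreal (real n * (1 / a k))"
        using a[of k] na[of k] by (simp add: ennreal_mult[symmetric] power2_eq_square)
      finally show ?thesis .
    qed
    have "(\<integral>\<^sup>+\<omega>. (\<Sum>k. indicator (A n) \<omega> * ennreal (?Z k \<omega>)) \<partial>M)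
        = (\<Sum>k. \<integral>\<^sup>+\<omega>. indicator (A n) \<omega> * ennreal (?Z k \<omega>) \<partial>M)"
      by (rule nn_integral_suminf) measurable
    also have "\<dots> \<le> (\<Sum>k. ennreal (real n * (1 / a k)))"
      by (intro suminf_le Vk) auto
    also have "\<dots> = ennreal (\<Sum>k. real n * (1 / a k))"
      using a by (intro suminf_ennreal2 summable_mult a_sum) (auto simp: less_imp_le)
    finally have "(\<integral>\<^sup>+\<omega>. (\<Sum>k. indicator (A n) \<omega> * ennreal (?Z k \<omega>)) \<partial>M) \<noteq> \<infinity>"
      by (auto simp: top_unique)
    then have "AE \<omega> in M. (\<Sum>k. indicator (A n) \<omega> * ennreal (?Z k \<omega>)) \<noteq> \<infinity>"
      by (intro nn_integral_PInf_AE) auto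
    then show ?thesis using fin
    proof eventually_elim
      case (elim \<omega>)
      show ?case
      proof (intro impI conjI allI)
        assume w: "\<omega> \<in> A n"
        show "X k \<omega> < \<infinity>" for k using elim w by auto
        have "(\<Sum>k. ennreal (?Z k \<omega>)) \<noteq> \<infinity>" using elim w by simp
        then have "summable (\<lambda>k. ?Z k \<omega>)"
          by (intro summable_suminf_not_top) auto
        then have "(\<lambda>k. ?Z k \<omega>) \<longlonglongrightarrow> 0" by (rule summable_LIMSEQ_zero)
        then have "(\<lambda>k. sqrt (?Z k \<omega>)) \<longlonglongrightarrow> sqrt 0" by (rule tendsto_real_sqrt)
        then show "(\<lambda>k. (enn2real (X k \<omega>) - enn2real (\<mu> k \<omega>)) / a k) \<longlonglongrightarrow> 0"
          by (simp only: real_sqrt_abs real_sqrt_zero tendsto_rabs_zero_iff)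
      qed
    qed
  qed
  then have "AE \<omega> in M. \<forall>n. \<omega> \<in> A n \<longrightarrow> (\<forall>k. X k \<omega> < \<infinity>) \<and> (\<lambda>k. (enn2real (X k \<omega>) - enn2real (\<mu> k \<omega>)) / a k) \<longlonglongrightarrow> 0"
    by (intro AE_all_countable[THEN iffD2] allI)
  with AE_space show ?thesis
  proof eventually_elim
    case (elim \<omega>)
    show ?case
    proof
      assume "\<exists>C. \<forall>k. \<mu> k \<omega> \<le> ennreal (C * a k)"
      then obtain C where C: "\<And>k. \<mu> k \<omega> \<le> ennreal (C * a k)" by blast
      obtain n :: nat where n: "C \<le> real n" using real_arch_simple by blast
      have "\<mu> k \<omega> \<le> ennreal (real n * a k)" for k
        using C[of k] by (rule order_trans) (use n a[of k] in \<open>auto intro!: ennreal_leI mult_right_mono\<close>)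
      then have "\<omega> \<in> A n" unfolding A_def sp using elim(1) by blast
      then show "(\<forall>k. X k \<omega> < \<infinity>) \<and> (\<lambda>k. (enn2real (X k \<omega>) - enn2real (\<mu> k \<omega>)) / a k) \<longlonglongrightarrow> 0"
        using elim(2) by blast
    qed
  qed
qed

section \<open>The rate measure near zero\<close>

text \<open>Division by \<open>\<Gamma>(0) = 0\<close> yields 0, which is also the value of the entire function \<open>1 / \<Gamma>\<close> there, so
  the integrand is continuous up to \<open>s = 1\<close>.\<close>

lemma divide_Gamma_eq: "s / Gamma x = s * rGamma x" for x :: real
  by (simp add: Gamma_def field_simps)

lemma rGamma_measurable [measurable]: "(rGamma :: real \<Rightarrow> real) \<in> borel_measurable borel"
  by (intro borel_measurable_continuous_onI continuous_on_rGamma)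

lemma continuous_on_rGamma_compose [continuous_intros]:
  fixes f :: "'b :: topological_space \<Rightarrow> real"
  shows "continuous_on S f \<Longrightarrow> continuous_on S (\<lambda>x. rGamma (f x))"
  by (rule continuous_on_compose2[OF continuous_on_rGamma[of UNIV]]) auto

lemma rapid_beta_density_measurable [measurable]:
  "rapid_beta_density \<eta> \<tau> \<xi> \<in> borel_measurable borel"
proof -
  have "(\<lambda>w. \<integral>s. indicator {\<tau>..1} s *\<^sub>R
        (s * rGamma (1 - s) * w powr (- 1 - s) * (1 - w) powr (\<xi> - 1)) \<partial>lborel) \<in> borel_measurable borel"
    by (rule lborel.borel_measurable_lebesgue_integral) measurable
  then show ?thesis
    unfolding rapid_beta_density_def set_lebesgue_integral_def divide_Gamma_eq by measurable
qed

text \<open>The recursion \<open>1 / \<Gamma>(1 - s) = (1 - s) / \<Gamma>(2 - s)\<close> exhibits the simple zero at \<open>s = 1\<close>, which is responsible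
  for the logarithmic correction to \<open>1 / w\<^sup>2\<close>.\<close>

lemma rapid_beta_density_eq:
  assumes "0 < w"
  shows "rapid_beta_density \<eta> \<tau> \<xi> w = \<eta> / (1 - \<tau>) * (1 - w) powr (\<xi> - 1) *
    (integral {\<tau>..1} (\<lambda>s. s * (1 - s) * rGamma (2 - s) * w powr (- 1 - s)))"
proof -
  have eq: "s / Gamma (1 - s) * w powr (- 1 - s) * (1 - w) powr (\<xi> - 1) =
      (1 - w) powr (\<xi> - 1) * (s * (1 - s) * rGamma (2 - s) * w powr (- 1 - s))" for s :: real
    using rGamma_plus1[of "1 - s"] by (simp add: divide_Gamma_eq add.commute)
  have cont: "continuous_on {\<tau>..1} (\<lambda>s. s * (1 - s) * rGamma (2 - s) * w powr (- 1 - s))"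
    using assms by (intro continuous_intros) auto
  have "(LINT s:{\<tau>..1}|lborel. s * (1 - s) * rGamma (2 - s) * w powr (- 1 - s))
      = integral {\<tau>..1} (\<lambda>s. s * (1 - s) * rGamma (2 - s) * w powr (- 1 - s))"
    by (intro set_borel_integral_eq_integral borel_integrable_atLeastAtMost' cont)
  then show ?thesis
    unfolding rapid_beta_density_def eq by simp
qed

lemma rGamma_bounds:
  "\<exists>R1 R2. 0 < R1 \<and> (\<forall>s\<in>{0..1}. R1 \<le> rGamma (2 - s) \<and> rGamma (2 - s) \<le> (R2 :: real))"
proof -
  have cont: "continuous_on {0..1} (\<lambda>s::real. rGamma (2 - s))"
    by (intro continuous_intros)
  obtain s1 where s1: "s1 \<in> {0..1}" "\<forall>s\<in>{0..1}. rGamma (2 - s1) \<le> rGamma (2 - s :: real)"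
    using continuous_attains_inf[OF _ _ cont] by auto
  obtain s2 where s2: "s2 \<in> {0..1}" "\<forall>s\<in>{0..1}. rGamma (2 - s) \<le> rGamma (2 - s2 :: real)"
    using continuous_attains_sup[OF _ _ cont] by auto
  have "0 < rGamma (2 - s1)" using s1 by (simp add: rGamma_inverse_Gamma Gamma_real_pos)
  with s1 s2 show ?thesis by blast
qed

text \<open>The exponent is split with \<open>1 - ln w\<close> in place of \<open>- ln w\<close>, because \<open>1 - ln w\<close> stays away from 0 for all
  \<open>w \<le> 1\<close>; the remaining factor \<open>exp (1 - s)\<close> lies between 1 and \<open>e\<close>.\<close>

lemma powr_minus_one_minus:
  assumes "0 < (w::real)"
  shows "w powr (- 1 - s) = w powr (-2) * exp (- (1 - s) * (1 - ln w)) * exp (1 - s)"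
proof -
  have "(- 1 - s) * ln w = (-2) * ln w + - (1 - s) * (1 - ln w) + (1 - s)" by (simp add: algebra_simps)
  then have "exp ((- 1 - s) * ln w) = exp ((-2) * ln w) * exp (- (1 - s) * (1 - ln w)) * exp (1 - s)"
    by (simp only: exp_add)
  then show ?thesis using assms unfolding powr_def by simp
qed

text \<open>With \<open>u = 1 - s\<close> this is a piece of the integral of \<open>u exp (- u \<Lambda>)\<close> over the half-line, whose value is
  \<open>1 / \<Lambda>\<^sup>2\<close>.\<close>

lemma integral_weighted_exp_le:
  fixes \<Lambda> \<tau> :: real
  assumes "0 < \<Lambda>" "\<tau> \<le> 1"
  shows "integral {\<tau>..1} (\<lambda>s. (1 - s) * exp (- (1 - s) * \<Lambda>)) \<le> 1 / \<Lambda>\<^sup>2"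
proof -
  let ?F = "\<lambda>s. exp (- (1 - s) * \<Lambda>) * (1 + (1 - s) * \<Lambda>) / \<Lambda>\<^sup>2"
  have "((\<lambda>s. (1 - s) * exp (- (1 - s) * \<Lambda>)) has_integral ?F 1 - ?F \<tau>) {\<tau>..1}"
  proof (rule fundamental_theorem_of_calculus[OF assms(2)])
    fix s assume "s \<in> {\<tau>..1}"
    have "(?F has_real_derivative (1 - s) * exp (- (1 - s) * \<Lambda>)) (at s within {\<tau>..1})"
      using assms(1) by (auto intro!: derivative_eq_intros simp: field_simps power2_eq_square)
    then show "(?F has_vector_derivative (1 - s) * exp (- (1 - s) * \<Lambda>)) (at s within {\<tau>..1})"
      by (rule has_real_derivative_iff_has_vector_derivative[THEN iffD1])
  qed
  moreover have "0 \<le> ?F \<tau>" using assms by simp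
  ultimately show ?thesis by (simp add: integral_unique)
qed

text \<open>With \<open>\<Lambda> = 1 - ln w\<close>, the integral is, up to bounded factors, \<open>1 / w\<^sup>2\<close> times a Laplace integral of \<open>1 - s\<close> with
  parameter \<open>\<Lambda>\<close>, which has order \<open>1 / \<Lambda>\<^sup>2\<close>. For the lower bound only the values of \<open>s\<close> within \<open>\<delta> / \<Lambda>\<close> of 1 are kept: there the exponential
  is at least \<open>1 / e\<close>, and \<open>s \<ge> 1 / 2\<close> even when \<open>\<tau> = 0\<close>.\<close>

lemma rapid_beta_integral_bounds:
  fixes \<tau> :: real
  assumes "0 \<le> \<tau>" "\<tau> < 1"
  shows "\<exists>\<kappa>1 \<kappa>2. 0 < \<kappa>1 \<and> 0 < \<kappa>2 \<and> (\<forall>w. 0 < w \<and> w \<le> 1 \<longrightarrow>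
     \<kappa>1 * w powr (-2) / (1 - ln w)\<^sup>2 \<le> integral {\<tau>..1} (\<lambda>s. s * (1 - s) * rGamma (2 - s) * w powr (- 1 - s)) \<and>
     integral {\<tau>..1} (\<lambda>s. s * (1 - s) * rGamma (2 - s) * w powr (- 1 - s)) \<le> \<kappa>2 * w powr (-2) / (1 - ln w)\<^sup>2)"
proof -
  obtain R1 R2 :: real where R: "0 < R1"
    "\<And>s. 0 \<le> s \<Longrightarrow> s \<le> 1 \<Longrightarrow> R1 \<le> rGamma (2 - s)" "\<And>s. 0 \<le> s \<Longrightarrow> s \<le> 1 \<Longrightarrow> rGamma (2 - s) \<le> R2"
    using rGamma_bounds by (metis atLeastAtMost_iff)
  have R2: "0 < R2" using R(1) R(2)[of 0] R(3)[of 0] by simp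
  define \<delta> where "\<delta> = (1 - \<tau>) / 2"
  have \<delta>: "0 < \<delta>" "\<delta> \<le> 1/2" using assms by (auto simp: \<delta>_def)
  let ?\<kappa>1 = "R1 / 4 * exp (-1) * \<delta>\<^sup>2" and ?\<kappa>2 = "R2 * exp 1"
  show ?thesis
  proof (rule exI[of _ ?\<kappa>1], rule exI[of _ ?\<kappa>2], intro conjI allI impI)
    show "0 < ?\<kappa>1" "0 < ?\<kappa>2" using R \<delta> R2 by auto
    fix w :: real assume w: "0 < w \<and> w \<le> 1"
    define \<Lambda> where "\<Lambda> = 1 - ln w"
    have \<Lambda>: "1 \<le> \<Lambda>" using w by (simp add: \<Lambda>_def)
    let ?g = "\<lambda>s. s * (1 - s) * rGamma (2 - s) * w powr (- 1 - s)"
    have int: "?g integrable_on S" if "S = {a..b}" for S and a b :: real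
      unfolding that using w by (intro integrable_continuous_real continuous_intros) auto
    show "integral {\<tau>..1} ?g \<le> ?\<kappa>2 * w powr (-2) / (1 - ln w)\<^sup>2"
    proof -
      have "integral {\<tau>..1} ?g \<le> integral {\<tau>..1} (\<lambda>s. (R2 * exp 1 * w powr (-2)) * ((1 - s) * exp (- (1 - s) * \<Lambda>)))"
      proof (intro integral_le int[OF refl] integrable_continuous_real continuous_intros)
        fix s assume s: "s \<in> {\<tau>..1}"
        then have "s * (1 - s) * rGamma (2 - s) * w powr (- 1 - s) \<le> 1 * (1 - s) * R2 * (w powr (-2) * exp (- (1 - s) * \<Lambda>) * exp 1)"
          unfolding powr_minus_one_minus[OF conjunct1[OF w]] \<Lambda>_def using assms R(1) R(2)[of s] R(3)[of s]
          by (intro mult_mono) (auto intro!: mult_nonneg_nonneg)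
        then show "?g s \<le> (R2 * exp 1 * w powr (-2)) * ((1 - s) * exp (- (1 - s) * \<Lambda>))"
          by (simp add: mult_ac)
      qed
      also have "\<dots> = (R2 * exp 1 * w powr (-2)) * integral {\<tau>..1} (\<lambda>s. (1 - s) * exp (- (1 - s) * \<Lambda>))"
        by simp
      also have "\<dots> \<le> (R2 * exp 1 * w powr (-2)) * (1 / \<Lambda>\<^sup>2)"
        using R2 \<Lambda> assms by (intro mult_left_mono integral_weighted_exp_le) auto
      finally show ?thesis by (simp add: \<Lambda>_def)
    qed
    show "?\<kappa>1 * w powr (-2) / (1 - ln w)\<^sup>2 \<le> integral {\<tau>..1} ?g"
    proof -
      define \<epsilon> where "\<epsilon> = \<delta> / \<Lambda>"
      have \<epsilon>: "0 < \<epsilon>" "\<epsilon> \<le> \<delta>" "\<epsilon> * \<Lambda> \<le> 1"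
        using \<delta> \<Lambda> mult_left_mono[OF \<Lambda>, of \<delta>] by (auto simp: \<epsilon>_def divide_le_eq)
      have nonneg: "0 \<le> ?g s" if "s \<in> {\<tau>..1}" for s
        using that assms R(1) R(2)[of s] by (auto intro!: mult_nonneg_nonneg)
      have sub: "{1 - \<epsilon>..1} \<subseteq> {\<tau>..1}" using \<epsilon> \<delta> by (auto simp: \<delta>_def)
      have "((\<lambda>s::real. 1 - s) has_integral (- (1 - 1)\<^sup>2 / 2) - (- (1 - (1 - \<epsilon>))\<^sup>2 / 2)) {1 - \<epsilon>..1}"
        using \<epsilon>
        by (intro fundamental_theorem_of_calculus)
           (auto simp: has_real_derivative_iff_has_vector_derivative[symmetric] field_simps intro!: derivative_eq_intros)
      then have i: "integral {1 - \<epsilon>..1} (\<lambda>s. 1 - s) = \<epsilon>\<^sup>2 / 2" by (simp add: integral_unique)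
      have "?\<kappa>1 * w powr (-2) / (1 - ln w)\<^sup>2 = (R1 / 2 * exp (-1) * w powr (-2)) * integral {1 - \<epsilon>..1} (\<lambda>s. 1 - s)"
        unfolding i by (simp add: \<epsilon>_def \<Lambda>_def power_divide)
      also have "\<dots> = integral {1 - \<epsilon>..1} (\<lambda>s. (R1 / 2 * exp (-1) * w powr (-2)) * (1 - s))"
        by simp
      also have "\<dots> \<le> integral {1 - \<epsilon>..1} ?g"
      proof (intro integral_le int[OF refl] integrable_continuous_real continuous_intros)
        fix s assume s: "s \<in> {1 - \<epsilon>..1}"
        then have s': "1/2 \<le> s" "s \<le> 1" "0 \<le> s" using \<epsilon> \<delta> by auto
        have "(1 - s) * \<Lambda> \<le> \<epsilon> * \<Lambda>" using s \<Lambda> by (intro mult_right_mono) auto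
        then have "(1 - s) * (1 - ln w) \<le> 1" using \<epsilon>(3) unfolding \<Lambda>_def by linarith
        then have e: "exp (-1) \<le> exp (- (1 - s) * (1 - ln w))"
          unfolding exp_le_cancel_iff minus_mult_left[symmetric] by linarith
        have "(1/2) * (1 - s) * R1 * (w powr (-2) * exp (-1) * 1) \<le> s * (1 - s) * rGamma (2 - s) * w powr (- 1 - s)"
          unfolding powr_minus_one_minus[OF conjunct1[OF w]] using s' R(1) R(2)[of s] e
          by (intro mult_mono) (auto intro!: mult_nonneg_nonneg)
        then show "(R1 / 2 * exp (-1) * w powr (-2)) * (1 - s) \<le> ?g s"
          by (simp add: mult_ac)
      qed
      also have "\<dots> \<le> integral {\<tau>..1} ?g"
        by (intro integral_subset_le sub int[OF refl] ballI nonneg)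
      finally show ?thesis .
    qed
  qed
qed

lemma rapid_beta_density_bounds:
  fixes \<eta> \<tau> \<xi> :: real
  assumes "0 < \<eta>" "0 \<le> \<tau>" "\<tau> < 1"
  shows "\<exists>\<kappa>1 \<kappa>2. 0 < \<kappa>1 \<and> 0 < \<kappa>2 \<and> (\<forall>w. 0 < w \<and> w \<le> 1 \<longrightarrow>
     \<kappa>1 * w powr (-2) / (1 - ln w)\<^sup>2 * (1 - w) powr (\<xi> - 1) \<le> rapid_beta_density \<eta> \<tau> \<xi> w \<and>
     rapid_beta_density \<eta> \<tau> \<xi> w \<le> \<kappa>2 * w powr (-2) / (1 - ln w)\<^sup>2 * (1 - w) powr (\<xi> - 1))"
proof -
  obtain \<kappa>1 \<kappa>2 where \<kappa>: "0 < \<kappa>1" "0 < \<kappa>2"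
     "\<And>w. 0 < w \<Longrightarrow> w \<le> 1 \<Longrightarrow> \<kappa>1 * w powr (-2) / (1 - ln w)\<^sup>2 \<le> integral {\<tau>..1} (\<lambda>s. s * (1 - s) * rGamma (2 - s) * w powr (- 1 - s))"
     "\<And>w. 0 < w \<Longrightarrow> w \<le> 1 \<Longrightarrow> integral {\<tau>..1} (\<lambda>s. s * (1 - s) * rGamma (2 - s) * w powr (- 1 - s)) \<le> \<kappa>2 * w powr (-2) / (1 - ln w)\<^sup>2"
    using rapid_beta_integral_bounds[OF assms(2,3)] by blast
  show ?thesis
  proof (rule exI[of _ "\<eta> / (1 - \<tau>) * \<kappa>1"], rule exI[of _ "\<eta> / (1 - \<tau>) * \<kappa>2"], intro conjI allI impI)
    show "0 < \<eta> / (1 - \<tau>) * \<kappa>1" "0 < \<eta> / (1 - \<tau>) * \<kappa>2" using assms \<kappa> by auto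
    fix w :: real assume w: "0 < w \<and> w \<le> 1"
    have c: "0 \<le> \<eta> / (1 - \<tau>) * (1 - w) powr (\<xi> - 1)" using assms by simp
    show "\<eta> / (1 - \<tau>) * \<kappa>1 * w powr (-2) / (1 - ln w)\<^sup>2 * (1 - w) powr (\<xi> - 1) \<le> rapid_beta_density \<eta> \<tau> \<xi> w"
      using mult_left_mono[OF \<kappa>(3)[of w] c] w by (simp add: rapid_beta_density_eq mult_ac)
    show "rapid_beta_density \<eta> \<tau> \<xi> w \<le> \<eta> / (1 - \<tau>) * \<kappa>2 * w powr (-2) / (1 - ln w)\<^sup>2 * (1 - w) powr (\<xi> - 1)"
      using mult_left_mono[OF \<kappa>(4)[of w] c] w by (simp add: rapid_beta_density_eq mult_ac)
  qed
qed

lemma sets_rapid_beta: "sets (rapid_beta \<eta> \<tau> \<xi>) = sets (restrict_space borel {0..1})"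
  by (simp add: rapid_beta_def sets_restrict_space)

lemma space_rapid_beta: "space (rapid_beta \<eta> \<tau> \<xi>) = {0..1}"
  by (simp add: rapid_beta_def space_restrict_space)

lemma emeasure_rapid_beta:
  assumes "B \<in> sets borel" "B \<subseteq> {0..1}"
  shows "emeasure (rapid_beta \<eta> \<tau> \<xi>) B = (\<integral>\<^sup>+x. ennreal (rapid_beta_density \<eta> \<tau> \<xi> x) * indicator B x \<partial>lborel)"
proof -
  have B: "B \<in> sets (restrict_space lborel {0..1})"
    using assms by (auto simp: sets_restrict_space_iff)
  have "emeasure (rapid_beta \<eta> \<tau> \<xi>) B = 
    (\<integral>\<^sup>+x. ennreal (rapid_beta_density \<eta> \<tau> \<xi> x) * indicator B x \<partial>restrict_space lborel {0..1})"
    unfolding rapid_beta_def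
    by (rule emeasure_density[OF _ B]) (intro measurable_restrict_space1, measurable)
  also have "\<dots> = (\<integral>\<^sup>+x. ennreal (rapid_beta_density \<eta> \<tau> \<xi> x) * indicator B x * indicator {0..1} x \<partial>lborel)"
    by (rule nn_integral_restrict_space) simp
  also have "\<dots> = (\<integral>\<^sup>+x. ennreal (rapid_beta_density \<eta> \<tau> \<xi> x) * indicator B x \<partial>lborel)"
    using assms(2) by (intro nn_integral_cong) (auto split: split_indicator)
  finally show ?thesis .
qed

definition dyadic :: "nat \<Rightarrow> real set" where
  "dyadic l = {1 / 2 ^ Suc l <.. 1 / 2 ^ l}"

text \<open>The order of magnitude of the rate measure of \<open>dyadic l\<close>. The denominator is \<open>(l + 1) (l + 2)\<close>, not
  \<open>l\<^sup>2\<close>, so that the series of \<open>level_size l / 2 ^ l\<close> telescopes.\<close>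

definition level_size :: "nat \<Rightarrow> real" where
  "level_size l = 2 ^ l / (real (Suc l) * real (Suc (Suc l)))"

lemma level_size_pos: "0 < level_size l"
  by (simp add: level_size_def)

lemma dyadic_pos: "w \<in> dyadic l \<Longrightarrow> 0 < w"
  by (auto simp: dyadic_def intro: less_trans[rotated])

lemma dyadic_density_bounds:
  assumes w: "w \<in> dyadic l"
  shows "level_size l * 2 ^ l / 2 \<le> w powr (-2) / (1 - ln w)\<^sup>2"
    and "w powr (-2) / (1 - ln w)\<^sup>2 \<le> 16 * (level_size l * 2 ^ l)"
proof -
  have w0: "0 < w" by (rule dyadic_pos[OF w])
  have w1: "1 / 2 ^ Suc l < w" "w \<le> 1 / 2 ^ l" using w by (auto simp: dyadic_def)
  have P: "w powr (-2) = (1 / w)\<^sup>2" using w0 by (simp add: powr_minus powr_numeral power_divide field_simps)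
  have r: "2 ^ l \<le> 1 / w" "1 / w \<le> 2 * 2 ^ l" using w0 w1 by (auto simp: field_simps)
  have lw: "- ln w = ln (1 / w)" using w0 by (simp add: ln_div)
  have "ln (2 ^ l) \<le> ln (1 / w)" using r(1) w0 by (subst ln_le_cancel_iff) auto
  then have "real l * ln 2 \<le> - ln w" using lw by (simp add: ln_realpow)
  moreover have "real l * (1/2) \<le> real l * ln 2" using ln2_ge_two_thirds by (intro mult_left_mono) auto
  ultimately have L1: "real (Suc (Suc l)) / 2 \<le> 1 - ln w" by simp
  have "ln (1 / w) \<le> ln (2 ^ Suc l)" using r w0 by (subst ln_le_cancel_iff) auto
  then have "- ln w \<le> real (Suc l) * ln 2" unfolding lw by (subst (asm) ln_realpow) auto
  also have "\<dots> \<le> real (Suc l) * 1" using ln_2_less_1 by (intro mult_left_mono) auto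
  finally have L2: "1 - ln w \<le> real (Suc (Suc l))" by simp
  have L0: "0 < 1 - ln w" using L1 by simp
  have "(1 - ln w)\<^sup>2 \<le> (real (Suc (Suc l)))\<^sup>2" using L2 L0 by (intro power_mono) auto
  also have "\<dots> \<le> 2 * (real (Suc l) * real (Suc (Suc l)))" by (simp add: power2_eq_square algebra_simps)
  finally have U: "(1 - ln w)\<^sup>2 \<le> 2 * (real (Suc l) * real (Suc (Suc l)))" .
  have "real (Suc l) * real (Suc (Suc l)) / 4 \<le> (real (Suc (Suc l)) / 2)\<^sup>2"
    by (simp add: power2_eq_square algebra_simps)
  also have "\<dots> \<le> (1 - ln w)\<^sup>2" using L1 by (intro power_mono) auto
  finally have V: "real (Suc l) * real (Suc (Suc l)) / 4 \<le> (1 - ln w)\<^sup>2" .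
  have "(2 ^ l)\<^sup>2 / (2 * (real (Suc l) * real (Suc (Suc l)))) \<le> (1 / w)\<^sup>2 / (1 - ln w)\<^sup>2"
    using r U L0 by (intro frac_le power_mono) auto
  then show "level_size l * 2 ^ l / 2 \<le> w powr (-2) / (1 - ln w)\<^sup>2"
    unfolding P by (simp add: level_size_def power2_eq_square mult_ac)
  have "(1 / w)\<^sup>2 / (1 - ln w)\<^sup>2 \<le> (2 * 2 ^ l)\<^sup>2 / (real (Suc l) * real (Suc (Suc l)) / 4)"
    using r V w0 by (intro frac_le power_mono) auto
  then show "w powr (-2) / (1 - ln w)\<^sup>2 \<le> 16 * (level_size l * 2 ^ l)"
    unfolding P by (simp add: level_size_def power2_eq_square mult_ac)
qed

lemma nn_integral_beta_tail:
  assumes "0 < (\<xi>::real)"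
  shows "(\<integral>\<^sup>+w. ennreal ((1 - w) powr (\<xi> - 1)) * indicator {0..1} w \<partial>lborel) = ennreal (1 / \<xi>)"
proof -
  have "(\<integral>\<^sup>+w. ennreal ((1 - w) powr (\<xi> - 1)) * indicator {0..1} w \<partial>lborel)
    = ennreal \<bar>-1\<bar> * (\<integral>\<^sup>+w. ennreal ((1 - (1 + (-1) * w)) powr (\<xi> - 1)) * indicator {0..1} (1 + (-1) * w) \<partial>lborel)"
    by (rule nn_integral_real_affine[where t = 1 and c = "-1"]) auto
  also have "\<dots> = (\<integral>\<^sup>+w. ennreal (w powr (\<xi> - 1)) * indicator {0..1} w \<partial>lborel)"
    by (auto intro!: nn_integral_cong split: split_indicator)
  also have "\<dots> = ennreal (1 powr (\<xi> - 1 + 1) / (\<xi> - 1 + 1))"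
    using assms by (intro nn_integral_has_integral_lebesgue' has_integral_powr_from_0) auto
  finally show ?thesis by simp
qed

lemma dyadic_sub: "dyadic l \<subseteq> {0..1}"
proof
  fix x assume x: "x \<in> dyadic l"
  have "(1::real) / 2 ^ l \<le> 1" by (simp add: divide_le_eq)
  moreover have "x \<le> 1 / 2 ^ l" using x by (simp add: dyadic_def)
  ultimately show "x \<in> {0..1}" using dyadic_pos[OF x] unfolding atLeastAtMost_iff by linarith
qed

lemma dyadic_borel [measurable]: "dyadic l \<in> sets borel"
  by (simp add: dyadic_def)

lemma emeasure_dyadic: "emeasure lborel (dyadic l) = ennreal (1 / 2 ^ Suc l)"
  by (simp add: dyadic_def field_simps)

lemma powr_half_bounds:
  fixes y :: real
  assumes "1/2 \<le> y" "y \<le> 1"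
  shows "2 powr (- \<bar>a\<bar>) \<le> y powr a" "y powr a \<le> 2 powr \<bar>a\<bar>"
proof -
  have "2 powr (- \<bar>a\<bar>) = (1/2) powr \<bar>a\<bar>" by (simp add: powr_minus powr_divide field_simps)
  also have "\<dots> \<le> y powr \<bar>a\<bar>" using assms by (intro powr_mono2) auto
  also have "\<dots> \<le> y powr a" using assms by (intro powr_mono') auto
  finally show "2 powr (- \<bar>a\<bar>) \<le> y powr a" .
  have "y powr a \<le> y powr (- \<bar>a\<bar>)" using assms by (intro powr_mono') auto
  also have "\<dots> \<le> (1/2) powr (- \<bar>a\<bar>)" using assms by (intro powr_mono2') auto
  also have "\<dots> = 2 powr \<bar>a\<bar>" by (simp add: powr_minus powr_divide field_simps)
  finally show "y powr a \<le> 2 powr \<bar>a\<bar>" .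
qed

text \<open>The factor \<open>(1 - w) powr (\<xi> - 1)\<close> is bounded above and below on all levels but the topmost one, where it may
  be unbounded or vanish at \<open>w = 1\<close>; there its integrability is enough, and only an upper bound is claimed.\<close>

lemma rapid_beta_dyadic_bounds:
  fixes \<eta> \<tau> \<xi> :: real
  assumes "0 < \<eta>" "0 < \<xi>" "0 \<le> \<tau>" "\<tau> < 1"
  shows "\<exists>c C. 0 < c \<and> 0 < C \<and> (\<forall>l. emeasure (rapid_beta \<eta> \<tau> \<xi>) (dyadic l) \<le> ennreal (C * level_size l)) \<and>
    (\<forall>l\<ge>1. ennreal (c * level_size l) \<le> emeasure (rapid_beta \<eta> \<tau> \<xi>) (dyadic l))"
proof -
  let ?f = "rapid_beta_density \<eta> \<tau> \<xi>" and ?\<nu> = "rapid_beta \<eta> \<tau> \<xi>"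
  obtain \<kappa>1 \<kappa>2 where \<kappa>: "0 < \<kappa>1" "0 < \<kappa>2"
     "\<And>w. 0 < w \<Longrightarrow> w \<le> 1 \<Longrightarrow> \<kappa>1 * w powr (-2) / (1 - ln w)\<^sup>2 * (1 - w) powr (\<xi> - 1) \<le> ?f w"
     "\<And>w. 0 < w \<Longrightarrow> w \<le> 1 \<Longrightarrow> ?f w \<le> \<kappa>2 * w powr (-2) / (1 - ln w)\<^sup>2 * (1 - w) powr (\<xi> - 1)"
    using rapid_beta_density_bounds[OF assms(1,3,4)] by blast
  let ?q = "2 powr \<bar>\<xi> - 1\<bar> :: real" and ?p = "2 powr (- \<bar>\<xi> - 1\<bar>) :: real"
  define c where "c = \<kappa>1 * ?p / 4"
  define C where "C = max (16 * \<kappa>2 * ?q) (16 * \<kappa>2 * (1 / \<xi>))"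
  have cC: "0 < c" "0 < C" using \<kappa> by (auto simp: c_def C_def less_max_iff_disj)
  have f_le: "?f w \<le> 16 * \<kappa>2 * (level_size l * 2 ^ l) * (1 - w) powr (\<xi> - 1)" if w: "w \<in> dyadic l" for w l
  proof -
    have "?f w \<le> \<kappa>2 * w powr (-2) / (1 - ln w)\<^sup>2 * (1 - w) powr (\<xi> - 1)"
      using \<kappa>(4)[of w] dyadic_pos[OF w] dyadic_sub w by fastforce
    also have "\<dots> = (\<kappa>2 * (1 - w) powr (\<xi> - 1)) * (w powr (-2) / (1 - ln w)\<^sup>2)" by simp
    also have "\<dots> \<le> (\<kappa>2 * (1 - w) powr (\<xi> - 1)) * (16 * (level_size l * 2 ^ l))"
      using \<kappa> by (intro mult_left_mono dyadic_density_bounds[OF w]) auto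
    finally show ?thesis by (simp add: mult_ac)
  qed
  have half: "1/2 \<le> 1 - w" "1 - w \<le> 1" if w: "w \<in> dyadic l" "1 \<le> l" for w l
  proof -
    have "w \<le> 1 / 2 ^ l" using w by (simp add: dyadic_def)
    also have "\<dots> \<le> 1 / 2 ^ 1" using w by (intro divide_left_mono power_increasing) auto
    finally show "1/2 \<le> 1 - w" by simp
    show "1 - w \<le> 1" using dyadic_pos[OF w(1)] by simp
  qed
  have upper: "emeasure ?\<nu> (dyadic l) \<le> ennreal (C * level_size l)" for l
  proof (cases "l = 0")
    case False
    have "emeasure ?\<nu> (dyadic l) = (\<integral>\<^sup>+w. ennreal (?f w) * indicator (dyadic l) w \<partial>lborel)"
      by (rule emeasure_rapid_beta[OF dyadic_borel dyadic_sub])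
    also have "\<dots> \<le> (\<integral>\<^sup>+w. ennreal (16 * \<kappa>2 * (level_size l * 2 ^ l) * ?q) * indicator (dyadic l) w \<partial>lborel)"
    proof (intro nn_integral_mono)
      fix w
      show "ennreal (?f w) * indicator (dyadic l) w \<le> ennreal (16 * \<kappa>2 * (level_size l * 2 ^ l) * ?q) * indicator (dyadic l) w"
      proof (cases "w \<in> dyadic l")
        case True
        have "?f w \<le> 16 * \<kappa>2 * (level_size l * 2 ^ l) * (1 - w) powr (\<xi> - 1)" by (rule f_le[OF True])
        also have "\<dots> \<le> 16 * \<kappa>2 * (level_size l * 2 ^ l) * ?q"
          using half[OF True] False \<kappa> level_size_pos[of l] by (intro mult_left_mono powr_half_bounds) auto
        finally show ?thesis using True by (simp add: ennreal_leI)
      qed simp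
    qed
    also have "\<dots> = ennreal (16 * \<kappa>2 * (level_size l * 2 ^ l) * ?q) * ennreal (1 / 2 ^ Suc l)"
      by (simp add: nn_integral_cmult emeasure_dyadic del: power_Suc)
    also have "\<dots> = ennreal (8 * \<kappa>2 * ?q * level_size l)"
      using \<kappa> level_size_pos[of l] by (subst ennreal_mult[symmetric]) (auto simp: field_simps)
    also have "\<dots> \<le> ennreal (C * level_size l)"
      using \<kappa> level_size_pos[of l]
      by (intro ennreal_leI mult_right_mono) (auto simp: C_def le_max_iff_disj)
    finally show ?thesis .
  next
    case True
    have "emeasure ?\<nu> (dyadic l) = (\<integral>\<^sup>+w. ennreal (?f w) * indicator (dyadic l) w \<partial>lborel)"
      by (rule emeasure_rapid_beta[OF dyadic_borel dyadic_sub])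
    also have "\<dots> \<le> (\<integral>\<^sup>+w. ennreal (16 * \<kappa>2 * (level_size l * 2 ^ l)) * (ennreal ((1 - w) powr (\<xi> - 1)) * indicator {0..1} w) \<partial>lborel)"
    proof (intro nn_integral_mono)
      fix w
      show "ennreal (?f w) * indicator (dyadic l) w \<le> ennreal (16 * \<kappa>2 * (level_size l * 2 ^ l)) * (ennreal ((1 - w) powr (\<xi> - 1)) * indicator {0..1} w)"
      proof (cases "w \<in> dyadic l")
        case T: True
        then have "w \<in> {0..1}" using dyadic_sub by blast
        then show ?thesis using T f_le[OF T] \<kappa> level_size_pos[of l]
          by (simp add: ennreal_mult[symmetric] ennreal_leI)
      qed simp
    qed
    also have "\<dots> = ennreal (16 * \<kappa>2 * (level_size l * 2 ^ l)) * ennreal (1 / \<xi>)"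
      by (subst nn_integral_cmult) (auto simp: nn_integral_beta_tail[OF assms(2)])
    also have "\<dots> = ennreal (16 * \<kappa>2 * (1 / \<xi>) * level_size l)"
      using True assms \<kappa> level_size_pos[of l] by (subst ennreal_mult[symmetric]) (auto simp: mult_ac)
    also have "\<dots> \<le> ennreal (C * level_size l)"
      using level_size_pos[of l] by (intro ennreal_leI mult_right_mono) (auto simp: C_def le_max_iff_disj)
    finally show ?thesis .
  qed
  have lower: "ennreal (c * level_size l) \<le> emeasure ?\<nu> (dyadic l)" if "l \<ge> 1" for l
  proof -
    have "ennreal (c * level_size l) = ennreal (\<kappa>1 * (level_size l * 2 ^ l / 2) * ?p) * ennreal (1 / 2 ^ Suc l)"
      using \<kappa> level_size_pos[of l] by (subst ennreal_mult[symmetric]) (auto simp: field_simps c_def)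
    also have "\<dots> = (\<integral>\<^sup>+w. ennreal (\<kappa>1 * (level_size l * 2 ^ l / 2) * ?p) * indicator (dyadic l) w \<partial>lborel)"
      by (simp add: nn_integral_cmult emeasure_dyadic del: power_Suc)
    also have "\<dots> \<le> (\<integral>\<^sup>+w. ennreal (?f w) * indicator (dyadic l) w \<partial>lborel)"
    proof (intro nn_integral_mono)
      fix w
      show "ennreal (\<kappa>1 * (level_size l * 2 ^ l / 2) * ?p) * indicator (dyadic l) w \<le> ennreal (?f w) * indicator (dyadic l) w"
      proof (cases "w \<in> dyadic l")
        case True
        have "\<kappa>1 * (level_size l * 2 ^ l / 2) * ?p \<le> \<kappa>1 * (w powr (-2) / (1 - ln w)\<^sup>2) * (1 - w) powr (\<xi> - 1)"
          using half[OF True that] \<kappa> level_size_pos[of l]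
          by (intro mult_mono dyadic_density_bounds[OF True] powr_half_bounds order_refl) auto
        also have "\<dots> \<le> ?f w"
          using \<kappa>(3)[of w] dyadic_pos[OF True] dyadic_sub True by fastforce
        finally show ?thesis using True by (simp add: ennreal_leI)
      qed simp
    qed
    also have "\<dots> = emeasure ?\<nu> (dyadic l)"
      by (rule emeasure_rapid_beta[OF dyadic_borel dyadic_sub, symmetric])
    finally show ?thesis .
  qed
  show ?thesis using cC upper lower by blast
qed

section \<open>Poisson counts\<close>

lemma poisson_sums: "(\<lambda>k. x ^ k / fact k * exp (- x)) sums (1 :: real)"
proof -
  have "(\<lambda>k. x ^ k / fact k) sums exp x"
    using exp_converges[of x] by (simp add: divide_inverse mult.commute)
  from sums_mult2[OF this, of "exp (- x)"] show ?thesis by (simp add: exp_add[symmetric])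
qed

lemma poisson_scaled_sums:
  "(\<lambda>k. x ^ k / fact k * exp (- x) * y ^ k) sums (exp (x * (y - 1)) :: real)"
proof -
  have "(\<lambda>k. exp (x * (y - 1)) * ((x * y) ^ k / fact k * exp (- (x * y)))) sums (exp (x * (y - 1)) * 1)"
    by (intro sums_mult poisson_sums)
  moreover have "exp (x * (y - 1)) * ((x * y) ^ k / fact k * exp (- (x * y))) = x ^ k / fact k * exp (- x) * y ^ k" for k
  proof -
    have "exp (x * (y - 1)) * exp (- (x * y)) = exp (- x)"
      unfolding exp_add[symmetric] by (simp add: algebra_simps)
    then show ?thesis by (simp add: power_mult_distrib mult_ac)
  qed
  ultimately show ?thesis by simp
qed

text \<open>A Chernoff bound: outside \<open>G\<close> one of \<open>exp (k - 4 x)\<close> and \<open>exp (x / 4 - k)\<close> is at least 1, and the Poisson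
  expectations of both are exponentially small in \<open>x\<close>.\<close>

lemma poisson_tail_sum:
  fixes x :: real
  assumes x: "0 \<le> x" and G: "finite G" "\<And>k. k \<notin> G \<Longrightarrow> real k < x / 4 \<or> 4 * x < real k"
  shows "1 - (\<Sum>k\<in>G. x ^ k / fact k * exp (- x)) \<le> 2 * exp (- x / 4)"
proof -
  let ?q = "\<lambda>k. x ^ k / fact k * exp (- x)"
  have q: "0 \<le> ?q k" for k using x by simp
  have lhs: "(\<lambda>k. ?q k - (if k \<in> G then ?q k else 0)) sums (1 - (\<Sum>k\<in>G. ?q k))"
    by (intro sums_diff poisson_sums sums_If_finite_set G)
  have rhs: "(\<lambda>k. ?q k * exp 1 ^ k * exp (- (4 * x)) + ?q k * exp (-1) ^ k * exp (x / 4)) sums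
      (exp (x * (exp 1 - 1)) * exp (- (4 * x)) + exp (x * (exp (-1) - 1)) * exp (x / 4))"
    by (intro sums_add sums_mult2 poisson_scaled_sums)
  have le: "?q k - (if k \<in> G then ?q k else 0) \<le> ?q k * exp 1 ^ k * exp (- (4 * x)) + ?q k * exp (-1) ^ k * exp (x / 4)" for k
  proof (cases "k \<in> G")
    case True
    have "0 \<le> ?q k * exp 1 ^ k * exp (- (4 * x)) + ?q k * exp (-1) ^ k * exp (x / 4)"
      by (intro add_nonneg_nonneg mult_nonneg_nonneg q) auto
    then show ?thesis using True by simp
  next
    case False
    have e: "exp 1 ^ k * exp (- (4 * x)) = exp (real k - 4 * x)" "exp (-1) ^ k * exp (x / 4) = exp (x / 4 - real k)"
      by (simp_all only: exp_of_nat_mult[symmetric] exp_add[symmetric]) simp_all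
    have "1 \<le> exp (real k - 4 * x) + exp (x / 4 - real k)"
      using G(2)[OF False]
    proof
      assume "real k < x / 4"
      then have "1 \<le> exp (x / 4 - real k)" by simp
      then show ?thesis by (simp add: add_increasing)
    next
      assume "4 * x < real k"
      then have "1 \<le> exp (real k - 4 * x)" by simp
      then show ?thesis by (simp add: add_increasing2)
    qed
    then have "?q k * 1 \<le> ?q k * (exp (real k - 4 * x) + exp (x / 4 - real k))"
      by (intro mult_left_mono q)
    moreover have "?q k * exp 1 ^ k * exp (- (4 * x)) + ?q k * exp (-1) ^ k * exp (x / 4)
        = ?q k * (exp (real k - 4 * x) + exp (x / 4 - real k))"
      unfolding distrib_left mult.assoc e ..
    ultimately show ?thesis using False by (simp only: if_False diff_0_right mult_1_right)
  qed
  have "1 - (\<Sum>k\<in>G. ?q k) \<le> exp (x * (exp 1 - 1)) * exp (- (4 * x)) + exp (x * (exp (-1) - 1)) * exp (x / 4)"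
    by (rule sums_le[OF le lhs rhs])
  also have "\<dots> \<le> exp (- x / 4) + exp (- x / 4)"
  proof (intro add_mono)
    have "x * exp 1 \<le> x * 3" using x exp_le by (intro mult_left_mono) auto
    then show "exp (x * (exp 1 - 1)) * exp (- (4 * x)) \<le> exp (- x / 4)"
      unfolding exp_add[symmetric] exp_le_cancel_iff using x by (simp add: algebra_simps)
    have "exp (-1) \<le> (1/2 :: real)" using exp_ge_add_one_self[of "1::real"] by (simp add: exp_minus field_simps)
    then have "x * exp (-1) \<le> x * (1/2)" using x by (intro mult_left_mono) auto
    then show "exp (x * (exp (-1) - 1)) * exp (x / 4) \<le> exp (- x / 4)"
      unfolding exp_add[symmetric] exp_le_cancel_iff using x by (simp add: algebra_simps)
  qed
  finally show ?thesis by simp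
qed

context
  fixes M :: "'a measure" and \<nu> :: "'b measure" and w
  assumes ppp: "poisson_point_process M \<nu> w"
begin

interpretation prob_space M using ppp by (simp add: poisson_point_process_def)

lemma point_count_measurable:
  assumes [measurable]: "B \<in> sets \<nu>"
  shows "point_count w B \<in> borel_measurable M"
proof -
  have [measurable]: "w i \<in> M \<rightarrow>\<^sub>M \<nu>" for i using ppp by (simp add: poisson_point_process_def)
  show ?thesis unfolding point_count_def by measurable
qed

lemma prob_point_count:
  assumes "B \<in> sets \<nu>" "emeasure \<nu> B < \<infinity>"
  shows "prob {\<omega> \<in> space M. point_count w B \<omega> = of_nat k} = measure \<nu> B ^ k / fact k * exp (- measure \<nu> B)"
  using ppp assms by (simp add: poisson_point_process_def)

lemma prob_point_count_finite_set:
  assumes B: "B \<in> sets \<nu>" "emeasure \<nu> B < \<infinity>" and G: "finite G"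
  shows "prob {\<omega> \<in> space M. \<forall>k\<in>G. point_count w B \<omega> \<noteq> of_nat k}
    = 1 - (\<Sum>k\<in>G. measure \<nu> B ^ k / fact k * exp (- measure \<nu> B))"
proof -
  note [measurable] = point_count_measurable[OF B(1)]
  let ?E = "\<lambda>k::nat. {\<omega> \<in> space M. point_count w B \<omega> = of_nat k}"
  have "prob (\<Union>k\<in>G. ?E k) = (\<Sum>k\<in>G. prob (?E k))"
    by (intro finite_measure_finite_Union G) (auto simp: disjoint_family_on_def)
  moreover have "{\<omega> \<in> space M. \<forall>k\<in>G. point_count w B \<omega> \<noteq> of_nat k} = space M - (\<Union>k\<in>G. ?E k)"
    by auto
  moreover have "prob (space M - (\<Union>k\<in>G. ?E k)) = 1 - prob (\<Union>k\<in>G. ?E k)"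
    using G by (intro prob_compl) measurable
  ultimately show ?thesis by (simp add: prob_point_count[OF B])
qed

lemma AE_point_count_finite:
  assumes B: "B \<in> sets \<nu>" "emeasure \<nu> B < \<infinity>"
  shows "AE \<omega> in M. point_count w B \<omega> < \<infinity>"
proof -
  note [measurable] = point_count_measurable[OF B(1)]
  let ?q = "\<lambda>k::nat. measure \<nu> B ^ k / fact k * exp (- measure \<nu> B)"
  let ?N = "{\<omega> \<in> space M. \<not> point_count w B \<omega> < \<infinity>}"
  have le: "prob ?N \<le> 1 - (\<Sum>k<n. ?q k)" for n
  proof -
    have "prob ?N \<le> prob {\<omega> \<in> space M. \<forall>k\<in>{..<n}. point_count w B \<omega> \<noteq> of_nat k}"
      by (intro finite_measure_mono) (auto simp: less_top[symmetric])
    then show ?thesis by (simp add: prob_point_count_finite_set[OF B])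
  qed
  have lim: "(\<lambda>n. 1 - (\<Sum>k<n. ?q k)) \<longlonglongrightarrow> 1 - 1"
    using poisson_sums by (intro tendsto_diff tendsto_const) (auto simp: sums_def)
  have "prob ?N \<le> 1 - 1"
    by (rule LIMSEQ_le_const[OF lim]) (use le in auto)
  then have "prob ?N = 0" by (simp add: measure_le_0_iff)
  then show ?thesis by (subst AE_iff_measurable[OF _ refl]) (auto simp: emeasure_eq_measure)
qed

lemma prob_point_count_tail:
  assumes B: "B \<in> sets \<nu>" "emeasure \<nu> B = ennreal x" and x: "0 \<le> x"
  shows "prob {\<omega> \<in> space M. point_count w B \<omega> < ennreal (x / 4) \<or> ennreal (4 * x) < point_count w B \<omega>} \<le> 2 * exp (- x / 4)"
proof -
  note [measurable] = point_count_measurable[OF B(1)]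
  have m: "measure \<nu> B = x" using B x by (simp add: measure_def)
  have fin: "emeasure \<nu> B < \<infinity>" using B by simp
  define G where "G = {k. x / 4 \<le> real k \<and> real k \<le> 4 * x}"
  have G: "finite G"
    by (rule finite_subset[of _ "{..nat \<lfloor>4 * x\<rfloor>}"]) (auto simp: G_def le_nat_floor)
  have "prob {\<omega> \<in> space M. point_count w B \<omega> < ennreal (x / 4) \<or> ennreal (4 * x) < point_count w B \<omega>}
     \<le> prob {\<omega> \<in> space M. \<forall>k\<in>G. point_count w B \<omega> \<noteq> of_nat k}"
  proof (intro finite_measure_mono)
    show "{\<omega> \<in> space M. point_count w B \<omega> < ennreal (x / 4) \<or> ennreal (4 * x) < point_count w B \<omega>}
      \<subseteq> {\<omega> \<in> space M. \<forall>k\<in>G. point_count w B \<omega> \<noteq> of_nat k}"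
      using x by (auto simp: G_def ennreal_of_nat_eq_real_of_nat ennreal_less_iff)
    show "{\<omega> \<in> space M. \<forall>k\<in>G. point_count w B \<omega> \<noteq> of_nat k} \<in> events"
      using G by measurable
  qed
  also have "\<dots> = 1 - (\<Sum>k\<in>G. x ^ k / fact k * exp (- x))"
    using prob_point_count_finite_set[OF B(1) fin G] by (simp add: m)
  also have "\<dots> \<le> 2 * exp (- x / 4)"
    by (rule poisson_tail_sum[OF x G]) (auto simp: G_def not_le)
  finally show ?thesis .
qed

text \<open>Each count lies within a factor 4 of its mean \<open>x\<close> except with probability at most \<open>2 exp (- x / 4) \<le> 8 / x\<close>, so
  by the first Borel-Cantelli lemma all but finitely many counts do. As every count is almost surely finite, the
  exceptional ones are absorbed by a random constant.\<close>

lemma AE_point_count_bounds: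
  fixes b :: "nat \<Rightarrow> real"
  assumes B: "\<And>l. B l \<in> sets \<nu>" and b: "\<And>l. 0 < b l" and sum: "summable (\<lambda>l. 1 / b l)"
    and c: "0 < c" "0 \<le> C" and up: "\<And>l. emeasure \<nu> (B l) \<le> ennreal (C * b l)"
    and low: "\<And>l. l \<ge> 1 \<Longrightarrow> ennreal (c * b l) \<le> emeasure \<nu> (B l)"
  shows "AE \<omega> in M. (\<exists>K. \<forall>l. point_count w (B l) \<omega> \<le> ennreal (K * b l)) \<and>
     (\<forall>\<^sub>F l in sequentially. ennreal (c / 4 * b l) \<le> point_count w (B l) \<omega>)"
proof -
  note [measurable] = point_count_measurable[OF B]
  define x where "x l = measure \<nu> (B l)" for l
  have fin: "emeasure \<nu> (B l) < \<infinity>" for l using up[of l] by (auto intro: le_less_trans)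
  have x: "emeasure \<nu> (B l) = ennreal (x l)" "0 \<le> x l" for l
    using fin[of l] by (auto simp: x_def emeasure_eq_ennreal_measure)
  have C: "x l \<le> C * b l" for l
  proof (rule ccontr)
    assume "\<not> x l \<le> C * b l"
    then show False using up[of l] x[of l] c b[of l] by simp
  qed
  have c': "c * b l \<le> x l" if "l \<ge> 1" for l using low[OF that] x[of l] c b[of l] by simp
  define A where "A l = {\<omega> \<in> space M. point_count w (B l) \<omega> < ennreal (x l / 4) \<or> ennreal (4 * x l) < point_count w (B l) \<omega>}" for l
  have [measurable]: "A l \<in> events" for l unfolding A_def by measurable
  have A_le: "prob (A (Suc l)) \<le> (8 / c) * (1 / b (Suc l))" for l
  proof -
    let ?y = "x (Suc l)"
    have y: "c * b (Suc l) \<le> ?y" by (rule c') simp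
    have y0: "0 < c * b (Suc l)" using c b by simp
    have "prob (A (Suc l)) \<le> 2 * exp (- ?y / 4)"
      unfolding A_def by (rule prob_point_count_tail[OF B x])
    also have "exp (- ?y / 4) \<le> 4 / ?y"
    proof -
      have "?y / 4 \<le> exp (?y / 4)" using exp_ge_add_one_self[of "?y / 4"] by linarith
      then show ?thesis using y y0 by (simp add: exp_minus field_simps)
    qed
    also have "4 / ?y \<le> 4 / (c * b (Suc l))" using y y0 by (intro divide_left_mono) auto
    finally show ?thesis by (simp add: field_simps)
  qed
  have "summable (\<lambda>l. (8 / c) * (1 / b (Suc l)))"
    by (rule summable_mult) (use sum in \<open>simp only: summable_Suc_iff[of "\<lambda>l. 1 / b l"]\<close>)
  then have "summable (\<lambda>l. prob (A (Suc l)))"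
    by (rule summable_comparison_test'[where N = 0]) (use A_le in simp)
  then have sum_A: "summable (\<lambda>l. prob (A l))" by (rule summable_Suc_iff[THEN iffD1])
  have "AE \<omega> in M. \<forall>\<^sub>F l in sequentially. \<omega> \<in> space M - A l"
    by (rule borel_cantelli_AE1[OF _ _ sum_A]) (auto simp: less_top[symmetric])
  moreover have "AE \<omega> in M. \<forall>l. point_count w (B l) \<omega> < \<infinity>"
    unfolding AE_all_countable by (intro allI AE_point_count_finite B fin)
  ultimately show ?thesis
  proof eventually_elim
    case (elim \<omega>)
    have ev: "\<forall>\<^sub>F l in sequentially. ennreal (x l / 4) \<le> point_count w (B l) \<omega> \<and> point_count w (B l) \<omega> \<le> ennreal (4 * x l)"
      using elim(1) by eventually_elim (auto simp: A_def not_less)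
    have low': "\<forall>\<^sub>F l in sequentially. ennreal (c / 4 * b l) \<le> point_count w (B l) \<omega>"
      using ev eventually_ge_at_top[of 1]
    proof eventually_elim
      case (elim l)
      have "ennreal (c / 4 * b l) \<le> ennreal (x l / 4)" using c'[of l] elim by (intro ennreal_leI) auto
      with elim show ?case by auto
    qed
    define r where "r l = enn2real (point_count w (B l) \<omega>) / b l" for l
    have r: "point_count w (B l) \<omega> = ennreal (r l * b l)" for l
      using elim(2) b[of l] by (simp add: r_def)
    have "\<forall>\<^sub>F l in sequentially. r l \<le> 4 * C"
      using ev
    proof eventually_elim
      case (elim l)
      have "ennreal (r l * b l) \<le> ennreal (4 * x l)" using elim r by simp
      then have "r l * b l \<le> 4 * x l" using x[of l] by simp
      also have "\<dots> \<le> (4 * C) * b l" using C[of l] by simp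
      finally show ?case using b[of l] by simp
    qed
    then obtain l0 where l0: "\<And>l. l \<ge> l0 \<Longrightarrow> r l \<le> 4 * C" by (auto simp: eventually_sequentially)
    define K where "K = Max (insert (4 * C) (r ` {..<l0}))"
    have K: "r l \<le> K" for l
    proof (cases "l < l0")
      case True
      then show ?thesis unfolding K_def by (intro Max_ge) auto
    next
      case False
      then have "r l \<le> 4 * C" using l0 by simp
      also have "4 * C \<le> K" unfolding K_def by (intro Max_ge) auto
      finally show ?thesis .
    qed
    have "point_count w (B l) \<omega> \<le> ennreal (K * b l)" for l
      unfolding r using K[of l] b[of l] by (intro ennreal_leI mult_right_mono) auto
    then show ?case using low' by blast
  qed
qed

end

lemma summable_level_size: "summable (\<lambda>l. 1 / level_size l)"
proof (rule summable_ratio_test[where c = "3/4" and N = 3])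
  fix n :: nat assume n: "3 \<le> n"
  then have "3 * real n \<le> real n * real n" by (intro mult_right_mono) auto
  then have "6 + real n \<le> real n * real n" using n by linarith
  from mult_right_mono[OF this, of "2 * 2 ^ n"] show "norm (1 / level_size (Suc n)) \<le> 3 / 4 * norm (1 / level_size n)"
    by (simp add: level_size_def field_simps)
qed simp

section \<open>Weights with bounded dyadic counts\<close>

text \<open>The order of magnitude \<open>t / log t\<close> at \<open>t = 2 ^ k\<close>.\<close>

definition block_scale :: "nat \<Rightarrow> real" where
  "block_scale k = 2 ^ k / real (Suc k)"

lemma block_scale_pos: "0 < block_scale k"
  by (simp add: block_scale_def)

lemma summable_block_scale: "summable (\<lambda>k. 1 / block_scale k)"
proof (rule summable_ratio_test[where c = "3/4" and N = 1])
  fix n :: nat assume n: "1 \<le> n"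
  have "1 * 2 ^ n \<le> real n * 2 ^ n" using n by (intro mult_right_mono) auto
  then show "norm (1 / block_scale (Suc n)) \<le> 3 / 4 * norm (1 / block_scale n)"
    by (simp add: block_scale_def field_simps)
qed simp

lemma summable_inverse_power2: "summable (\<lambda>k. 1 / (2 ^ k :: real))"
  using summable_geometric[of "1/2 :: real"] by (simp add: power_divide)

lemma suminf_swap_ennreal:
  fixes f :: "nat \<Rightarrow> nat \<Rightarrow> ennreal"
  shows "(\<Sum>i. \<Sum>l. f i l) = (\<Sum>l. \<Sum>i. f i l)"
  using nn_integral_suminf[of "\<lambda>l i. f i l" "count_space UNIV"] by (simp add: nn_integral_count_space_nat)

lemma nn_integral_count_space_pairs:
  fixes f :: "nat \<times> nat \<Rightarrow> ennreal"
  shows "(\<integral>\<^sup>+e. f e \<partial>count_space UNIV) = (\<Sum>i. \<Sum>j. f (i, j))"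
  unfolding nn_integral_fst_count_space[symmetric] by (simp add: nn_integral_count_space_nat)

lemma level_size_telescope: "(\<lambda>l. level_size (k + l) / 2 ^ (k + l)) sums (1 / real (Suc k))"
proof -
  have lim: "(\<lambda>l. - 1 / real (Suc (k + l))) \<longlonglongrightarrow> 0"
    using LIMSEQ_ignore_initial_segment[OF LIMSEQ_inverse_real_of_nat, of k, THEN tendsto_minus]
    by (simp add: inverse_eq_divide add.commute)
  have "(\<lambda>l. - 1 / real (Suc (k + Suc l)) - (- 1 / real (Suc (k + l)))) sums (0 - (- 1 / real (Suc (k + 0))))"
    by (rule telescope_sums[OF lim])
  moreover have "- 1 / real (Suc (k + Suc l)) - (- 1 / real (Suc (k + l))) = level_size (k + l) / 2 ^ (k + l)" for l
  proof -
    have "level_size (k + l) / 2 ^ (k + l) = 1 / (real (Suc (k + l)) * real (Suc (Suc (k + l))))"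
      by (simp add: level_size_def)
    also have "\<dots> = - 1 / real (Suc (k + Suc l)) - (- 1 / real (Suc (k + l)))"
      by (simp add: field_simps)
    finally show ?thesis by simp
  qed
  ultimately show ?thesis by simp
qed

text \<open>The sum has order \<open>2 ^ k / k\<^sup>2\<close>; the cruder bound is what the induction step supports directly and is of the
  same order as the other contributions to the number of vertices.\<close>

lemma sum_level_size_le: "(\<Sum>l<k. level_size l) \<le> 4 * block_scale k"
proof (induction k)
  case (Suc k)
  show ?case
  proof (cases "k = 0")
    case True
    then show ?thesis by (simp add: level_size_def block_scale_def)
  next
    case False
    have "(\<Sum>l<Suc k. level_size l) \<le> 4 * block_scale k + level_size k" using Suc.IH by simp
    also have "\<dots> = 2 ^ k * ((4 * real (Suc (Suc k)) + 1) / (real (Suc k) * real (Suc (Suc k))))"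
    proof -
      have "4 * (P / u) + P / (u * v) = P * ((4 * v + 1) / (u * v))" if "0 < u" "0 < v" for P u v :: real
        using that by (simp add: field_simps)
      then show ?thesis unfolding block_scale_def level_size_def by simp
    qed
    also have "\<dots> \<le> 2 ^ k * (8 * real (Suc k) / (real (Suc k) * real (Suc (Suc k))))"
      using False by (intro mult_left_mono divide_right_mono) auto
    also have "\<dots> = 4 * block_scale (Suc k)"
    proof -
      have "P * (8 * u / (u * v)) = 4 * (2 * P / v)" if "0 < u" "0 < v" for P u v :: real
        using that by (simp add: field_simps)
      from this[of "real (Suc k)" "real (Suc (Suc k))" "2 ^ k"] show ?thesis
        unfolding block_scale_def by (simp del: of_nat_Suc)
    qed
    finally show ?thesis .
  qed
qed (simp add: block_scale_def)

lemma dyadic_ex: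
  assumes "0 < w" "w \<le> 1 / 2 ^ k"
  shows "\<exists>l\<ge>k. w \<in> dyadic l"
proof -
  have "\<exists>n. 1 / 2 ^ n < w"
    using real_arch_pow_inv[OF assms(1), of "1/2"] by (auto simp: power_divide)
  then have ex: "\<exists>n. 1 / 2 ^ n < w" .
  define n where "n = (LEAST n. 1 / 2 ^ n < w)"
  have n: "1 / 2 ^ n < w" unfolding n_def by (rule LeastI_ex[OF ex])
  have kn: "k < n"
  proof (rule ccontr)
    assume "\<not> k < n"
    then have "(1::real) / 2 ^ k \<le> 1 / 2 ^ n" by (intro divide_left_mono power_increasing) auto
    with n assms(2) show False by simp
  qed
  then obtain l where l: "n = Suc l" by (cases n) auto
  have "\<not> 1 / 2 ^ l < w" using not_less_Least[of l "\<lambda>n. 1 / 2 ^ n < w"] l by (simp add: n_def)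
  then have "w \<in> dyadic l" using n l by (simp add: dyadic_def)
  then show ?thesis using kn l by (intro exI[of _ l]) auto
qed

lemma dyadic_le: "w \<in> dyadic l \<Longrightarrow> k \<le> l \<Longrightarrow> w \<le> 1 / 2 ^ k"
proof -
  assume "w \<in> dyadic l" "k \<le> l"
  then have "w \<le> 1 / 2 ^ l" by (simp add: dyadic_def)
  also have "\<dots> \<le> 1 / 2 ^ k" using \<open>k \<le> l\<close> by (intro divide_left_mono power_increasing) auto
  finally show ?thesis .
qed

lemma dyadic_gt: "w \<in> dyadic l \<Longrightarrow> l < k \<Longrightarrow> 1 / 2 ^ k < w"
proof -
  assume w: "w \<in> dyadic l" "l < k"
  then have "1 / 2 ^ k \<le> (1 / 2 ^ Suc l :: real)" by (intro divide_left_mono power_increasing) auto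
  also have "\<dots> < w" using w by (simp add: dyadic_def)
  finally show ?thesis .
qed

lemma dyadic_unique:
  assumes "w \<in> dyadic l" "w \<in> dyadic l'"
  shows "l = l'"
proof (rule ccontr)
  assume "l \<noteq> l'"
  then consider "l < l'" | "l' < l" by linarith
  then show False
  proof cases
    case 1
    then show False using dyadic_gt[OF assms(1) 1] dyadic_le[OF assms(2) order_refl] by simp
  next
    case 2
    then show False using dyadic_gt[OF assms(2) 2] dyadic_le[OF assms(1) order_refl] by simp
  qed
qed

text \<open>For \<open>n y \<le> 1\<close> the probability of at least one success in \<open>n\<close> trials is comparable to the expected number of
  successes: repeated edges do not matter for light vertices.\<close>

lemma one_minus_power_bounds:
  fixes y :: real
  assumes "0 \<le> y" "y \<le> 1"
  shows "1 - (1 - y) ^ n \<le> real n * y"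
    and "real n * y \<le> 1 \<Longrightarrow> real n * y / 2 \<le> 1 - (1 - y) ^ n"
proof -
  show "1 - (1 - y) ^ n \<le> real n * y" using Bernoulli_inequality[of "-y" n] assms by simp
  assume z: "real n * y \<le> 1"
  let ?z = "real n * y"
  have z0: "0 \<le> ?z" using assms by simp
  have "(1 - y) ^ n \<le> exp (- y) ^ n" using assms exp_ge_add_one_self[of "-y"] by (intro power_mono) auto
  also have "\<dots> = exp (- ?z)" by (simp add: exp_of_nat_mult[symmetric])
  also have "\<dots> \<le> 1 / (1 + ?z)"
    using exp_ge_add_one_self[of ?z] z0 unfolding exp_minus inverse_eq_divide by (intro divide_left_mono) (auto intro!: mult_pos_pos simp del: exp_ge_add_one_self)
  also have "\<dots> \<le> 1 - ?z / 2"
  proof -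
    have "?z * ?z \<le> 1 * ?z" using z z0 by (intro mult_right_mono)
    then have "1 \<le> (1 - ?z / 2) * (1 + ?z)" by (simp add: algebra_simps)
    then show ?thesis using z0 by (simp only: divide_le_eq) auto
  qed
  finally show "?z / 2 \<le> 1 - (1 - y) ^ n" by simp
qed

definition small_mass :: "(nat \<Rightarrow> real) \<Rightarrow> nat \<Rightarrow> ennreal" where
  "small_mass x k = (\<Sum>i. ennreal (x i) * indicator {..1 / 2 ^ k} (x i))"

definition edge_rate :: "(nat \<Rightarrow> real) \<Rightarrow> nat \<times> nat \<Rightarrow> real" where
  "edge_rate x = (\<lambda>(i, j). if i < j then x i * x j else 0)"

definition small_edge_rate :: "nat \<Rightarrow> (nat \<Rightarrow> real) \<Rightarrow> nat \<times> nat \<Rightarrow> real" where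
  "small_edge_rate k x = (\<lambda>(i, j). if i < j \<and> (x i \<le> 1 / 2 ^ k \<or> x j \<le> 1 / 2 ^ k) then x i * x j else 0)"

text \<open>Given the weights \<open>x\<close>, the probability that vertex \<open>i\<close>, if it is light, has been joined to the hub \<open>j\<close> by
  step \<open>2 ^ k\<close>.\<close>

definition hub_prob :: "nat \<Rightarrow> nat \<Rightarrow> (nat \<Rightarrow> real) \<Rightarrow> nat \<Rightarrow> real" where
  "hub_prob j k x i = (if i \<noteq> j \<and> x i \<le> 1 / 2 ^ k then 1 - (1 - x i * x j) ^ (2 ^ k) else 0)"

text \<open>What almost every realization of the Poisson process satisfies. Fixing one such realization, the conditional
  means of the three counts of interest are estimated without probability.\<close>

locale level_bounded_weights =
  fixes x :: "nat \<Rightarrow> real" and K c :: real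
  assumes x_ge0: "\<And>i. 0 \<le> x i" and x_le1: "\<And>i. x i \<le> 1"
    and level_upper: "\<And>l. (\<Sum>i. indicator (dyadic l) (x i)) \<le> ennreal (K * level_size l)"
    and level_lower: "\<forall>\<^sub>F l in sequentially. ennreal (c * level_size l) \<le> (\<Sum>i. indicator (dyadic l) (x i))"
    and K0: "0 \<le> K" and c0: "0 < c"
begin

text \<open>A weight on level \<open>l\<close> is at most \<open>1 / 2 ^ l\<close>, so level \<open>l\<close> carries mass at most
  \<open>K / ((l + 1) (l + 2))\<close>, and the levels from \<open>k\<close> on telescope to \<open>K / (k + 1)\<close>.\<close>

lemma small_mass_le: "small_mass x k \<le> ennreal (K / real (Suc k))"
proof -
  have "small_mass x k \<le> (\<Sum>i. \<Sum>l. ennreal (1 / 2 ^ (k + l)) * indicator (dyadic (k + l)) (x i))"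
    unfolding small_mass_def
  proof (intro suminf_le summableI)
    fix i
    show "ennreal (x i) * indicator {..1 / 2 ^ k} (x i) \<le> (\<Sum>l. ennreal (1 / 2 ^ (k + l)) * indicator (dyadic (k + l)) (x i))"
    proof (cases "0 < x i \<and> x i \<le> 1 / 2 ^ k")
      case True
      then obtain l where l: "k \<le> l" "x i \<in> dyadic l" using dyadic_ex by blast
      then obtain l' where l': "l = k + l'" by (auto simp: le_iff_add)
      have "ennreal (x i) * indicator {..1 / 2 ^ k} (x i) \<le> (\<Sum>l\<in>{l'}. ennreal (1 / 2 ^ (k + l)) * indicator (dyadic (k + l)) (x i))"
        using l l' True by (auto simp: dyadic_def intro!: ennreal_leI)
      also have "\<dots> \<le> (\<Sum>l. ennreal (1 / 2 ^ (k + l)) * indicator (dyadic (k + l)) (x i))"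
        by (intro sum_le_suminf summableI) auto
      finally show ?thesis .
    next
      case False
      then have "x i = 0 \<or> \<not> x i \<le> 1 / 2 ^ k" using x_ge0[of i] by auto
      then show ?thesis by auto
    qed
  qed
  also have "\<dots> = (\<Sum>l. ennreal (1 / 2 ^ (k + l)) * (\<Sum>i. indicator (dyadic (k + l)) (x i)))"
    by (subst suminf_swap_ennreal) simp
  also have "\<dots> \<le> (\<Sum>l. ennreal (1 / 2 ^ (k + l)) * ennreal (K * level_size (k + l)))"
    by (intro suminf_le summableI mult_left_mono level_upper) auto
  also have "\<dots> = (\<Sum>l. ennreal (K * (level_size (k + l) / 2 ^ (k + l))))"
    using K0 by (intro suminf_cong, subst ennreal_mult[symmetric]) (auto intro!: mult_nonneg_nonneg less_imp_le[OF level_size_pos])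
  also have "\<dots> = ennreal (K * (1 / real (Suc k)))"
    using K0 less_imp_le[OF level_size_pos] by (intro suminf_ennreal_eq sums_mult level_size_telescope) auto
  finally show ?thesis by simp
qed

lemma small_mass_ge: "\<forall>\<^sub>F k in sequentially. ennreal (c / 2 / real (Suc k)) \<le> small_mass x k"
proof -
  obtain l0 where l0: "\<And>l. l0 \<le> l \<Longrightarrow> ennreal (c * level_size l) \<le> (\<Sum>i. indicator (dyadic l) (x i))"
    using level_lower by (auto simp: eventually_sequentially)
  have "ennreal (c / 2 / real (Suc k)) \<le> small_mass x k" if k: "l0 \<le> k" for k
  proof -
    have "ennreal (c / 2 / real (Suc k)) = ennreal (c / 2 * (1 / real (Suc k)))" by simp
    also have "\<dots> = (\<Sum>l. ennreal (c / 2 * (level_size (k + l) / 2 ^ (k + l))))"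
      using c0 less_imp_le[OF level_size_pos]
      by (intro suminf_ennreal_eq[symmetric] sums_mult level_size_telescope) auto
    also have "\<dots> = (\<Sum>l. ennreal (1 / 2 ^ Suc (k + l)) * ennreal (c * level_size (k + l)))"
      using c0 level_size_pos
      by (intro suminf_cong, subst ennreal_mult[symmetric]) (auto intro!: mult_nonneg_nonneg less_imp_le)
    also have "\<dots> \<le> (\<Sum>l. ennreal (1 / 2 ^ Suc (k + l)) * (\<Sum>i. indicator (dyadic (k + l)) (x i)))"
      using k by (intro suminf_le summableI mult_left_mono l0) auto
    also have "\<dots> = (\<Sum>i. \<Sum>l. ennreal (1 / 2 ^ Suc (k + l)) * indicator (dyadic (k + l)) (x i))"
      by (subst suminf_swap_ennreal) simp
    also have "\<dots> \<le> small_mass x k"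
      unfolding small_mass_def
    proof (intro suminf_le summableI)
      fix i
      show "(\<Sum>l. ennreal (1 / 2 ^ Suc (k + l)) * indicator (dyadic (k + l)) (x i)) \<le> ennreal (x i) * indicator {..1 / 2 ^ k} (x i)"
      proof (cases "\<exists>l. x i \<in> dyadic (k + l)")
        case True
        then obtain l where l: "x i \<in> dyadic (k + l)" by blast
        have "(\<Sum>l. ennreal (1 / 2 ^ Suc (k + l)) * indicator (dyadic (k + l)) (x i)) =
          (\<Sum>l\<in>{l}. ennreal (1 / 2 ^ Suc (k + l)) * indicator (dyadic (k + l)) (x i))"
          by (intro suminf_finite) (auto simp: indicator_def dest!: dyadic_unique[OF l])
        also have "\<dots> = ennreal (1 / 2 ^ Suc (k + l))" using l by simp
        also have "\<dots> \<le> ennreal (x i)" using l by (intro ennreal_leI) (simp add: dyadic_def)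
        also have "\<dots> = ennreal (x i) * indicator {..1 / 2 ^ k} (x i)" using dyadic_le[OF l, of k] by simp
        finally show ?thesis .
      qed simp
    qed
    finally show ?thesis .
  qed
  then show ?thesis by (auto simp: eventually_sequentially)
qed

lemma large_count_le: "(\<Sum>i. indicator {1 / 2 ^ k<..} (x i)) \<le> ennreal (4 * K * block_scale k)"
proof -
  have "(\<Sum>i. indicator {1 / 2 ^ k<..} (x i)) \<le> (\<Sum>i. \<Sum>l<k. indicator (dyadic l) (x i) :: ennreal)"
  proof (intro suminf_le summableI)
    fix i
    show "(indicator {1 / 2 ^ k<..} (x i) :: ennreal) \<le> (\<Sum>l<k. indicator (dyadic l) (x i))"
    proof (cases "1 / 2 ^ k < x i")
      case True
      have "0 < (1::real) / 2 ^ k" by simp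
      then have "0 < x i" using True by linarith
      then obtain l where l: "x i \<in> dyadic l" using dyadic_ex[of "x i" 0] x_le1 by auto
      have "l < k" using dyadic_le[OF l, of k] True by (cases "l < k") auto
      then have "(\<Sum>l\<in>{l}. indicator (dyadic l) (x i)) \<le> (\<Sum>l<k. indicator (dyadic l) (x i) :: ennreal)"
        by (intro sum_mono2) auto
      then show ?thesis using l by (auto split: split_indicator)
    qed simp
  qed
  also have "\<dots> = (\<Sum>l<k. \<Sum>i. indicator (dyadic l) (x i))"
    by (rule suminf_sum) simp
  also have "\<dots> \<le> (\<Sum>l<k. ennreal (K * level_size l))"
    by (intro sum_mono level_upper)
  also have "\<dots> = ennreal (\<Sum>l<k. K * level_size l)"
    using K0 less_imp_le[OF level_size_pos] by (intro sum_ennreal) auto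
  also have "\<dots> \<le> ennreal (4 * K * block_scale k)"
    using mult_left_mono[OF sum_level_size_le K0, of k] by (intro ennreal_leI) (simp add: sum_distrib_left mult_ac)
  finally show ?thesis .
qed

lemma small_mass_0: "small_mass x 0 = (\<Sum>i. ennreal (x i))"
  unfolding small_mass_def using x_le1 by (intro suminf_cong) simp

lemma edge_rate_sum_finite: "(\<integral>\<^sup>+e. ennreal (edge_rate x e) \<partial>count_space UNIV) \<le> ennreal (K * K)"
proof -
  have "(\<integral>\<^sup>+e. ennreal (edge_rate x e) \<partial>count_space UNIV) \<le> (\<Sum>i. \<Sum>j. ennreal (x i) * ennreal (x j))"
    unfolding nn_integral_count_space_pairs using x_ge0
    by (intro suminf_le summableI) (auto simp: edge_rate_def ennreal_mult)
  also have "\<dots> = small_mass x 0 * small_mass x 0" by (simp add: small_mass_0)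
  also have "\<dots> \<le> ennreal K * ennreal K" using small_mass_le[of 0] by (intro mult_mono) auto
  finally show ?thesis using K0 by (simp add: ennreal_mult)
qed

lemma small_edge_rate_sum_le:
  "(\<integral>\<^sup>+e. ennreal (small_edge_rate k x e) \<partial>count_space UNIV) \<le> ennreal (2 * K * K / real (Suc k))"
proof -
  let ?I = "\<lambda>i. indicator {..1 / 2 ^ k} (x i) :: ennreal"
  have "(\<integral>\<^sup>+e. ennreal (small_edge_rate k x e) \<partial>count_space UNIV) \<le>
     (\<Sum>i. \<Sum>j. (ennreal (x i) * ?I i) * ennreal (x j) + ennreal (x i) * (ennreal (x j) * ?I j))"
    unfolding nn_integral_count_space_pairs using x_ge0
    by (intro suminf_le summableI) (auto simp: small_edge_rate_def ennreal_mult split: split_indicator)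
  also have "\<dots> = small_mass x k * small_mass x 0 + small_mass x 0 * small_mass x k"
    unfolding small_mass_0 by (simp add: suminf_add[symmetric] small_mass_def)
  also have "\<dots> \<le> ennreal (K / real (Suc k)) * ennreal K + ennreal K * ennreal (K / real (Suc k))"
    using small_mass_le[of 0] small_mass_le[of k] by (intro add_mono mult_mono) auto
  also have "\<dots> = ennreal (2 * K * K / real (Suc k))"
    using K0 by (simp add: ennreal_mult[symmetric] ennreal_plus[symmetric] mult_ac del: ennreal_plus)
  finally show ?thesis .
qed

lemma hub_sum_le: "(\<integral>\<^sup>+i. ennreal (hub_prob j k x i) \<partial>count_space UNIV) \<le> ennreal (K * block_scale k)"
proof -
  have "(\<integral>\<^sup>+i. ennreal (hub_prob j k x i) \<partial>count_space UNIV) \<le> (\<Sum>i. ennreal (2 ^ k) * (ennreal (x i) * indicator {..1 / 2 ^ k} (x i)))"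
    unfolding nn_integral_count_space_nat
  proof (intro suminf_le summableI)
    fix i
    have p: "0 \<le> x i * x j" "x i * x j \<le> 1" using x_ge0 x_le1 by (auto intro: mult_le_one)
    have "1 - (1 - x i * x j) ^ (2 ^ k) \<le> 2 ^ k * (x i * x j)"
      using one_minus_power_bounds(1)[OF p, of "2 ^ k"] by simp
    also have "\<dots> \<le> 2 ^ k * (x i * 1)" using x_ge0 x_le1 by (intro mult_left_mono) auto
    finally have "ennreal (1 - (1 - x i * x j) ^ (2 ^ k)) \<le> ennreal (2 ^ k * x i)" by (intro ennreal_leI) simp
    also have "\<dots> = ennreal (2 ^ k) * ennreal (x i)" using x_ge0 by (simp add: ennreal_mult)
    finally show "ennreal (hub_prob j k x i) \<le> ennreal (2 ^ k) * (ennreal (x i) * indicator {..1 / 2 ^ k} (x i))"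
      by (simp add: hub_prob_def)
  qed
  also have "\<dots> = ennreal (2 ^ k) * small_mass x k" by (simp add: small_mass_def)
  also have "\<dots> \<le> ennreal (2 ^ k) * ennreal (K / real (Suc k))" by (intro mult_left_mono small_mass_le) auto
  also have "\<dots> = ennreal (K * block_scale k)"
    using K0 by (subst ennreal_mult[symmetric]) (auto simp: block_scale_def)
  finally show ?thesis .
qed

text \<open>Once \<open>1 / 2 ^ k\<close> is below the weight of the hub, the hub itself is not light, so the exclusion \<open>i \<noteq> j\<close> costs
  nothing and the sum is at least \<open>2 ^ k * x j / 2\<close> times the light mass.\<close>

lemma hub_sum_ge:
  assumes "0 < x j"
  shows "\<forall>\<^sub>F k in sequentially. ennreal (x j * c / 4 * block_scale k) \<le> (\<integral>\<^sup>+i. ennreal (hub_prob j k x i) \<partial>count_space UNIV)"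
proof -
  obtain n where n: "1 / 2 ^ n < x j"
    using real_arch_pow_inv[OF assms, of "1/2"] by (auto simp: power_divide)
  show ?thesis using small_mass_ge eventually_ge_at_top[of n]
  proof eventually_elim
    case (elim k)
    have "(1::real) / 2 ^ k \<le> 1 / 2 ^ n" using elim by (intro divide_left_mono power_increasing) auto
    then have kj: "1 / 2 ^ k < x j" using n by linarith
    have "ennreal (x j * c / 4 * block_scale k) = ennreal (2 ^ k * x j / 2) * ennreal (c / 2 / real (Suc k))"
      using assms c0 by (subst ennreal_mult[symmetric]) (auto simp: block_scale_def field_simps)
    also have "\<dots> \<le> ennreal (2 ^ k * x j / 2) * small_mass x k"
      by (intro mult_left_mono elim) auto
    also have "\<dots> = (\<Sum>i. ennreal (2 ^ k * x j / 2) * (ennreal (x i) * indicator {..1 / 2 ^ k} (x i)))"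
      by (simp add: small_mass_def)
    also have "\<dots> \<le> (\<Sum>i. ennreal (hub_prob j k x i))"
    proof (intro suminf_le summableI)
      fix i
      show "ennreal (2 ^ k * x j / 2) * (ennreal (x i) * indicator {..1 / 2 ^ k} (x i)) \<le> ennreal (hub_prob j k x i)"
      proof (cases "x i \<le> 1 / 2 ^ k")
        case True
        then have ij: "i \<noteq> j" using kj by auto
        have p: "0 \<le> x i * x j" "x i * x j \<le> 1" using x_ge0 x_le1 by (auto intro: mult_le_one)
        have "x i * x j \<le> 1 / 2 ^ k * 1" using True x_le1 x_ge0 by (intro mult_mono) auto
        then have "real (2 ^ k) * (x i * x j) \<le> 1" by (simp add: field_simps)
        from one_minus_power_bounds(2)[OF p this]
        have le: "2 ^ k * x j / 2 * x i \<le> hub_prob j k x i" using True ij by (simp add: hub_prob_def mult_ac)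
        have "ennreal (2 ^ k * x j / 2) * (ennreal (x i) * indicator {..1 / 2 ^ k} (x i)) = ennreal (2 ^ k * x j / 2 * x i)"
          using True assms x_ge0 by (subst ennreal_mult) auto
        also have "\<dots> \<le> ennreal (hub_prob j k x i)" using le by (rule ennreal_leI)
        finally show ?thesis .
      qed simp
    qed
    finally show ?case by (simp add: nn_integral_count_space_nat)
  qed
qed

lemma ex_small_positive: "\<exists>i. 0 < x i \<and> x i \<le> 1 / 2 ^ k"
proof (rule ccontr)
  assume "\<not> ?thesis"
  then have z: "\<And>i. x i \<le> 1 / 2 ^ k \<Longrightarrow> x i = 0" using x_ge0 by (metis less_eq_real_def)
  obtain k' where k': "k \<le> k'" "ennreal (c / 2 / real (Suc k')) \<le> small_mass x k'"
    using small_mass_ge by (auto simp: eventually_sequentially) (meson nat_le_linear)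
  have "small_mass x k' = 0"
  proof -
    have "ennreal (x i) * indicator {..1 / 2 ^ k'} (x i) = 0" for i
    proof (cases "x i \<le> 1 / 2 ^ k'")
      case True
      also have "(1::real) / 2 ^ k' \<le> 1 / 2 ^ k" using k' by (intro divide_left_mono power_increasing) auto
      finally have "x i = 0" by (rule z)
      then show ?thesis by simp
    qed simp
    then show ?thesis by (simp only: small_mass_def suminf_zero)
  qed
  with k' c0 show False by (simp add: ennreal_le_iff2 divide_le_eq)
qed

lemma edge_rate_sum_pos: "0 < (\<integral>\<^sup>+e. ennreal (edge_rate x e) \<partial>count_space UNIV)"
proof -
  obtain i where i: "0 < x i" using ex_small_positive[of 0] by auto
  obtain n where n: "1 / 2 ^ n < x i"
    using real_arch_pow_inv[OF i, of "1/2"] by (auto simp: power_divide)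
  obtain j where j: "0 < x j" "x j \<le> 1 / 2 ^ n" using ex_small_positive[of n] by auto
  have ij: "i \<noteq> j" using n j by auto
  define e where "e = (min i j, max i j)"
  have "0 < ennreal (edge_rate x e)" using i j ij by (auto simp: edge_rate_def e_def min_def max_def)
  also have "\<dots> \<le> (\<integral>\<^sup>+e. ennreal (edge_rate x e) \<partial>count_space UNIV)"
    by (rule nn_integral_ge_point) simp
  finally show ?thesis .
qed

end

section \<open>The conditional law of the edges\<close>

lemma pmf_map_of_bool_bernoulli:
  assumes "0 \<le> q" "q \<le> 1"
  shows "pmf (map_pmf of_bool (bernoulli_pmf q)) n = (if n = (0::nat) then 1 - q else if n = 1 then q else 0)"
proof -
  have vim: "of_bool -` {n} = (if n = (0::nat) then {False} else if n = 1 then {True} else {})"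
  proof (rule set_eqI)
    fix b :: bool
    show "b \<in> of_bool -` {n} \<longleftrightarrow> b \<in> (if n = 0 then {False} else if n = 1 then {True} else {})"
      by (cases b) simp_all
  qed
  have "pmf (map_pmf of_bool (bernoulli_pmf q)) n = measure (measure_pmf (bernoulli_pmf q)) (of_bool -` {n})"
    by (simp add: pmf_map)
  then show ?thesis unfolding vim using assms
    by (simp add: measure_pmf_single)
qed

lemma pair_in_vertex_pairs: "i \<noteq> j \<Longrightarrow> {i, j} \<in> vertex_pairs"
  by (auto simp: vertex_pairs_def)

text \<open>The space of the rate measure confines the weights to the unit interval, so that products of weights are
  probabilities; its \<open>\<sigma>\<close>-algebra makes them Borel measurable.\<close>

locale edge_exchangeable =
  fixes M :: "'a measure" and \<nu> w m
  assumes seq: "edge_exchangeable_sequence M \<nu> w m"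
    and space_\<nu>: "space \<nu> = {0..1}" and sets_\<nu>: "sets \<nu> = sets (restrict_space borel {0..1})"
begin

sublocale prob_space M
  using seq by (simp add: edge_exchangeable_sequence_def poisson_point_process_def)

abbreviation "F \<equiv> weight_algebra M w"

lemma ppp: "poisson_point_process M \<nu> w"
  using seq by (simp add: edge_exchangeable_sequence_def)

lemma w_measurable_\<nu>: "w i \<in> M \<rightarrow>\<^sub>M \<nu>"
  using ppp by (simp add: poisson_point_process_def)

lemma w_bounds: "\<omega> \<in> space M \<Longrightarrow> 0 \<le> w i \<omega>" "\<omega> \<in> space M \<Longrightarrow> w i \<omega> \<le> 1"
  using measurable_space[OF w_measurable_\<nu>] by (auto simp: space_\<nu>)

lemma w_measurable [measurable]: "w i \<in> borel_measurable M"
proof -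
  have "w i \<in> M \<rightarrow>\<^sub>M restrict_space borel {0..1}"
    using w_measurable_\<nu>[of i] measurable_cong_sets[OF refl sets_\<nu>] by blast
  then show ?thesis by (rule measurable_restrict_space2_iff[THEN iffD1, THEN conjunct1])
qed

lemma weights_measurable: "(\<lambda>\<omega> i. w i \<omega>) \<in> M \<rightarrow>\<^sub>M Pi\<^sub>M UNIV (\<lambda>_. borel)"
  by (rule measurable_PiM_single') (auto simp: space_PiM)

lemma space_F: "space F = space M"
  by (simp add: weight_algebra_def)

lemma subalgebra_F: "subalgebra M F"
  unfolding subalgebra_def weight_algebra_def
  using measurable_sets[OF weights_measurable] weights_measurable
  by (auto simp: sets_vimage_algebra2 measurable_def)

lemma w_measurable_F [measurable]: "w i \<in> borel_measurable F"
proof -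
  have "(\<lambda>\<omega> i. w i \<omega>) \<in> F \<rightarrow>\<^sub>M Pi\<^sub>M UNIV (\<lambda>_. borel)"
    unfolding weight_algebra_def by (rule measurable_vimage_algebra1) (auto simp: space_PiM)
  then have "(\<lambda>\<omega>. (\<lambda>i. w i \<omega>) i) \<in> borel_measurable F"
    by (rule measurable_compose[OF _ measurable_component_singleton]) simp
  then show ?thesis by simp
qed

lemma m_measurable: "1 \<le> p \<Longrightarrow> e \<in> vertex_pairs \<Longrightarrow> m p e \<in> M \<rightarrow>\<^sub>M count_space UNIV"
  using seq by (simp add: edge_exchangeable_sequence_def)

lemma weight_prod_bounds:
  assumes "\<omega> \<in> space M"
  shows "0 \<le> (\<Prod>i\<in>e. w i \<omega>)" "(\<Prod>i\<in>e. w i \<omega>) \<le> 1"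
  using w_bounds[OF assms] by (auto intro!: prod_nonneg prod_le_1)

text \<open>The conditional mass function of the model, with the Bernoulli probabilities evaluated; this is legitimate since
  the weights lie in the unit interval.\<close>

lemma joint_law:
  assumes J: "finite J" "J \<subseteq> {1..} \<times> vertex_pairs"
  shows "has_cond_prob M F {\<omega> \<in> space M. \<forall>(p, e)\<in>J. m p e \<omega> = v (p, e)}
    (\<lambda>\<omega>. \<Prod>(p, e)\<in>J. if v (p, e) = 0 then 1 - (\<Prod>i\<in>e. w i \<omega>) else if v (p, e) = 1 then (\<Prod>i\<in>e. w i \<omega>) else 0)"
    (is "has_cond_prob M F ?E ?q")
proof -
  interpret sigma_finite_subalgebra M F
    by (rule finite_measure_subalgebra_is_sigma_finite)
       (simp add: finite_measure_subalgebra_def finite_measure_subalgebra_axioms_def finite_measure_axioms subalgebra_F)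
  have q01: "0 \<le> ?q \<omega> \<and> ?q \<omega> \<le> 1" if "\<omega> \<in> space M" for \<omega>
    using weight_prod_bounds[OF that] by (auto intro!: prod_nonneg prod_le_1 split: prod.splits)
  have qF: "?q \<in> borel_measurable F"
    unfolding split_beta' by measurable
  then have qM[measurable]: "?q \<in> borel_measurable M" by (rule measurable_from_subalg[OF subalgebra_F])
  have E: "?E \<in> events"
  proof -
    have "?E = (\<Inter>(p, e)\<in>J. {\<omega> \<in> space M. m p e \<omega> = v (p, e)}) \<inter> space M"
      by auto
    moreover have "{\<omega> \<in> space M. m p e \<omega> = v (p, e)} \<in> events" if "(p, e) \<in> J" for p e
    proof -
      have [measurable]: "m p e \<in> M \<rightarrow>\<^sub>M count_space UNIV" using that J by (intro m_measurable) auto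
      show ?thesis by measurable
    qed
    ultimately show ?thesis
      using J(1) by (cases "J = {}") (auto intro!: sets.Int sets.finite_INT)
  qed
  have "AE \<omega> in M. real_cond_exp M F (indicator ?E) \<omega> =
           (\<Prod>(p, e)\<in>J. pmf (map_pmf of_bool (bernoulli_pmf (\<Prod>i\<in>e. w i \<omega>))) (v (p, e)))"
    using seq J by (simp add: edge_exchangeable_sequence_def)
  with AE_space have ce: "AE \<omega> in M. real_cond_exp M F (indicator ?E) \<omega> = ?q \<omega>"
  proof eventually_elim
    case (elim \<omega>)
    then show ?case
      using weight_prod_bounds[OF elim(1)] by (simp add: pmf_map_of_bool_bernoulli)
  qed
  have "measure M (A \<inter> ?E) = (\<integral>\<omega>. indicator A \<omega> * ?q \<omega> \<partial>M)" if A: "A \<in> sets F" for A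
  proof -
    have [measurable]: "A \<in> events" using A subalgebra_F by (auto simp: subalgebra_def)
    have "measure M (A \<inter> ?E) = (\<integral>\<omega>. indicator (A \<inter> ?E) \<omega> \<partial>M)" using E by simp
    also have "\<dots> = (\<integral>\<omega>\<in>A. indicator ?E \<omega> \<partial>M)"
      unfolding set_lebesgue_integral_def by (simp add: indicator_inter_arith)
    also have "\<dots> = (\<integral>\<omega>\<in>A. real_cond_exp M F (indicator ?E) \<omega> \<partial>M)"
      by (rule real_cond_exp_intA[OF _ A]) (use E in \<open>auto simp: less_top[symmetric]\<close>)
    also have "\<dots> = (\<integral>\<omega>\<in>A. ?q \<omega> \<partial>M)"
      unfolding set_lebesgue_integral_def
      by (rule integral_cong_AE) (use ce in \<open>auto intro!: borel_measurable_indicator\<close>)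
    finally show ?thesis by (simp add: set_lebesgue_integral_def)
  qed
  with E qF q01 show ?thesis unfolding has_cond_prob_def by blast
qed

lemma AE_multiplicity_le_1: "AE \<omega> in M. \<forall>p e. 1 \<le> p \<longrightarrow> e \<in> vertex_pairs \<longrightarrow> m p e \<omega> \<le> 1"
proof -
  have ae: "AE \<omega> in M. \<not> (m p e \<omega> = n \<and> 2 \<le> n)" if pe: "1 \<le> p" "e \<in> vertex_pairs" for p e n
  proof (cases "2 \<le> n")
    case True
    have [measurable]: "m p e \<in> M \<rightarrow>\<^sub>M count_space UNIV" using pe by (rule m_measurable)
    have h: "has_cond_prob M F {\<omega> \<in> space M. m p e \<omega> = n} (\<lambda>_. 0)"
      using joint_law[of "{(p, e)}" "\<lambda>_. n"] pe True by simp
    have "space M \<inter> {\<omega> \<in> space M. m p e \<omega> = n} = {\<omega> \<in> space M. m p e \<omega> = n}" by auto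
    then have "prob {\<omega> \<in> space M. m p e \<omega> = n} = 0"
      using has_cond_probD(5)[OF h, of "space M"] sets.top[of F] by (simp add: space_F)
    then have "AE \<omega> in M. m p e \<omega> \<noteq> n"
      by (subst AE_iff_measurable[where N = "{\<omega> \<in> space M. m p e \<omega> = n}"]) (auto simp: emeasure_eq_measure)
    then show ?thesis by eventually_elim simp
  qed simp
  have "vertex_pairs \<subseteq> Collect finite" by (auto simp: vertex_pairs_def)
  then have "countable vertex_pairs" using countable_Collect_finite by (rule countable_subset)
  then have "AE \<omega> in M. \<forall>e\<in>vertex_pairs. \<forall>p\<in>{1..}. \<forall>n. \<not> (m p e \<omega> = n \<and> 2 \<le> n)"
    by (intro AE_ball_countable[THEN iffD2] ballI AE_all_countable[THEN iffD2] allI ae) auto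
  then show ?thesis by eventually_elim (force simp: not_le)
qed

lemma edge_event:
  assumes "1 \<le> p" "i < j"
  shows "has_cond_prob M F {\<omega> \<in> space M. m p {i, j} \<omega> = 1} (\<lambda>\<omega>. w i \<omega> * w j \<omega>)"
  using joint_law[of "{(p, {i, j})}" "\<lambda>_. 1"] assms by (simp add: pair_in_vertex_pairs)

lemma edge_event_pair:
  assumes "1 \<le> p" "i < j" "1 \<le> p'" "i' < j'" and ne: "(p, i, j) \<noteq> (p', i', j')"
  shows "has_cond_prob M F ({\<omega> \<in> space M. m p {i, j} \<omega> = 1} \<inter> {\<omega> \<in> space M. m p' {i', j'} \<omega> = 1})
    (\<lambda>\<omega>. (w i \<omega> * w j \<omega>) * (w i' \<omega> * w j' \<omega>))"
proof -
  have ne': "(p, {i, j}) \<noteq> (p', {i', j'})" using assms by (auto simp: doubleton_eq_iff)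
  have "has_cond_prob M F {\<omega> \<in> space M. \<forall>(p, e)\<in>{(p, {i, j}), (p', {i', j'})}. m p e \<omega> = 1}
    (\<lambda>\<omega>. \<Prod>(p, e)\<in>{(p, {i, j}), (p', {i', j'})}. \<Prod>i\<in>e. w i \<omega>)"
    using joint_law[of "{(p, {i, j}), (p', {i', j'})}" "\<lambda>_. 1"] assms by (simp add: pair_in_vertex_pairs)
  moreover have "{\<omega> \<in> space M. \<forall>(p, e)\<in>{(p, {i, j}), (p', {i', j'})}. m p e \<omega> = 1}
      = {\<omega> \<in> space M. m p {i, j} \<omega> = 1} \<inter> {\<omega> \<in> space M. m p' {i', j'} \<omega> = 1}" by auto
  moreover have "(\<lambda>\<omega>. \<Prod>(p, e)\<in>{(p, {i, j}), (p', {i', j'})}. \<Prod>i\<in>e. w i \<omega>)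
     = (\<lambda>\<omega>. (w i \<omega> * w j \<omega>) * (w i' \<omega> * w j' \<omega>))"
    using ne' assms by (subst prod.insert) auto
  ultimately show ?thesis by metis
qed

text \<open>The sets \<open>C k e\<close> select pairs of vertices by a criterion on the weights. The events counted are \<open>m p {i, j} = 1\<close>,
  which describe the multiplicities completely because these are almost surely 0 or 1.\<close>

lemma edge_concentration:
  fixes C :: "nat \<Rightarrow> nat \<times> nat \<Rightarrow> 'a set" and a :: "nat \<Rightarrow> real"
  assumes C: "\<And>k e. C k e \<in> sets F" and a: "\<And>k. 0 < a k" and a_sum: "summable (\<lambda>k. 1 / a k)"
  defines "X \<equiv> \<lambda>k \<omega>. \<integral>\<^sup>+(i, j). (if i < j \<and> \<omega> \<in> C k (i, j) then of_nat (multiplicity_upto m (2 ^ k) {i, j} \<omega>) else 0) \<partial>count_space UNIV"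
    and "\<mu> \<equiv> \<lambda>k \<omega>. ennreal (2 ^ k) * (\<integral>\<^sup>+(i, j). (if i < j \<and> \<omega> \<in> C k (i, j) then ennreal (w i \<omega> * w j \<omega>) else 0) \<partial>count_space UNIV)"
  shows "AE \<omega> in M. (\<exists>K. \<forall>k. \<mu> k \<omega> \<le> ennreal (K * a k)) \<longrightarrow>
     (\<forall>k. X k \<omega> < \<infinity>) \<and> (\<lambda>k. (enn2real (X k \<omega>) - enn2real (\<mu> k \<omega>)) / a k) \<longlonglongrightarrow> 0"
proof -
  define B :: "nat \<Rightarrow> nat \<times> nat \<times> nat \<Rightarrow> 'a set"
    where "B k = (\<lambda>(p, i, j). if 1 \<le> p \<and> p \<le> 2 ^ k \<and> i < j then {\<omega> \<in> space M. m p {i, j} \<omega> = 1} \<inter> C k (i, j) else {})" for k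
  define q :: "nat \<Rightarrow> nat \<times> nat \<times> nat \<Rightarrow> 'a \<Rightarrow> real"
    where "q k = (\<lambda>(p, i, j) \<omega>. if 1 \<le> p \<and> p \<le> 2 ^ k \<and> i < j then indicator (C k (i, j)) \<omega> * (w i \<omega> * w j \<omega>) else 0)" for k
  have one: "has_cond_prob M F (B k e) (q k e)" for k e
  proof (cases e)
    case (fields p i j)
    then show ?thesis
      using has_cond_prob_Int_subalgebra[OF subalgebra_F edge_event[of p i j] C[of k "(i, j)"]]
        has_cond_prob_empty
      by (auto simp: B_def q_def)
  qed
  have two: "has_cond_prob M F (B k e \<inter> B k e') (\<lambda>\<omega>. q k e \<omega> * q k e' \<omega>)" if "e \<noteq> e'" for k e e'
  proof (cases e; cases e')
    fix p i j p' i' j' assume e: "e = (p, i, j)" "e' = (p', i', j')"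
    show ?thesis
    proof (cases "(1 \<le> p \<and> p \<le> 2 ^ k \<and> i < j) \<and> (1 \<le> p' \<and> p' \<le> 2 ^ k \<and> i' < j')")
      case True
      have "has_cond_prob M F ({\<omega> \<in> space M. m p {i, j} \<omega> = 1} \<inter> {\<omega> \<in> space M. m p' {i', j'} \<omega> = 1} \<inter> (C k (i, j) \<inter> C k (i', j')))
         (\<lambda>\<omega>. indicator (C k (i, j) \<inter> C k (i', j')) \<omega> * ((w i \<omega> * w j \<omega>) * (w i' \<omega> * w j' \<omega>)))"
        using True that e by (intro has_cond_prob_Int_subalgebra subalgebra_F edge_event_pair sets.Int C) auto
      then show ?thesis
        using subalgebra_F by (rule has_cond_prob_cong) (use True e in \<open>auto simp: B_def q_def indicator_inter_arith\<close>)
    next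
      case False
      show ?thesis
        using has_cond_prob_empty subalgebra_F
        by (rule has_cond_prob_cong) (use False e in \<open>auto simp: B_def q_def\<close>)
    qed
  qed
  have Xeq: "AE \<omega> in M. \<forall>k. X k \<omega> = (\<integral>\<^sup>+e. indicator (B k e) \<omega> \<partial>count_space UNIV)"
    using AE_multiplicity_le_1 AE_space
  proof eventually_elim
    case (elim \<omega>)
    show ?case
    proof
      fix k
      have "(\<integral>\<^sup>+e. indicator (B k e) \<omega> \<partial>count_space UNIV) = 
        (\<integral>\<^sup>+e. \<integral>\<^sup>+p. indicator (B k (p, e)) \<omega> \<partial>count_space UNIV \<partial>count_space UNIV)"
        by (rule nn_integral_snd_count_space[symmetric])
      also have "\<dots> = X k \<omega>"
        unfolding X_def
      proof (rule nn_integral_cong)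
        fix e :: "nat \<times> nat"
        obtain i j where e: "e = (i, j)" by (cases e)
        have "(\<integral>\<^sup>+p. indicator (B k (p, e)) \<omega> \<partial>count_space UNIV)
          = (\<integral>\<^sup>+p. (if i < j \<and> \<omega> \<in> C k (i, j) then of_nat (m p {i, j} \<omega>) else 0) * indicator {1..2 ^ k} p \<partial>count_space UNIV)"
        proof (rule nn_integral_cong)
          fix p :: nat
          have "m p {i, j} \<omega> = 0 \<or> m p {i, j} \<omega> = 1" if "1 \<le> p" "i < j"
          proof -
            have "m p {i, j} \<omega> \<le> 1" using elim(1) that pair_in_vertex_pairs[of i j] by auto
            then show ?thesis by linarith
          qed
          then show "indicator (B k (p, e)) \<omega> = (if i < j \<and> \<omega> \<in> C k (i, j) then of_nat (m p {i, j} \<omega>) else 0) * (indicator {1..2 ^ k} p :: ennreal)"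
            using elim(2) by (auto simp: B_def e split: split_indicator)
        qed
        also have "\<dots> = (\<Sum>p=1..2 ^ k. (if i < j \<and> \<omega> \<in> C k (i, j) then of_nat (m p {i, j} \<omega>) else 0))"
          by (subst nn_integral_indicator_finite) simp_all
        also have "\<dots> = (case e of (i, j) \<Rightarrow> if i < j \<and> \<omega> \<in> C k (i, j) then of_nat (multiplicity_upto m (2 ^ k) {i, j} \<omega>) else 0)"
          by (cases "i < j \<and> \<omega> \<in> C k (i, j)") (simp_all add: e multiplicity_upto_def del: de_Morgan_conj)
        finally show "(\<integral>\<^sup>+p. indicator (B k (p, e)) \<omega> \<partial>count_space UNIV) = \<dots>" .
      qed
      finally show "X k \<omega> = (\<integral>\<^sup>+e. indicator (B k e) \<omega> \<partial>count_space UNIV)" by simp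
    qed
  qed
  have \<mu>eq: "\<mu> k \<omega> = (\<integral>\<^sup>+e. ennreal (q k e \<omega>) \<partial>count_space UNIV)" for k \<omega>
  proof -
    have "(\<integral>\<^sup>+e. ennreal (q k e \<omega>) \<partial>count_space UNIV) = 
      (\<integral>\<^sup>+e. \<integral>\<^sup>+p. ennreal (q k (p, e) \<omega>) \<partial>count_space UNIV \<partial>count_space UNIV)"
      by (rule nn_integral_snd_count_space[symmetric])
    also have "\<dots> = (\<integral>\<^sup>+e. ennreal (2 ^ k) * (case e of (i, j) \<Rightarrow> if i < j \<and> \<omega> \<in> C k (i, j) then ennreal (w i \<omega> * w j \<omega>) else 0) \<partial>count_space UNIV)"
    proof (rule nn_integral_cong)
      fix e :: "nat \<times> nat"
      obtain i j where e: "e = (i, j)" by (cases e)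
      have "(\<integral>\<^sup>+p. ennreal (q k (p, e) \<omega>) \<partial>count_space UNIV)
          = (\<integral>\<^sup>+p. (if i < j \<and> \<omega> \<in> C k (i, j) then ennreal (w i \<omega> * w j \<omega>) else 0) * indicator {1..2 ^ k} (p :: nat) \<partial>count_space UNIV)"
        by (rule nn_integral_cong) (auto simp: q_def e split: split_indicator)
      also have "\<dots> = (\<Sum>p::nat=1..2 ^ k. (if i < j \<and> \<omega> \<in> C k (i, j) then ennreal (w i \<omega> * w j \<omega>) else 0))"
        by (subst nn_integral_indicator_finite) simp_all
      also have "\<dots> = ennreal (2 ^ k) * (case e of (i, j) \<Rightarrow> if i < j \<and> \<omega> \<in> C k (i, j) then ennreal (w i \<omega> * w j \<omega>) else 0)"
        by (simp add: e ennreal_of_nat_eq_real_of_nat)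
      finally show "(\<integral>\<^sup>+p. ennreal (q k (p, e) \<omega>) \<partial>count_space UNIV) = \<dots>" .
    qed
    also have "\<dots> = \<mu> k \<omega>" unfolding \<mu>_def by (rule nn_integral_cmult) simp
    finally show ?thesis by simp
  qed
  have "AE \<omega> in M. (\<exists>K. \<forall>k. (\<integral>\<^sup>+e. ennreal (q k e \<omega>) \<partial>count_space UNIV) \<le> ennreal (K * a k)) \<longrightarrow>
     (\<forall>k. (\<integral>\<^sup>+e. indicator (B k e) \<omega> \<partial>count_space UNIV) < \<infinity>) \<and>
     (\<lambda>k. (enn2real (\<integral>\<^sup>+e. indicator (B k e) \<omega> \<partial>count_space UNIV)
       - enn2real (\<integral>\<^sup>+e. ennreal (q k e \<omega>) \<partial>count_space UNIV)) / a k) \<longlonglongrightarrow> 0"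
    by (rule cond_pairwise_concentration[OF subalgebra_F one two a a_sum])
  then show ?thesis using Xeq
    unfolding \<mu>eq by eventually_elim (simp cong: if_cong)
qed

lemma no_edge_event:
  assumes "finite E" "E \<subseteq> vertex_pairs"
  shows "has_cond_prob M F {\<omega> \<in> space M. \<forall>p\<in>{1..t}. \<forall>e\<in>E. m p e \<omega> = 0} (\<lambda>\<omega>. (\<Prod>e\<in>E. 1 - (\<Prod>i\<in>e. w i \<omega>)) ^ t)"
proof -
  have eq: "(\<Prod>(p, e)\<in>{1..t} \<times> E. f e) = (\<Prod>e\<in>E. f e) ^ t" for f :: "nat set \<Rightarrow> real"
    by (simp add: prod.cartesian_product[symmetric])
  have "has_cond_prob M F {\<omega> \<in> space M. \<forall>(p, e)\<in>{1..t} \<times> E. m p e \<omega> = 0} (\<lambda>\<omega>. \<Prod>(p, e)\<in>{1..t} \<times> E. 1 - (\<Prod>i\<in>e. w i \<omega>))"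
  proof -
    have "finite ({1..t} \<times> E)" "{1..t} \<times> E \<subseteq> {1..} \<times> vertex_pairs" using assms by auto
    from joint_law[OF this, of "\<lambda>_. 0"] show ?thesis by simp
  qed
  then show ?thesis
    using subalgebra_F
  proof (rule has_cond_prob_cong)
    show "(\<Prod>(p, e)\<in>{1..t} \<times> E. 1 - (\<Prod>i\<in>e. w i \<omega>)) = (\<Prod>e\<in>E. 1 - (\<Prod>i\<in>e. w i \<omega>)) ^ t" for \<omega>
      by (rule eq)
  qed auto
qed

lemma hub_event:
  assumes "i \<noteq> j"
  shows "has_cond_prob M F {\<omega> \<in> space M. \<exists>p\<in>{1..t}. m p {i, j} \<omega> \<noteq> 0} (\<lambda>\<omega>. 1 - (1 - w i \<omega> * w j \<omega>) ^ t)"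
proof -
  have N: "has_cond_prob M F {\<omega> \<in> space M. \<forall>p\<in>{1..t}. \<forall>e\<in>{{i, j}}. m p e \<omega> = 0} (\<lambda>\<omega>. (1 - w i \<omega> * w j \<omega>) ^ t)"
    using no_edge_event[of "{{i, j}}" t] assms by (simp add: pair_in_vertex_pairs)
  have "has_cond_prob M F (space M - {\<omega> \<in> space M. \<forall>p\<in>{1..t}. \<forall>e\<in>{{i, j}}. m p e \<omega> = 0}) (\<lambda>\<omega>. 1 - (1 - w i \<omega> * w j \<omega>) ^ t)"
    by (rule has_cond_prob_Diff[OF subalgebra_F has_cond_prob_space[OF subalgebra_F] N has_cond_probD(4)[OF N]]) auto
  then show ?thesis using subalgebra_F by (rule has_cond_prob_cong) auto
qed

text \<open>Independence passes from the joint absence of edges, whose probability the model gives, to the joint presence by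
  inclusion-exclusion, written as a difference of nested events.\<close>

lemma hub_event_pair:
  assumes "i \<noteq> j" "i' \<noteq> j" "i \<noteq> i'"
  shows "has_cond_prob M F ({\<omega> \<in> space M. \<exists>p\<in>{1..t}. m p {i, j} \<omega> \<noteq> 0} \<inter> {\<omega> \<in> space M. \<exists>p\<in>{1..t}. m p {i', j} \<omega> \<noteq> 0})
    (\<lambda>\<omega>. (1 - (1 - w i \<omega> * w j \<omega>) ^ t) * (1 - (1 - w i' \<omega> * w j \<omega>) ^ t))"
proof -
  let ?N = "\<lambda>E. {\<omega> \<in> space M. \<forall>p\<in>{1..t}. \<forall>e\<in>E. m p e \<omega> = 0}"
  have ne: "{i, j} \<noteq> {i', j}" using assms by (auto simp: doubleton_eq_iff)
  have N: "has_cond_prob M F (?N {{i', j}}) (\<lambda>\<omega>. (1 - w i' \<omega> * w j \<omega>) ^ t)"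
    using no_edge_event[of "{{i', j}}" t] assms by (simp add: pair_in_vertex_pairs)
  have "has_cond_prob M F (?N {{i, j}, {i', j}}) (\<lambda>\<omega>. (\<Prod>e\<in>{{i, j}, {i', j}}. 1 - (\<Prod>i\<in>e. w i \<omega>)) ^ t)"
    using no_edge_event[of "{{i, j}, {i', j}}" t] assms by (simp add: pair_in_vertex_pairs)
  moreover have "(\<lambda>\<omega>. (\<Prod>e\<in>{{i, j}, {i', j}}. 1 - (\<Prod>i\<in>e. w i \<omega>)) ^ t) = (\<lambda>\<omega>. (1 - w i \<omega> * w j \<omega>) ^ t * (1 - w i' \<omega> * w j \<omega>) ^ t)"
    using ne assms by (subst prod.insert) (auto simp: power_mult_distrib)
  ultimately have N2: "has_cond_prob M F (?N {{i, j}, {i', j}}) (\<lambda>\<omega>. (1 - w i \<omega> * w j \<omega>) ^ t * (1 - w i' \<omega> * w j \<omega>) ^ t)"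
    by metis
  have b: "0 \<le> (1 - w i \<omega> * w j \<omega>) ^ t" "(1 - w i \<omega> * w j \<omega>) ^ t \<le> 1" if "\<omega> \<in> space M" for i \<omega>
    using w_bounds[OF that] mult_le_one[OF w_bounds(2)[OF that, of i] w_bounds(1)[OF that, of j] w_bounds(2)[OF that, of j]]
    by (auto intro!: power_le_one)
  have D: "has_cond_prob M F (?N {{i', j}} - ?N {{i, j}, {i', j}})
      (\<lambda>\<omega>. (1 - w i' \<omega> * w j \<omega>) ^ t - (1 - w i \<omega> * w j \<omega>) ^ t * (1 - w i' \<omega> * w j \<omega>) ^ t)"
    using b by (intro has_cond_prob_Diff[OF subalgebra_F N N2]) (auto simp: mult_left_le_one_le)
  \<comment> \<open>removing from the presence of \<open>{i, j}\<close> the outcomes with \<open>{i, j}\<close> present and \<open>{i', j}\<close> absent\<close>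
  have "has_cond_prob M F ({\<omega> \<in> space M. \<exists>p\<in>{1..t}. m p {i, j} \<omega> \<noteq> 0} - (?N {{i', j}} - ?N {{i, j}, {i', j}}))
      (\<lambda>\<omega>. (1 - (1 - w i \<omega> * w j \<omega>) ^ t) - ((1 - w i' \<omega> * w j \<omega>) ^ t - (1 - w i \<omega> * w j \<omega>) ^ t * (1 - w i' \<omega> * w j \<omega>) ^ t))"
  proof (rule has_cond_prob_Diff[OF subalgebra_F hub_event[OF assms(1)] D])
    fix \<omega> assume \<omega>: "\<omega> \<in> space M"
    have "0 \<le> (1 - (1 - w i \<omega> * w j \<omega>) ^ t) * (1 - (1 - w i' \<omega> * w j \<omega>) ^ t)"
      using b[OF \<omega>] by (intro mult_nonneg_nonneg) auto
    then show "(1 - w i' \<omega> * w j \<omega>) ^ t - (1 - w i \<omega> * w j \<omega>) ^ t * (1 - w i' \<omega> * w j \<omega>) ^ t \<le> 1 - (1 - w i \<omega> * w j \<omega>) ^ t"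
      by (simp add: algebra_simps)
  qed auto
  then show ?thesis
    using subalgebra_F by (rule has_cond_prob_cong) (auto simp: algebra_simps)
qed

text \<open>The number of light vertices joined to \<open>j\<close> counts vertices, not edges, so the event of a vertex involves all
  \<open>2 ^ k\<close> steps; distinct vertices use distinct pairs and are therefore conditionally independent.\<close>

lemma hub_concentration:
  fixes a :: "nat \<Rightarrow> real" and j :: nat
  assumes a: "\<And>k. 0 < a k" and a_sum: "summable (\<lambda>k. 1 / a k)"
  defines "X \<equiv> \<lambda>k \<omega>. \<integral>\<^sup>+i. (if i \<noteq> j \<and> w i \<omega> \<le> 1 / 2 ^ k \<and> multiplicity_upto m (2 ^ k) {i, j} \<omega> \<noteq> 0 then 1 else 0) \<partial>count_space UNIV"
    and "\<mu> \<equiv> \<lambda>k \<omega>. \<integral>\<^sup>+i. ennreal (if i \<noteq> j \<and> w i \<omega> \<le> 1 / 2 ^ k then 1 - (1 - w i \<omega> * w j \<omega>) ^ (2 ^ k) else 0) \<partial>count_space UNIV"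
  shows "AE \<omega> in M. (\<exists>K. \<forall>k. \<mu> k \<omega> \<le> ennreal (K * a k)) \<longrightarrow>
     (\<forall>k. X k \<omega> < \<infinity>) \<and> (\<lambda>k. (enn2real (X k \<omega>) - enn2real (\<mu> k \<omega>)) / a k) \<longlonglongrightarrow> 0"
proof -
  define S where "S k i = {\<omega> \<in> space F. w i \<omega> \<le> 1 / 2 ^ k}" for k :: nat and i
  have S[measurable]: "S k i \<in> sets F" for k i unfolding S_def by measurable
  define H where "H k i = {\<omega> \<in> space M. \<exists>p\<in>{1..2 ^ k}. m p {i, j} \<omega> \<noteq> 0}" for k :: nat and i
  define B where "B k i = (if i \<noteq> j then H k i \<inter> S k i else {})" for k i
  define q where "q k i \<omega> = (if i \<noteq> j then indicator (S k i) \<omega> * (1 - (1 - w i \<omega> * w j \<omega>) ^ (2 ^ k)) else 0)" for k i \<omega>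
  have one: "has_cond_prob M F (B k i) (q k i)" for k i
  proof (cases "i = j")
    case True
    then show ?thesis using has_cond_prob_empty by (simp add: B_def q_def[abs_def])
  next
    case False
    then show ?thesis
      using has_cond_prob_Int_subalgebra[OF subalgebra_F hub_event[OF False] S]
      by (simp add: B_def q_def[abs_def] H_def)
  qed
  have two: "has_cond_prob M F (B k i \<inter> B k i') (\<lambda>\<omega>. q k i \<omega> * q k i' \<omega>)" if "i \<noteq> i'" for k i i'
  proof (cases "i \<noteq> j \<and> i' \<noteq> j")
    case True
    have "has_cond_prob M F (H k i \<inter> H k i' \<inter> (S k i \<inter> S k i'))
       (\<lambda>\<omega>. indicator (S k i \<inter> S k i') \<omega> * ((1 - (1 - w i \<omega> * w j \<omega>) ^ (2 ^ k)) * (1 - (1 - w i' \<omega> * w j \<omega>) ^ (2 ^ k))))"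
      unfolding H_def using True that by (intro has_cond_prob_Int_subalgebra subalgebra_F hub_event_pair sets.Int S) auto
    then show ?thesis
      using subalgebra_F by (rule has_cond_prob_cong) (use True in \<open>auto simp: B_def q_def indicator_inter_arith\<close>)
  next
    case False
    show ?thesis
      using has_cond_prob_empty subalgebra_F
      by (rule has_cond_prob_cong) (use False in \<open>auto simp: B_def q_def\<close>)
  qed
  have eq: "X k \<omega> = (\<integral>\<^sup>+i. indicator (B k i) \<omega> \<partial>count_space UNIV)" "\<mu> k \<omega> = (\<integral>\<^sup>+i. ennreal (q k i \<omega>) \<partial>count_space UNIV)"
    if "\<omega> \<in> space M" for k \<omega>
    unfolding X_def \<mu>_def using that
    by (auto intro!: nn_integral_cong simp: B_def q_def H_def S_def space_F multiplicity_upto_def split: split_indicator)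
  have "AE \<omega> in M. (\<exists>K. \<forall>k. (\<integral>\<^sup>+e. ennreal (q k e \<omega>) \<partial>count_space UNIV) \<le> ennreal (K * a k)) \<longrightarrow>
     (\<forall>k. (\<integral>\<^sup>+e. indicator (B k e) \<omega> \<partial>count_space UNIV) < \<infinity>) \<and>
     (\<lambda>k. (enn2real (\<integral>\<^sup>+e. indicator (B k e) \<omega> \<partial>count_space UNIV)
       - enn2real (\<integral>\<^sup>+e. ennreal (q k e \<omega>) \<partial>count_space UNIV)) / a k) \<longlonglongrightarrow> 0"
    by (rule cond_pairwise_concentration[OF subalgebra_F one two a a_sum])
  then show ?thesis using AE_space
    by eventually_elim (simp add: eq)
qed

end

section \<open>Vertices, edges and their growth\<close>

lemma sum_ordered_pairs:
  fixes g :: "nat set \<Rightarrow> ennreal"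
  shows "(\<Sum>i. \<Sum>j. if j \<noteq> i then g {i, j} else 0) = 2 * (\<integral>\<^sup>+(i, j). (if i < j then g {i, j} else 0) \<partial>count_space UNIV)"
proof -
  let ?h = "\<lambda>(i, j). if i < j then g {i, j} else 0"
  have 1: "(\<Sum>i. \<Sum>j. if i < j then g {i, j} else 0) = (\<integral>\<^sup>+e. ?h e \<partial>count_space UNIV)"
    unfolding nn_integral_count_space_pairs by simp
  have 2: "(\<Sum>i. \<Sum>j. if j < i then g {i, j} else 0) = (\<integral>\<^sup>+e. ?h e \<partial>count_space UNIV)"
  proof -
    have "(\<Sum>i. \<Sum>j. if j < i then g {i, j} else 0) = (\<Sum>i. \<Sum>j. ?h (j, i))"
      by (intro suminf_cong) (simp add: doubleton_eq_iff insert_commute)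
    then show ?thesis
      unfolding nn_integral_snd_count_space[symmetric] by (simp add: nn_integral_count_space_nat)
  qed
  have "(\<Sum>i. \<Sum>j. if j \<noteq> i then g {i, j} else 0) =
     (\<Sum>i. \<Sum>j. (if i < j then g {i, j} else 0) + (if j < i then g {i, j} else 0))"
    by (intro suminf_cong) auto
  also have "\<dots> = (\<Sum>i. \<Sum>j. if i < j then g {i, j} else 0) + (\<Sum>i. \<Sum>j. if j < i then g {i, j} else 0)"
    by (simp add: suminf_add[symmetric])
  finally show ?thesis unfolding 1 2 by (simp add: mult_2)
qed

lemma multiplicity_upto_mono: "s \<le> t \<Longrightarrow> multiplicity_upto m s e \<omega> \<le> multiplicity_upto m t e \<omega>"
  unfolding multiplicity_upto_def by (intro sum_mono2) auto

lemma num_edges_eq: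
  "num_edges m t \<omega> = (\<integral>\<^sup>+(i, j). (if i < j then of_nat (multiplicity_upto m t {i, j} \<omega>) else 0) \<partial>count_space UNIV)"
  unfolding num_edges_def sum_ordered_pairs[of "\<lambda>e. of_nat (multiplicity_upto m t e \<omega>)"]
  by (simp add: ennreal_divide_times ennreal_times_divide[symmetric] mult.commute[of 2] ennreal_mult_divide_eq)

lemma num_edges_mono: "s \<le> t \<Longrightarrow> num_edges m s \<omega> \<le> num_edges m t \<omega>"
  unfolding num_edges_eq
  by (intro nn_integral_mono) (auto intro!: of_nat_mono multiplicity_upto_mono)

lemma degree_pos_iff:
  "(\<Sum>j. if j \<noteq> i then of_nat (multiplicity_upto m t {i, j} \<omega>) else 0) > (0 :: ennreal) \<longleftrightarrow>
    (\<exists>j. j \<noteq> i \<and> multiplicity_upto m t {i, j} \<omega> \<noteq> 0)"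
  by (subst zero_less_iff_neq_zero, subst suminf_eq_zero_iff) auto

lemma of_bool_le_ennreal: "(P \<Longrightarrow> Q) \<Longrightarrow> of_bool P \<le> (of_bool Q :: ennreal)"
  by (cases P) simp_all

lemma num_vertices_mono:
  assumes "s \<le> t"
  shows "num_vertices m s \<omega> \<le> num_vertices m t \<omega>"
  unfolding num_vertices_def degree_pos_iff
proof (intro suminf_le summableI of_bool_le_ennreal)
  fix i assume "\<exists>j. j \<noteq> i \<and> multiplicity_upto m s {i, j} \<omega> \<noteq> 0"
  then show "\<exists>j. j \<noteq> i \<and> multiplicity_upto m t {i, j} \<omega> \<noteq> 0"
    using multiplicity_upto_mono[OF assms, of m _ \<omega>] by (metis le_zero_eq)
qed

lemma of_bool_degree_le:
  "(of_bool ((\<Sum>j. if j \<noteq> i then of_nat (multiplicity_upto m t {i, j} \<omega>) else 0) > (0 :: ennreal)) :: ennreal)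
    \<le> (\<Sum>j. if j \<noteq> i then of_nat (multiplicity_upto m t {i, j} \<omega>) else 0)"
proof (cases "\<exists>j. j \<noteq> i \<and> multiplicity_upto m t {i, j} \<omega> \<noteq> 0")
  case True
  then obtain j where j: "j \<noteq> i" "multiplicity_upto m t {i, j} \<omega> \<noteq> 0" by blast
  have "of_nat 1 \<le> (of_nat (multiplicity_upto m t {i, j} \<omega>) :: ennreal)"
    using j by (intro of_nat_mono) simp
  also have "\<dots> = (\<Sum>j\<in>{j}. if j \<noteq> i then of_nat (multiplicity_upto m t {i, j} \<omega>) else 0)"
    using j by simp
  also have "\<dots> \<le> (\<Sum>j. if j \<noteq> i then of_nat (multiplicity_upto m t {i, j} \<omega>) else 0)"
    by (intro sum_le_suminf summableI) auto
  finally show ?thesis by (simp add: of_bool_def)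
next
  case False
  then have "\<not> (\<Sum>j. if j \<noteq> i then of_nat (multiplicity_upto m t {i, j} \<omega>) else 0) > (0 :: ennreal)"
    unfolding degree_pos_iff .
  then show ?thesis by (simp only: of_bool_eq zero_le)
qed

text \<open>A vertex outside \<open>S\<close> is counted outright; a vertex in \<open>S\<close> is bounded by its degree, and each edge meeting \<open>S\<close>
  contributes to at most two degrees.\<close>

lemma num_vertices_le:
  fixes S :: "nat set"
  shows "num_vertices m t \<omega> \<le> (\<Sum>i. indicator (- S) i) +
    2 * (\<integral>\<^sup>+(i, j). (if i < j \<and> (i \<in> S \<or> j \<in> S) then of_nat (multiplicity_upto m t {i, j} \<omega>) else 0) \<partial>count_space UNIV)"
proof -
  let ?g = "\<lambda>e. if e \<inter> S \<noteq> {} then of_nat (multiplicity_upto m t e \<omega>) else (0 :: ennreal)"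
  have "num_vertices m t \<omega> \<le> (\<Sum>i. indicator (- S) i + (\<Sum>j. if j \<noteq> i then ?g {i, j} else 0))"
    unfolding num_vertices_def
  proof (intro suminf_le summableI)
    fix i
    show "of_bool ((\<Sum>j. if j \<noteq> i then of_nat (multiplicity_upto m t {i, j} \<omega>) else 0) > (0 :: ennreal))
       \<le> (indicator (- S) i + (\<Sum>j. if j \<noteq> i then ?g {i, j} else 0) :: ennreal)"
    proof (cases "i \<in> S")
      case True
      then have "(\<lambda>j. if j \<noteq> i then ?g {i, j} else 0) = (\<lambda>j. if j \<noteq> i then of_nat (multiplicity_upto m t {i, j} \<omega>) else 0)"
        by auto
      then show ?thesis using True of_bool_degree_le[of i m t \<omega>] by simp
    qed (auto simp: of_bool_def add_increasing2)
  qed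
  also have "\<dots> = (\<Sum>i. indicator (- S) i) + (\<Sum>i. \<Sum>j. if j \<noteq> i then ?g {i, j} else 0)"
    by (rule suminf_add[symmetric]) auto
  also have "(\<Sum>i. \<Sum>j. if j \<noteq> i then ?g {i, j} else 0)
     = 2 * (\<integral>\<^sup>+(i, j). (if i < j then ?g {i, j} else 0) \<partial>count_space UNIV)"
    by (rule sum_ordered_pairs)
  also have "(\<integral>\<^sup>+(i, j). (if i < j then ?g {i, j} else 0) \<partial>count_space UNIV) =
     (\<integral>\<^sup>+(i, j). (if i < j \<and> (i \<in> S \<or> j \<in> S) then of_nat (multiplicity_upto m t {i, j} \<omega>) else 0) \<partial>count_space UNIV)"
    by (intro nn_integral_cong) auto
  finally show ?thesis .
qed

lemma num_vertices_le_num_edges: "num_vertices m t \<omega> \<le> 2 * num_edges m t \<omega>"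
  using num_vertices_le[of m t \<omega> UNIV] by (simp add: num_edges_eq)

lemma num_vertices_ge_hub:
  "(\<integral>\<^sup>+i. (if i \<noteq> j \<and> P i \<and> multiplicity_upto m t {i, j} \<omega> \<noteq> 0 then 1 else 0) \<partial>count_space UNIV) \<le> num_vertices m t \<omega>"
proof -
  have "(if i \<noteq> j \<and> P i \<and> multiplicity_upto m t {i, j} \<omega> \<noteq> 0 then 1 else 0)
      \<le> (of_bool (\<exists>j. j \<noteq> i \<and> multiplicity_upto m t {i, j} \<omega> \<noteq> 0) :: ennreal)" for i
    unfolding of_bool_def[symmetric] by (rule of_bool_le_ennreal) (auto intro: exI[of _ j])
  then show ?thesis
    unfolding nn_integral_count_space_nat num_vertices_def degree_pos_iff
    by (intro suminf_le summableI)
qed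

lemma eventually_upper_of_deviation:
  fixes X \<mu> a :: "nat \<Rightarrow> real"
  assumes lim: "(\<lambda>k. (X k - \<mu> k) / a k) \<longlonglongrightarrow> 0" and a: "\<And>k. 0 < a k"
    and le: "\<forall>\<^sub>F k in sequentially. \<mu> k \<le> C * a k"
  shows "\<forall>\<^sub>F k in sequentially. X k \<le> (C + 1) * a k"
proof -
  have "\<forall>\<^sub>F k in sequentially. (X k - \<mu> k) / a k < 1" using order_tendstoD(2)[OF lim, of 1] by simp
  then show ?thesis using le
  proof eventually_elim
    case (elim k)
    then have "X k - \<mu> k < a k" using a[of k] by (simp add: divide_less_eq)
    then show ?case using elim by (simp add: algebra_simps)
  qed
qed

lemma eventually_lower_of_deviation:
  fixes X \<mu> a :: "nat \<Rightarrow> real"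
  assumes lim: "(\<lambda>k. (X k - \<mu> k) / a k) \<longlonglongrightarrow> 0" and a: "\<And>k. 0 < a k" and c: "0 < c"
    and ge: "\<forall>\<^sub>F k in sequentially. c * a k \<le> \<mu> k"
  shows "\<forall>\<^sub>F k in sequentially. c / 2 * a k \<le> X k"
proof -
  have "\<forall>\<^sub>F k in sequentially. - (c / 2) < (X k - \<mu> k) / a k" using order_tendstoD(1)[OF lim, of "- (c / 2)"] c by simp
  then show ?thesis using ge
  proof eventually_elim
    case (elim k)
    then have "- (c / 2) * a k < X k - \<mu> k" using a[of k] by (simp add: less_divide_eq)
    then show ?case using elim by (simp add: algebra_simps)
  qed
qed

lemma slowly_varying_ln: "slowly_varying (\<lambda>x. ln (1 + x))"
  unfolding slowly_varying_def
proof (intro conjI allI impI)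
  fix c :: real assume "0 < c"
  then show "((\<lambda>x. ln (1 + c * x) / ln (1 + x)) \<longlongrightarrow> 1) at_top" by real_asymp
qed simp

text \<open>A step \<open>t\<close> lies between consecutive powers \<open>2 ^ k\<close> and \<open>2 ^ Suc k\<close>, and both scales change by at most a factor
  2 between them. Since \<open>N t\<close> is of order \<open>2 ^ k / (k + 1)\<close>, its logarithm is of order \<open>k + 1\<close>, so
  \<open>N t * ln (1 + N t)\<close> is of order \<open>2 ^ k\<close>.\<close>

lemma bigtheta_of_dyadic_bounds:
  fixes E N :: "nat \<Rightarrow> real"
  assumes mono: "mono E" "mono N"
    and e: "0 < e1" "\<forall>\<^sub>F k in sequentially. e1 * 2 ^ k \<le> E (2 ^ k)" "\<forall>\<^sub>F k in sequentially. E (2 ^ k) \<le> e2 * 2 ^ k"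
    and n: "0 < n1" "\<forall>\<^sub>F k in sequentially. n1 * block_scale k \<le> N (2 ^ k)" "\<forall>\<^sub>F k in sequentially. N (2 ^ k) \<le> n2 * block_scale k"
  shows "E \<in> \<Theta>(\<lambda>t. N t * ln (1 + N t))"
proof -
  let ?P = "\<lambda>k. e1 * 2 ^ k \<le> E (2 ^ k) \<and> E (2 ^ k) \<le> e2 * 2 ^ k \<and> n1 * block_scale k \<le> N (2 ^ k) \<and> N (2 ^ k) \<le> n2 * block_scale k
    \<and> 2 + ln 8 - ln n1 \<le> real k / 8"
  have "\<forall>\<^sub>F k in sequentially. 2 + ln 8 - ln n1 \<le> real k / 8" by real_asymp
  with e n have "\<forall>\<^sub>F k in sequentially. ?P k" by (simp add: eventually_conj_iff)
  then obtain k0 where k0: "\<And>k. k0 \<le> k \<Longrightarrow> ?P k" by (auto simp: eventually_sequentially)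
  have e2: "0 < e2"
  proof -
    have "0 < e1 * 2 ^ k0" using e by simp
    also have "\<dots> \<le> e2 * 2 ^ k0" using k0[of k0] by (blast intro: order_trans)
    finally show ?thesis by (simp add: zero_less_mult_iff)
  qed
  have n2: "0 < n2"
  proof -
    have "0 < n1 * block_scale k0" using n block_scale_pos by simp
    also have "\<dots> \<le> n2 * block_scale k0" using k0[of k0] by (blast intro: order_trans)
    finally show ?thesis using block_scale_pos[of k0] by (simp add: zero_less_mult_iff)
  qed
  define A where "A = ln (1 + 2 * n2) + 1"
  have A: "0 < A" unfolding A_def using n2 by (intro add_pos_pos) auto
  have key: "\<exists>k. e1 * 2 ^ k \<le> E t \<and> E t \<le> 2 * e2 * 2 ^ k \<and> n1 / 4 * 2 ^ k \<le> N t * ln (1 + N t) \<and> N t * ln (1 + N t) \<le> 2 * n2 * A * 2 ^ k"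
    if t: "2 ^ k0 \<le> t" for t
  proof -
    have "1 \<le> t" using t one_le_power[of "2::nat" k0] by linarith
    then obtain k where k: "2 ^ k \<le> t" "t < 2 ^ Suc k" using ex_power_ivl1[of 2 t] by auto
    have "k0 \<le> k"
    proof (rule ccontr)
      assume "\<not> k0 \<le> k"
      then have "(2::nat) ^ Suc k \<le> 2 ^ k0" by (intro power_increasing) auto
      then show False using k t by linarith
    qed
    then have P: "?P k" "?P (Suc k)" using k0[of k] k0[of "Suc k"] by auto
    have "E (2 ^ k) \<le> E t" "E t \<le> E (2 ^ Suc k)" "N (2 ^ k) \<le> N t" "N t \<le> N (2 ^ Suc k)"
      using k by (auto intro!: monoD[OF mono(1)] monoD[OF mono(2)])
    then have bE: "e1 * 2 ^ k \<le> E t" "E t \<le> 2 * e2 * 2 ^ k" and bN: "n1 * block_scale k \<le> N t" and "N t \<le> n2 * block_scale (Suc k)"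
      using P by auto
    note this(4)
    also have "n2 * block_scale (Suc k) \<le> n2 * (2 * block_scale k)"
      using n2 by (intro mult_left_mono) (auto simp: block_scale_def intro!: divide_left_mono)
    finally have bN': "N t \<le> 2 * n2 * block_scale k" by simp
    have s: "block_scale k * real (Suc k) = 2 ^ k" by (simp add: block_scale_def)
    have N0: "0 < N t" using bN n block_scale_pos[of k] by (auto intro: less_le_trans[rotated])
    have "block_scale k \<le> 2 ^ k" by (simp add: block_scale_def divide_le_eq)
    then have "2 * n2 * block_scale k \<le> 2 * n2 * 2 ^ k" using n2 by (intro mult_left_mono) auto
    moreover have "1 \<le> (2::real) ^ k" by simp
    ultimately have "1 + N t \<le> (1 + 2 * n2) * 2 ^ k" using bN' unfolding distrib_right mult_1_left by linarith
    then have "ln (1 + N t) \<le> ln ((1 + 2 * n2) * 2 ^ k)" using N0 n2 by (subst ln_le_cancel_iff) auto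
    also have "\<dots> = ln (1 + 2 * n2) + real k * ln 2" using n2 by (simp add: ln_mult ln_realpow)
    also have "\<dots> \<le> ln (1 + 2 * n2) * real (Suc k) + real (Suc k) * 1"
    proof (intro add_mono mult_mono)
      show "ln (1 + 2 * n2) \<le> ln (1 + 2 * n2) * real (Suc k)" using n2 by (simp add: algebra_simps)
    qed (use ln_2_less_1 in auto)
    also have "\<dots> = A * real (Suc k)" by (simp add: A_def algebra_simps)
    finally have lnU: "ln (1 + N t) \<le> A * real (Suc k)" .
    have "N t * ln (1 + N t) \<le> (2 * n2 * block_scale k) * (A * real (Suc k))"
      using bN' lnU N0 n2 block_scale_pos[of k] by (intro mult_mono) auto
    also have "\<dots> = 2 * n2 * A * (block_scale k * real (Suc k))" by simp
    finally have U: "N t * ln (1 + N t) \<le> 2 * n2 * A * 2 ^ k" unfolding s .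
    \<comment> \<open>the tangent of the logarithm at 8 has slope \<open>1 / 8\<close>, small enough to leave \<open>(k + 1) / 4\<close> out of \<open>k ln 2\<close>\<close>
    have "ln (real (Suc k)) = ln 8 + ln (real (Suc k) / 8)" by (simp add: ln_div)
    also have "\<dots> \<le> ln 8 + (real (Suc k) / 8 - 1)" by (intro add_left_mono ln_le_minus_one) simp
    finally have lnk: "ln (real (Suc k)) \<le> ln 8 + (real (Suc k) / 8 - 1)" .
    have l2: "real k * (2/3) \<le> real k * ln 2" using ln2_ge_two_thirds by (intro mult_left_mono) auto
    have "real (Suc k) / 4 \<le> ln n1 + real k * ln 2 - ln (real (Suc k))"
    proof -
      have "(1 + r) / 4 \<le> y + z - u" if "u \<le> v + ((1 + r) / 8 - 1)" "r * (2 / 3) \<le> z" "2 + v - y \<le> r / 8" "0 \<le> r"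
        for r u v y z :: real using that by argo
      moreover have "2 + ln 8 - ln n1 \<le> real k / 8" using P(1) by blast
      ultimately show ?thesis using lnk l2 unfolding of_nat_Suc by simp
    qed
    also have "\<dots> = ln (n1 * block_scale k)"
      using n by (simp add: block_scale_def ln_mult ln_div ln_realpow)
    also have "\<dots> \<le> ln (1 + N t)" using bN N0 n block_scale_pos[of k] by (subst ln_le_cancel_iff) auto
    finally have lnL: "real (Suc k) / 4 \<le> ln (1 + N t)" .
    have "n1 / 4 * 2 ^ k = (n1 * block_scale k) * (real (Suc k) / 4)" unfolding s[symmetric] by simp
    also have "\<dots> \<le> N t * ln (1 + N t)"
      using bN lnL N0 by (intro mult_mono) auto
    finally have L: "n1 / 4 * 2 ^ k \<le> N t * ln (1 + N t)" .
    show ?thesis using bE U L by blast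
  qed
  show ?thesis
  proof (rule bigthetaI)
    show "E \<in> O(\<lambda>t. N t * ln (1 + N t))"
    proof (rule bigoI[where c = "8 * e2 / n1"])
      show "\<forall>\<^sub>F t in at_top. norm (E t) \<le> 8 * e2 / n1 * norm (N t * ln (1 + N t))"
        using eventually_ge_at_top[of "2 ^ k0"]
      proof eventually_elim
        case (elim t)
        then obtain k where k: "e1 * 2 ^ k \<le> E t" "E t \<le> 2 * e2 * 2 ^ k" "n1 / 4 * 2 ^ k \<le> N t * ln (1 + N t)"
          using key[of t] by blast
        have "0 \<le> e1 * 2 ^ k" "0 \<le> n1 / 4 * 2 ^ k" using e n by auto
        then have pos: "0 \<le> E t" "0 \<le> N t * ln (1 + N t)" using k by linarith+
        have "E t \<le> 8 * e2 / n1 * (n1 / 4 * 2 ^ k)" using k n by simp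
        also have "\<dots> \<le> 8 * e2 / n1 * (N t * ln (1 + N t))" using k e2 n by (intro mult_left_mono) auto
        finally show ?case using pos by simp
      qed
    qed
    show "E \<in> \<Omega>(\<lambda>t. N t * ln (1 + N t))"
    proof (rule landau_omega.bigI[where c = "e1 / (2 * n2 * A)"])
      show "\<forall>\<^sub>F t in at_top. e1 / (2 * n2 * A) * norm (N t * ln (1 + N t)) \<le> norm (E t)"
        using eventually_ge_at_top[of "2 ^ k0"]
      proof eventually_elim
        case (elim t)
        then obtain k where k: "e1 * 2 ^ k \<le> E t" "N t * ln (1 + N t) \<le> 2 * n2 * A * 2 ^ k" "n1 / 4 * 2 ^ k \<le> N t * ln (1 + N t)"
          using key[of t] by blast
        have "0 \<le> e1 * 2 ^ k" "0 \<le> n1 / 4 * 2 ^ k" using e n by auto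
        then have pos: "0 \<le> E t" "0 \<le> N t * ln (1 + N t)" using k by linarith+
        have "e1 / (2 * n2 * A) * (N t * ln (1 + N t)) \<le> e1 / (2 * n2 * A) * (2 * n2 * A * 2 ^ k)"
          using k e n2 A by (intro mult_left_mono) auto
        also have "\<dots> = e1 * 2 ^ k" using n2 A by simp
        finally show ?case using pos k by simp
      qed
    qed (use e n2 A in auto)
  qed
qed

theorem mainTheorem2:
  fixes M :: "'a measure" and \<eta> \<xi> \<tau> :: real
    and w :: "nat \<Rightarrow> 'a \<Rightarrow> real" and m :: "nat \<Rightarrow> nat set \<Rightarrow> 'a \<Rightarrow> nat"
  assumes "\<eta> > 0" and "\<xi> > 0" and "0 \<le> \<tau>" and "\<tau> < 1"
    and "edge_exchangeable_sequence M (rapid_beta \<eta> \<tau> \<xi>) w m"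
  shows "\<exists>l. slowly_varying l \<and>
           (AE \<omega> in M.
              (\<forall>t. num_vertices m t \<omega> < \<infinity> \<and> num_edges m t \<omega> < \<infinity>) \<and>
              (\<lambda>t. enn2real (num_edges m t \<omega>))
                \<in> \<Theta>(\<lambda>t. enn2real (num_vertices m t \<omega>) * l (enn2real (num_vertices m t \<omega>))))"
proof (rule exI[of _ "\<lambda>x. ln (1 + x)"], rule conjI[OF slowly_varying_ln])
  interpret edge_exchangeable M "rapid_beta \<eta> \<tau> \<xi>" w m
    using assms(5) by unfold_locales (auto simp: space_rapid_beta sets_rapid_beta)
  obtain c C where cC: "0 < c" "0 < C"
    "\<And>l. emeasure (rapid_beta \<eta> \<tau> \<xi>) (dyadic l) \<le> ennreal (C * level_size l)"
    "\<And>l. l \<ge> 1 \<Longrightarrow> ennreal (c * level_size l) \<le> emeasure (rapid_beta \<eta> \<tau> \<xi>) (dyadic l)"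
    using rapid_beta_dyadic_bounds[OF assms(1-4)] by blast
  have dy: "dyadic l \<in> sets (rapid_beta \<eta> \<tau> \<xi>)" for l
    unfolding sets_rapid_beta using dyadic_sub by (auto simp: sets_restrict_space_iff)
  have weights: "AE \<omega> in M. (\<exists>K. \<forall>l. point_count w (dyadic l) \<omega> \<le> ennreal (K * level_size l)) \<and>
     (\<forall>\<^sub>F l in sequentially. ennreal (c / 4 * level_size l) \<le> point_count w (dyadic l) \<omega>)"
    using AE_point_count_bounds[OF ppp, of dyadic level_size c C] dy level_size_pos summable_level_size cC by auto
  have pow: "0 < (2::real) ^ k" for k by simp
  define small where "small k = (\<lambda>(i, j). {\<omega> \<in> space F. w i \<omega> \<le> 1 / 2 ^ k \<or> w j \<omega> \<le> 1 / 2 ^ k})" for k :: nat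
  have small_F: "small k e \<in> sets F" for k e
    unfolding small_def by (cases e) simp
  note edges = edge_concentration[of "\<lambda>_ _. space F" "\<lambda>k. 2 ^ k", OF sets.top pow summable_inverse_power2]
  note small_edges = edge_concentration[of small block_scale, OF small_F block_scale_pos summable_block_scale]
  have hubs: "AE \<omega> in M. \<forall>j. (\<exists>K. \<forall>k. (\<integral>\<^sup>+i. ennreal (if i \<noteq> j \<and> w i \<omega> \<le> 1 / 2 ^ k then 1 - (1 - w i \<omega> * w j \<omega>) ^ (2 ^ k) else 0) \<partial>count_space UNIV) \<le> ennreal (K * block_scale k)) \<longrightarrow>
     (\<forall>k. (\<integral>\<^sup>+i. (if i \<noteq> j \<and> w i \<omega> \<le> 1 / 2 ^ k \<and> multiplicity_upto m (2 ^ k) {i, j} \<omega> \<noteq> 0 then 1 else 0) \<partial>count_space UNIV) < \<infinity>) \<and>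
     (\<lambda>k. (enn2real (\<integral>\<^sup>+i. (if i \<noteq> j \<and> w i \<omega> \<le> 1 / 2 ^ k \<and> multiplicity_upto m (2 ^ k) {i, j} \<omega> \<noteq> 0 then 1 else 0) \<partial>count_space UNIV)
       - enn2real (\<integral>\<^sup>+i. ennreal (if i \<noteq> j \<and> w i \<omega> \<le> 1 / 2 ^ k then 1 - (1 - w i \<omega> * w j \<omega>) ^ (2 ^ k) else 0) \<partial>count_space UNIV)) / block_scale k) \<longlonglongrightarrow> 0"
    by (intro AE_all_countable[THEN iffD2] allI hub_concentration[OF block_scale_pos summable_block_scale])
  show "AE \<omega> in M. (\<forall>t. num_vertices m t \<omega> < \<infinity> \<and> num_edges m t \<omega> < \<infinity>) \<and>
      (\<lambda>t. enn2real (num_edges m t \<omega>)) \<in> \<Theta>(\<lambda>t. enn2real (num_vertices m t \<omega>) * ln (1 + enn2real (num_vertices m t \<omega>)))"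
    using AE_space weights edges small_edges hubs
  proof eventually_elim
    case (elim \<omega>)
    let ?E = "\<lambda>t. num_edges m t \<omega>" and ?N = "\<lambda>t. num_vertices m t \<omega>"
    define x where "x i = w i \<omega>" for i
    have pc: "point_count w (dyadic l) \<omega> = (\<Sum>i. indicator (dyadic l) (x i))" for l
      by (simp add: point_count_def x_def)
    obtain K' where K': "\<And>l. point_count w (dyadic l) \<omega> \<le> ennreal (K' * level_size l)" using elim(2) by blast
    \<comment> \<open>truncated at 0 only to make the sign of the constant explicit\<close>
    define K where "K = max K' 0"
    have K: "point_count w (dyadic l) \<omega> \<le> ennreal (K * level_size l)" for l
      using K'[of l] by (rule order_trans) (use level_size_pos[of l] in \<open>auto simp: K_def intro!: ennreal_leI mult_right_mono\<close>)
    interpret level_bounded_weights x K "c / 4"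
      using elim(1,2) K cC(1) w_bounds[OF elim(1)]
      by unfold_locales (auto simp: pc x_def K_def)
    define E1 where "E1 = enn2real (\<integral>\<^sup>+e. ennreal (edge_rate x e) \<partial>count_space UNIV)"
    have E1_fin: "(\<integral>\<^sup>+e. ennreal (edge_rate x e) \<partial>count_space UNIV) < \<infinity>"
      using edge_rate_sum_finite by (rule le_less_trans) simp
    have E1: "(\<integral>\<^sup>+e. ennreal (edge_rate x e) \<partial>count_space UNIV) = ennreal E1" "0 < E1"
      using edge_rate_sum_pos E1_fin by (auto simp: E1_def enn2real_positive_iff)
    have \<mu>_edge: "(\<integral>\<^sup>+(i, j). (if i < j \<and> \<omega> \<in> space F then ennreal (w i \<omega> * w j \<omega>) else 0) \<partial>count_space UNIV) = ennreal E1"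
      unfolding E1(1)[symmetric] using elim(1)
      by (intro nn_integral_cong) (auto simp: edge_rate_def x_def space_F)
    have X_edge: "(\<integral>\<^sup>+(i, j). (if i < j \<and> \<omega> \<in> space F then of_nat (multiplicity_upto m (2 ^ k) {i, j} \<omega>) else 0) \<partial>count_space UNIV) = ?E (2 ^ k)" for k
      unfolding num_edges_eq using elim(1) by (simp add: space_F)
    have "\<forall>k. ennreal (2 ^ k) * ennreal E1 \<le> ennreal (E1 * 2 ^ k)"
      using E1(2) by (simp add: ennreal_mult[symmetric] mult.commute)
    with elim(3) have E_fin: "\<And>k. ?E (2 ^ k) < \<infinity>" and
      E_lim: "(\<lambda>k. (enn2real (?E (2 ^ k)) - enn2real (ennreal (2 ^ k) * ennreal E1)) / 2 ^ k) \<longlonglongrightarrow> 0"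
      unfolding \<mu>_edge X_edge by blast+
    have E_fin': "?E t < \<infinity>" for t
      using num_edges_mono[of t "2 ^ t" m \<omega>] E_fin[of t] by (auto intro: le_less_trans less_imp_le)
    have N_fin: "?N t < \<infinity>" for t
    proof -
      have "2 * ?E t < \<infinity>" using E_fin'[of t] by (simp add: ennreal_mult_less_top)
      with num_vertices_le_num_edges show ?thesis by (rule le_less_trans)
    qed
    have E_low: "\<forall>\<^sub>F k in sequentially. E1 / 2 * 2 ^ k \<le> enn2real (?E (2 ^ k))"
      using E1(2) by (intro eventually_lower_of_deviation[OF E_lim]) (auto simp: enn2real_mult)
    have E_up: "\<forall>\<^sub>F k in sequentially. enn2real (?E (2 ^ k)) \<le> (E1 + 1) * 2 ^ k"
      using E1(2) by (intro eventually_upper_of_deviation[OF E_lim]) (auto simp: enn2real_mult)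

    let ?D = "\<lambda>k. \<integral>\<^sup>+(i, j). (if i < j \<and> (x i \<le> 1 / 2 ^ k \<or> x j \<le> 1 / 2 ^ k) then of_nat (multiplicity_upto m (2 ^ k) {i, j} \<omega>) else 0) \<partial>count_space UNIV"
    let ?\<mu>D = "\<lambda>k. ennreal (2 ^ k) * (\<integral>\<^sup>+e. ennreal (small_edge_rate k x e) \<partial>count_space UNIV)"
    have \<mu>_small: "ennreal (2 ^ k) * (\<integral>\<^sup>+(i, j). (if i < j \<and> \<omega> \<in> small k (i, j) then ennreal (w i \<omega> * w j \<omega>) else 0) \<partial>count_space UNIV) = ?\<mu>D k" for k
      using elim(1)
      by (intro arg_cong[where f = "\<lambda>y. ennreal (2 ^ k) * y"] nn_integral_cong) (auto simp: small_edge_rate_def small_def x_def space_F)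
    have X_small: "(\<integral>\<^sup>+(i, j). (if i < j \<and> \<omega> \<in> small k (i, j) then of_nat (multiplicity_upto m (2 ^ k) {i, j} \<omega>) else 0) \<partial>count_space UNIV) = ?D k" for k
      using elim(1) by (simp add: small_def x_def space_F)
    have \<mu>D_le: "?\<mu>D k \<le> ennreal (2 * K * K * block_scale k)" for k
    proof -
      have "?\<mu>D k \<le> ennreal (2 ^ k) * ennreal (2 * K * K / real (Suc k))"
        by (intro mult_left_mono small_edge_rate_sum_le) auto
      also have "\<dots> = ennreal (2 * K * K * block_scale k)"
        by (subst ennreal_mult[symmetric]) (auto simp: block_scale_def K_def)
      finally show ?thesis .
    qed
    with elim(4) have D_fin: "\<And>k. ?D k < \<infinity>" and
      D_lim: "(\<lambda>k. (enn2real (?D k) - enn2real (?\<mu>D k)) / block_scale k) \<longlonglongrightarrow> 0"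
      unfolding \<mu>_small X_small by blast+
    have D_up: "\<forall>\<^sub>F k in sequentially. enn2real (?D k) \<le> (2 * K * K + 1) * block_scale k"
    proof (rule eventually_upper_of_deviation[OF D_lim block_scale_pos], rule always_eventually, rule allI)
      fix k
      show "enn2real (?\<mu>D k) \<le> 2 * K * K * block_scale k"
        using enn2real_mono[OF \<mu>D_le[of k]] block_scale_pos[of k] by (simp add: K_def)
    qed
    have N_up: "\<forall>\<^sub>F k in sequentially. enn2real (?N (2 ^ k)) \<le> (4 * K + 2 * (2 * K * K + 1)) * block_scale k"
      using D_up
    proof eventually_elim
      case (elim k)
      let ?d = "(2 * K * K + 1) * block_scale k"
      have "?D k = ennreal (enn2real (?D k))" using D_fin[of k] by simp
      also have "\<dots> \<le> ennreal ?d" using elim by (rule ennreal_leI)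
      finally have D: "?D k \<le> ennreal ?d" .
      have "?N (2 ^ k) \<le> (\<Sum>i. indicator (- {i. x i \<le> 1 / 2 ^ k}) i) + 2 * ?D k"
        using num_vertices_le[of m "2 ^ k" \<omega> "{i. x i \<le> 1 / 2 ^ k}"] by simp
      also have "(\<Sum>i. indicator (- {i. x i \<le> 1 / 2 ^ k}) i :: ennreal) = (\<Sum>i. indicator {1 / 2 ^ k<..} (x i))"
        by (intro suminf_cong) (auto simp: not_le split: split_indicator)
      also have "\<dots> + 2 * ?D k \<le> ennreal (4 * K * block_scale k) + ennreal 2 * ennreal ?d"
        using D by (intro add_mono large_count_le mult_mono) auto
      also have "\<dots> = ennreal ((4 * K + 2 * (2 * K * K + 1)) * block_scale k)"
      proof -
        have nonneg: "0 \<le> 4 * K * block_scale k" "0 \<le> ?d"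
          using K0 less_imp_le[OF block_scale_pos, of k] by (auto intro!: mult_nonneg_nonneg add_nonneg_nonneg)
        have "(4 * K + 2 * (2 * K * K + 1)) * block_scale k = 4 * K * block_scale k + 2 * ?d"
          by (simp add: algebra_simps)
        also have "ennreal \<dots> = ennreal (4 * K * block_scale k) + ennreal (2 * ?d)"
          using nonneg by (intro ennreal_plus) auto
        also have "ennreal (2 * ?d) = ennreal 2 * ennreal ?d" using nonneg by (intro ennreal_mult) auto
        finally show ?thesis ..
      qed
      finally have "enn2real (?N (2 ^ k)) \<le> enn2real (ennreal ((4 * K + 2 * (2 * K * K + 1)) * block_scale k))"
        by (rule enn2real_mono) simp
      then show ?case using block_scale_pos[of k] by (simp add: K_def)
    qed

    \<comment> \<open>the hub depends on \<open>\<omega>\<close>, which is why \<open>hubs\<close> covers all \<open>j\<close> at once\<close>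
    obtain j where j: "0 < x j" using ex_small_positive[of 0] by blast
    let ?L = "\<lambda>k. \<integral>\<^sup>+i. (if i \<noteq> j \<and> x i \<le> 1 / 2 ^ k \<and> multiplicity_upto m (2 ^ k) {i, j} \<omega> \<noteq> 0 then 1 else 0) \<partial>count_space UNIV"
    let ?\<mu>L = "\<lambda>k. \<integral>\<^sup>+i. ennreal (hub_prob j k x i) \<partial>count_space UNIV"
    have "\<exists>K. \<forall>k. ?\<mu>L k \<le> ennreal (K * block_scale k)" using hub_sum_le by blast
    then have L_lim: "(\<lambda>k. (enn2real (?L k) - enn2real (?\<mu>L k)) / block_scale k) \<longlonglongrightarrow> 0"
      using elim(5)[rule_format, of j] unfolding hub_prob_def x_def by blast
    have "\<forall>\<^sub>F k in sequentially. x j * (c / 4) / 4 * block_scale k \<le> enn2real (?\<mu>L k)"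
      using hub_sum_ge[OF j]
    proof eventually_elim
      case (elim k)
      have "?\<mu>L k < \<infinity>" using hub_sum_le by (rule le_less_trans) simp
      then have "enn2real (ennreal (x j * (c / 4) / 4 * block_scale k)) \<le> enn2real (?\<mu>L k)"
        using elim by (intro enn2real_mono) auto
      then show ?case using j cC(1) block_scale_pos[of k] by simp
    qed
    then have L_low: "\<forall>\<^sub>F k in sequentially. x j * (c / 4) / 4 / 2 * block_scale k \<le> enn2real (?L k)"
      using j cC(1) by (intro eventually_lower_of_deviation[OF L_lim block_scale_pos]) auto
    have N_low: "\<forall>\<^sub>F k in sequentially. x j * (c / 4) / 4 / 2 * block_scale k \<le> enn2real (?N (2 ^ k))"
      using L_low
    proof eventually_elim
      case (elim k)
      have "enn2real (?L k) \<le> enn2real (?N (2 ^ k))"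
        using N_fin[of "2 ^ k"] by (intro enn2real_mono num_vertices_ge_hub) auto
      with elim show ?case by linarith
    qed
    have "mono (\<lambda>t. enn2real (?E t))" "mono (\<lambda>t. enn2real (?N t))"
      using E_fin' N_fin by (auto intro!: monoI enn2real_mono num_edges_mono num_vertices_mono)
    then have "(\<lambda>t. enn2real (?E t)) \<in> \<Theta>(\<lambda>t. enn2real (?N t) * ln (1 + enn2real (?N t)))"
      by (rule bigtheta_of_dyadic_bounds[OF _ _ _ E_low E_up _ N_low N_up]) (use E1(2) j cC(1) in auto)
    then show ?case using E_fin' N_fin by blast
  qed
qed

end
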